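(* Let $\mathcal M=(K_{i(e)},w_e,p_e)_{e\in E}$ be a Markov system on a complete metric space $(K,d)$ which is uniformly continuous, non-degenerate, contractive, and satisfies: - (absolute continuity condition) $P_x\ll P_y$ for all $i\in N$ and $x,y\in K_i$; - $\sup_{i\in N}\sup_{x\in K_i}\sum_{e\in E,\,i(e)=i}p_e(x)\,d\left(w_e(x_{i(e)}),x_{t(e)}\right)<\infty$; - (dominating Markov chain) $\sum_{e\in E,\,i(e)=i}\sup_{x\in K_i}p_e(x)<\infty$ for every $i\in N$. Suppose that $-\sum_{e\in E}p_e\log p_e$ is bounded. Then for every $i\in I_G$ there exists an ergodic $\lambda_i\in P(\mathcal M)$ such that for every $x\in C_i$, $$\lim_{n\to\infty}\frac1n\log P_x\left({}_1[\sigma_1,\dots,\sigma_n]^+\right)=\sum_{e\in E}\int_{K_{i(e)}}p_e\log p_e\,d\lambda_i$$ for $P_x$-a.e. $\sigma\in\Sigma^+$.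
   Context: Markov system. A Markov system $\mathcal M=(K_{i(e)},w_e,p_e)_{e\in E}$ on a complete metric space $(K,d)$ consists of: an at most countable set $E$; Borel measurable maps $w_e:K\to K$ and Borel measurable functions $p_e:K\to[0,1]$ ($e\in E$) with $\sum_{e\in E}p_e(x)=1$ for all $x\in K$; a partition $(K_i)_{i\in N}$ of $K$ into non-empty Borel sets (vertex sets; $N$ is the set of vertices); and maps $i,t:E\to N$, with $i$ surjective (so $N$ is at most countable), such that $\emptyset\neq\{p_e>0\}\subset K_{i(e)}$ and $w_e(K_{i(e)})\subset K_{t(e)}$ for all $e\in E$. It is positive if $p_e>0$ on $K_{i(e)}$ for all $e$ (this is implied by the absolute continuity condition); uniformly continuous if $w_e|_{K_{i(e)}}$ and $p_e|_{K_{i(e)}}$ are uniformly continuous for all $e$; contractive if there is $0<a<1$ with $\sum_{e\in E,\,i(e)=j}p_e(x)d(w_ex,w_ey)\le a\,d(x,y)$ for all $x,y\in K_j$, $j\in N$. Markov operator and invariant measures. For Borel $f\ge0$ on $K$, $Uf:=\sum_{e\in E}p_e\,f\circ w_e$; for $\nu$ a Borel probability measure on $K$, $U^*\nu(f):=\int Uf\,d\nu$. $P(\mathcal M)$ is the set of Borel probability measures $\mu$ on $K$ with $U^*\mu=\mu$. $\mu\in P(\mathcal M)$ is called ergodic if for every $\lambda\in P(\mathcal M)$, $\lambda\ll\mu$ implies $\lambda=\mu$. Communication classes. $(e_1,\dots,e_n)\in E^n$ is a path if $i(e_{m+1})=t(e_m)$ for $1\le m\le n-1$; it goes from $i(e_1)$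 to $t(e_n)$. $j\in N$ is accessible from $i\in N$ if $i=j$ or there is a path from $i$ to $j$. Two vertices communicate if each is accessible from the other. $i$ is essential if it communicates with every vertex accessible from it. $(c_i)_{i\in I}$ is the partition of the set of essential vertices into communication equivalence classes and $C_i:=\bigcup_{j\in c_i}K_j$. Generating classes. $x_0\in K$ is generating if the probability measures $\alpha_n^{x_0}$ on $N$, $\alpha_n^{x_0}\{j\}:=\frac1n\sum_{k=1}^n(U^* )^k\delta_{x_0}(K_j)$, $n\in\mathbb N$, are uniformly tight (for each $\epsilon>0$ there is a finite $V\subset N$ with $\alpha^{x_0}_n(N\setminus V)<\epsilon$ for all $n$). A vertex $i_0$ is generating if $K_{i_0}$ contains a generating point. For positive $\mathcal M$, the class $c_i$ (or $C_i$) is generating if some $j\in c_i$ is generating; $I_G\subset I$ is the set of indices of generating classes. Code space. $\bar E:=E\cup\{\infty\}$ is the one-point compactification of the discrete space $E$; $w_\infty:=\mathrm{id}$, $p_\infty:=0$, $i(\infty)=t(\infty)=n_\infty$ for a fixed $n_\infty\in N$. $\Sigma:=\bar E^{\mathbb Z}$, $\Sigma^+:=\bar E^{\mathbb N}$ with product topologies and Borel $\sigma$-algebras; ${}_m[e_m,\dots,e_n]=\{\sigma\in\Sigma:\sigma_i=e_i,\ m\le i\le n\}$, and ${}_m[e_m,\dots,e_n]^+$ denotes the analogous cylinder in $\Sigma^+$. $S$ is the left shift on $\Sigma$, $(S\sigma)_{i-1}=\sigma_i$; $P_S(\Sigma)$ is the set of $S$-invariant Borel probability measures. $\mathcal F$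 is the $\sigma$-algebra on $\Sigma$ generated by all cylinders ${}_m[e_m,\dots,e_0]$, $m\le0$. $\Sigma_G:=\{\sigma\in\Sigma:\sigma_n\in E,\ i(\sigma_{n+1})=t(\sigma_n)\ \forall n\in\mathbb Z\}$. For $x\in K$, $P_x$ is the Borel probability measure on $\Sigma^+$ with $P_x({}_1[e_1,\dots,e_k]^+)=p_{e_1}(x)p_{e_2}(w_{e_1}x)\cdots p_{e_k}(w_{e_{k-1}}\circ\cdots\circ w_{e_1}x)$. Coding map and non-degeneracy. Points $x_i\in K_i$, $i\in N$, are fixed once and for all (they are the points $x_{i(e)},x_{t(e)}$ in the claim). $D:=\{\sigma\in\Sigma_G:\lim_{m\to-\infty}w_{\sigma_0}\circ w_{\sigma_{-1}}\circ\cdots\circ w_{\sigma_m}(x_{i(\sigma_m)})\text{ exists}\}$. The coding map $F:\Sigma\to K$ is $F(\sigma):=$ this limit if $\sigma\in D$, and $F(\sigma):=x_{t(\sigma_0)}$ otherwise. Let $T_j:=\{\sigma\in\Sigma_G:t(\sigma_0)=j\}$, and let $\bar p_e$ be the continuous extension of $p_e|_{K_{i(e)}}$ to the closure $\bar K_{i(e)}$, extended by $0$ to $K$. $\tilde E(\mathcal M):=\{\Lambda\in P_S(\Sigma):\Lambda(D)=1$ and $E_\Lambda(1_{{}_1[e]}|\mathcal F)=(\bar p_e\circ F)1_{T_{i(e)}}$ $\Lambda$-a.e. for all $e\in E\}$. $\mathcal M$ is non-degenerate if for every $\Lambda\in\tilde E(\mathcal M)$ there is $i\in N$ with $\Lambda(T_i\cap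 F^{-1}(K_i))>0$. Convention: $0\log0:=0$. *)

theory Defs
  imports "HOL-Probability.Probability"
begin

section \<open>Markov systems\<close>

text \<open>
  The complete metric space is a type of class \<^class>\<open>complete_space\<close>, the edge set is a type of
  class \<^class>\<open>countable\<close>, and the vertex set is a type, countable because \<open>src\<close> is surjective.
  All sums of nonnegative terms are taken in \<^typ>\<open>ennreal\<close>, so that divergence is the value
  \<open>\<infinity>\<close> and not the default \<open>0\<close> of a non-summable real family.
\<close>

record ('a, 'v, 'e) markov_sys =
  vert :: "'v \<Rightarrow> 'a set"
  src :: "'e \<Rightarrow> 'v"
  tgt :: "'e \<Rightarrow> 'v"
  wmap :: "'e \<Rightarrow> 'a \<Rightarrow> 'a"
  prb :: "'e \<Rightarrow> 'a \<Rightarrow> real"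

definition markov_system :: "('a::complete_space, 'v, 'e::countable) markov_sys \<Rightarrow> bool" where
  "markov_system M \<longleftrightarrow>
     (\<forall>j. vert M j \<noteq> {} \<and> vert M j \<in> sets borel) \<and>
     disjoint_family (vert M) \<and> (\<Union>j. vert M j) = UNIV \<and>
     surj (src M) \<and>
     (\<forall>e. wmap M e \<in> borel_measurable borel) \<and>
     (\<forall>e. prb M e \<in> borel_measurable borel) \<and>
     (\<forall>e x. 0 \<le> prb M e x \<and> prb M e x \<le> 1) \<and>
     (\<forall>x. ((\<lambda>e. prb M e x) has_sum 1) UNIV) \<and>
     (\<forall>e. {x. 0 < prb M e x} \<noteq> {} \<and> {x. 0 < prb M e x} \<subseteq> vert M (src M e)) \<and>
     (\<forall>e. wmap M e ` vert M (src M e) \<subseteq> vert M (tgt M e))"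

definition uniformly_continuous_system ::
    "('a::complete_space, 'v, 'e::countable) markov_sys \<Rightarrow> bool" where
  "uniformly_continuous_system M \<longleftrightarrow>
     (\<forall>e. uniformly_continuous_on (vert M (src M e)) (wmap M e) \<and>
          uniformly_continuous_on (vert M (src M e)) (prb M e))"

definition contractive :: "('a::complete_space, 'v, 'e::countable) markov_sys \<Rightarrow> bool" where
  "contractive M \<longleftrightarrow>
     (\<exists>a. 0 < a \<and> a < 1 \<and>
       (\<forall>j. \<forall>x\<in>vert M j. \<forall>y\<in>vert M j.
          (\<Sum>\<^sub>\<infinity>e\<in>{e. src M e = j}. ennreal (prb M e x * dist (wmap M e x) (wmap M e y)))
            \<le> ennreal (a * dist x y)))"


section \<open>Markov operator and invariant measures\<close>

definition markov_op ::
    "('a::complete_space, 'v, 'e::countable) markov_sys \<Rightarrow> ('a \<Rightarrow> ennreal) \<Rightarrow> 'a \<Rightarrow> ennreal" where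
  "markov_op M f x = (\<Sum>\<^sub>\<infinity>e. ennreal (prb M e x) * f (wmap M e x))"

definition markov_dual ::
    "('a::complete_space, 'v, 'e::countable) markov_sys \<Rightarrow> 'a measure \<Rightarrow> 'a measure" where
  "markov_dual M \<nu> = measure_of UNIV (sets borel) (\<lambda>A. \<integral>\<^sup>+x. markov_op M (indicator A) x \<partial>\<nu>)"

lemma infsum_ennreal_eq_nn_integral:
  fixes f :: "'b::countable \<Rightarrow> ennreal"
  shows "(\<Sum>\<^sub>\<infinity>x. f x) = (\<integral>\<^sup>+x. f x \<partial>count_space UNIV)"
proof -
  have le: "(\<Sum>x\<in>F. f x) \<le> (\<integral>\<^sup>+x. f x \<partial>count_space UNIV)" if "finite F" for F
  proof -
    have "(\<Sum>x\<in>F. f x) = (\<integral>\<^sup>+x. f x \<partial>count_space F)"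
      using that by (simp add: nn_integral_count_space_finite)
    also have "\<dots> = (\<integral>\<^sup>+x. f x * indicator F x \<partial>count_space UNIV)"
      by (simp add: nn_integral_count_space_indicator)
    also have "\<dots> \<le> (\<integral>\<^sup>+x. f x \<partial>count_space UNIV)"
      by (intro nn_integral_mono) (auto simp: indicator_def)
    finally show ?thesis .
  qed
  have "(\<integral>\<^sup>+x. f x \<partial>count_space UNIV)
      = (\<integral>\<^sup>+x. f x * (SUP n. indicator {x. to_nat x < n} x) \<partial>count_space UNIV)"
  proof (intro nn_integral_cong)
    fix x :: 'b
    have "(SUP n. indicator {x. to_nat x < n} x) = (1::ennreal)"
      by (intro antisym SUP_least SUP_upper2[of "Suc (to_nat x)"]) (auto simp: indicator_def)
    then show "f x = f x * (SUP n. indicator {x. to_nat x < n} x)" by simp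
  qed
  also have "\<dots> = (\<integral>\<^sup>+x. (SUP n. f x * indicator {x. to_nat x < n} x) \<partial>count_space UNIV)"
    by (simp add: SUP_mult_left_ennreal)
  also have "\<dots> = (SUP n. \<integral>\<^sup>+x. f x * indicator {x. to_nat x < n} x \<partial>count_space UNIV)"
    by (intro nn_integral_monotone_convergence_SUP)
       (auto simp: incseq_def le_fun_def indicator_def)
  also have "\<dots> = (SUP n. \<Sum>x | to_nat x < n. f x)"
  proof -
    have "finite {x::'b. to_nat x < n}" for n
      using finite_vimageI[of "{..<n}" "to_nat :: 'b \<Rightarrow> nat"] by (auto simp: vimage_def)
    then show ?thesis
      by (simp add: nn_integral_count_space_indicator[symmetric] nn_integral_count_space_finite)
  qed
  also have "\<dots> \<le> (SUP F\<in>{F. finite F \<and> F \<subseteq> UNIV}. \<Sum>x\<in>F. f x)"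
  proof (intro SUP_least SUP_upper)
    fix n show "{x::'b. to_nat x < n} \<in> {F. finite F \<and> F \<subseteq> UNIV}"
      using finite_vimageI[of "{..<n}" "to_nat :: 'b \<Rightarrow> nat"] by (auto simp: vimage_def)
  qed
  finally have "(\<integral>\<^sup>+x. f x \<partial>count_space UNIV) \<le> (SUP F\<in>{F. finite F \<and> F \<subseteq> UNIV}. \<Sum>x\<in>F. f x)" .
  then show ?thesis
    using le by (subst nonneg_infsum_complete) (auto intro!: antisym SUP_least)
qed

lemma nn_integral_markov_op:
  assumes M: "markov_system M" and \<nu>: "sets \<nu> = sets borel"
    and f: "f \<in> borel_measurable borel"
  shows "(\<integral>\<^sup>+x. markov_op M f x \<partial>\<nu>) =
    (\<integral>\<^sup>+e. (\<integral>\<^sup>+x. ennreal (prb M e x) * f (wmap M e x) \<partial>\<nu>) \<partial>count_space UNIV)"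
proof -
  have [measurable]: "wmap M e \<in> borel_measurable borel" "prb M e \<in> borel_measurable borel" for e
    using M by (auto simp: markov_system_def)
  note f[measurable] \<nu>[measurable_cong]
  have "(\<lambda>x. ennreal (prb M e x) * f (wmap M e x)) \<in> borel_measurable \<nu>" for e by measurable
  then show ?thesis unfolding markov_op_def infsum_ennreal_eq_nn_integral
    by (subst nn_integral_count_space_nn_integral) auto
qed

lemma sets_markov_dual [simp]: "sets (markov_dual M \<nu>) = sets borel"
  and space_markov_dual [simp]: "space (markov_dual M \<nu>) = UNIV"
  unfolding markov_dual_def using sets.sigma_sets_eq[of borel]
  by (auto simp: space_measure_of_conv sets_measure_of_conv)

lemma emeasure_markov_dual:
  assumes M: "markov_system M" and \<nu>: "sets \<nu> = sets borel" and A: "A \<in> sets borel"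
  shows "emeasure (markov_dual M \<nu>) A = (\<integral>\<^sup>+x. markov_op M (indicator A) x \<partial>\<nu>)"
proof -
  have [measurable]: "wmap M e \<in> borel_measurable borel" "prb M e \<in> borel_measurable borel" for e
    using M by (auto simp: markov_system_def)
  note \<nu>[measurable_cong]
  have "countably_additive (sets borel) (\<lambda>A. \<integral>\<^sup>+x. markov_op M (indicator A) x \<partial>\<nu>)"
  proof (rule countably_additiveI)
    fix A :: "nat \<Rightarrow> 'a set"
    assume A: "range A \<subseteq> sets borel" "disjoint_family A" "(\<Union>i. A i) \<in> sets borel"
    have [measurable]: "A n \<in> sets borel" for n using A by auto
    have meas: "(\<lambda>x. ennreal (prb M e x) * indicator (A n) (wmap M e x)) \<in> borel_measurable \<nu>" for n e
      by measurable
    have "(\<Sum>n. \<integral>\<^sup>+x. markov_op M (indicator (A n)) x \<partial>\<nu>)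
      = (\<Sum>n. \<integral>\<^sup>+e. (\<integral>\<^sup>+x. ennreal (prb M e x) * indicator (A n) (wmap M e x) \<partial>\<nu>) \<partial>count_space UNIV)"
      by (subst nn_integral_markov_op[OF M \<nu>]) auto
    also have "\<dots> = (\<integral>\<^sup>+e. (\<Sum>n. \<integral>\<^sup>+x. ennreal (prb M e x) * indicator (A n) (wmap M e x) \<partial>\<nu>) \<partial>count_space UNIV)"
      by (rule nn_integral_suminf[symmetric]) simp
    also have "\<dots> = (\<integral>\<^sup>+e. (\<integral>\<^sup>+x. (\<Sum>n. ennreal (prb M e x) * indicator (A n) (wmap M e x)) \<partial>\<nu>) \<partial>count_space UNIV)"
      using meas by (intro nn_integral_cong nn_integral_suminf[symmetric])
    also have "\<dots> = (\<integral>\<^sup>+x. markov_op M (indicator (\<Union>n. A n)) x \<partial>\<nu>)"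
      using A by (subst nn_integral_markov_op[OF M \<nu>]) (auto simp: suminf_indicator)
    finally show "(\<Sum>n. \<integral>\<^sup>+x. markov_op M (indicator (A n)) x \<partial>\<nu>)
      = (\<integral>\<^sup>+x. markov_op M (indicator (\<Union>n. A n)) x \<partial>\<nu>)" .
  qed
  moreover have "markov_op M (indicator {}) = (\<lambda>_. 0)"
    by (auto simp: markov_op_def)
  ultimately show ?thesis using A sets.sigma_algebra_axioms[of "borel :: 'a measure"]
    unfolding markov_dual_def
    by (intro emeasure_measure_of_sigma) (auto simp: positive_def)
qed

lemma nn_integral_markov_dual:
  assumes M: "markov_system M" and \<nu>: "sets \<nu> = sets borel"
    and f: "f \<in> borel_measurable borel"
  shows "(\<integral>\<^sup>+x. f x \<partial>markov_dual M \<nu>) = (\<integral>\<^sup>+x. markov_op M f x \<partial>\<nu>)"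
proof -
  have [measurable]: "wmap M e \<in> borel_measurable borel" "prb M e \<in> borel_measurable borel" for e
    using M by (auto simp: markov_system_def)
  note \<nu>[measurable_cong]
  note op = nn_integral_markov_op[OF M \<nu>]
  from f show ?thesis
  proof (induction rule: borel_measurable_induct)
    case (cong f g)
    then have "f = g" by auto
    with cong show ?case by simp
  next
    case (set A)
    then show ?case using emeasure_markov_dual[OF M \<nu>] by simp
  next
    case (mult u c)
    note [measurable] = mult(2)
    have "(\<integral>\<^sup>+x. c * u x \<partial>markov_dual M \<nu>) = c * (\<integral>\<^sup>+x. u x \<partial>markov_dual M \<nu>)"
      by (rule nn_integral_cmult) (use mult in \<open>simp cong: measurable_cong_sets\<close>)
    also have "\<dots> = (\<integral>\<^sup>+x. markov_op M (\<lambda>x. c * u x) x \<partial>\<nu>)"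
      unfolding mult by (subst (1 2) op)
        (auto simp: nn_integral_cmult mult.left_commute[of _ c])
    finally show ?case .
  next
    case (add u v)
    note [measurable] = add(1,3)
    have "(\<integral>\<^sup>+x. v x + u x \<partial>markov_dual M \<nu>)
        = (\<integral>\<^sup>+x. v x \<partial>markov_dual M \<nu>) + (\<integral>\<^sup>+x. u x \<partial>markov_dual M \<nu>)"
      by (rule nn_integral_add) (use add in \<open>simp_all cong: measurable_cong_sets\<close>)
    also have "\<dots> = (\<integral>\<^sup>+x. markov_op M (\<lambda>x. v x + u x) x \<partial>\<nu>)"
      unfolding add by (subst (1 2 3) op)
        (auto simp: nn_integral_add distrib_left)
    finally show ?case .
  next
    case (seq U)
    note [measurable] = seq(1)
    have inc: "incseq (\<lambda>i x. ennreal (prb M e x) * U i (wmap M e x))" for e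
      using seq(3) by (auto simp: incseq_def le_fun_def intro!: mult_left_mono)
    have inc': "incseq (\<lambda>i e. \<integral>\<^sup>+x. ennreal (prb M e x) * U i (wmap M e x) \<partial>\<nu>)"
      using inc by (auto simp: incseq_def le_fun_def intro!: nn_integral_mono)
    have "(\<integral>\<^sup>+x. (SUP i. U i x) \<partial>markov_dual M \<nu>) = (SUP i. \<integral>\<^sup>+x. U i x \<partial>markov_dual M \<nu>)"
      by (rule nn_integral_monotone_convergence_SUP)
         (use seq in \<open>simp_all cong: measurable_cong_sets\<close>)
    also have "\<dots> = (\<integral>\<^sup>+x. markov_op M (\<lambda>x. SUP i. U i x) x \<partial>\<nu>)"
      unfolding seq using inc inc' by (subst (1 2) op)
        (auto simp: SUP_mult_left_ennreal nn_integral_monotone_convergence_SUP)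
    finally show ?case by (simp add: image_comp comp_def SUP_apply[abs_def])
  qed
qed

definition invariant_measures ::
    "('a::complete_space, 'v, 'e::countable) markov_sys \<Rightarrow> 'a measure set" where
  "invariant_measures M = {\<mu>. prob_space \<mu> \<and> sets \<mu> = sets borel \<and> markov_dual M \<mu> = \<mu>}"

definition ergodic_measure ::
    "('a::complete_space, 'v, 'e::countable) markov_sys \<Rightarrow> 'a measure \<Rightarrow> bool" where
  "ergodic_measure M \<mu> \<longleftrightarrow> \<mu> \<in> invariant_measures M \<and>
     (\<forall>\<nu>\<in>invariant_measures M. absolutely_continuous \<mu> \<nu> \<longrightarrow> \<nu> = \<mu>)"


section \<open>Communication classes\<close>

definition edge_path :: "('a, 'v, 'e) markov_sys \<Rightarrow> 'e list \<Rightarrow> bool" where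
  "edge_path M es \<longleftrightarrow> es \<noteq> [] \<and> successively (\<lambda>e e'. src M e' = tgt M e) es"

text \<open>\<open>accessible M j k\<close>: \<open>k\<close> is accessible from \<open>j\<close>.\<close>

definition accessible :: "('a, 'v, 'e) markov_sys \<Rightarrow> 'v \<Rightarrow> 'v \<Rightarrow> bool" where
  "accessible M j k \<longleftrightarrow>
     j = k \<or> (\<exists>es. edge_path M es \<and> src M (hd es) = j \<and> tgt M (last es) = k)"

definition communicate :: "('a, 'v, 'e) markov_sys \<Rightarrow> 'v \<Rightarrow> 'v \<Rightarrow> bool" where
  "communicate M j k \<longleftrightarrow> accessible M j k \<and> accessible M k j"

definition essential :: "('a, 'v, 'e) markov_sys \<Rightarrow> 'v \<Rightarrow> bool" where
  "essential M j \<longleftrightarrow> (\<forall>k. accessible M j k \<longrightarrow> communicate M j k)"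

definition essential_classes :: "('a, 'v, 'e) markov_sys \<Rightarrow> 'v set set" where
  "essential_classes M =
     {j. essential M j} // {(j, k). essential M j \<and> essential M k \<and> communicate M j k}"

definition class_union :: "('a, 'v, 'e) markov_sys \<Rightarrow> 'v set \<Rightarrow> 'a set" where
  "class_union M c = (\<Union>j\<in>c. vert M j)"


section \<open>Generating classes\<close>

definition occupation_measure ::
    "('a::complete_space, 'v, 'e::countable) markov_sys \<Rightarrow> 'a \<Rightarrow> nat \<Rightarrow> 'v measure" where
  "occupation_measure M x n =
     point_measure UNIV
       (\<lambda>j. (\<Sum>k=1..n. emeasure ((markov_dual M ^^ k) (return borel x)) (vert M j)) / of_nat n)"

definition generating_point ::
    "('a::complete_space, 'v, 'e::countable) markov_sys \<Rightarrow> 'a \<Rightarrow> bool" where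
  "generating_point M x \<longleftrightarrow>
     (\<forall>\<epsilon>>0. \<exists>V. finite V \<and>
        (\<forall>n\<ge>1. emeasure (occupation_measure M x n) (UNIV - V) < ennreal \<epsilon>))"

definition generating_vertex ::
    "('a::complete_space, 'v, 'e::countable) markov_sys \<Rightarrow> 'v \<Rightarrow> bool" where
  "generating_vertex M j \<longleftrightarrow> (\<exists>x\<in>vert M j. generating_point M x)"

text \<open>The classes \<open>c\<^sub>i\<close> are indexed by themselves.\<close>

definition generating_classes ::
    "('a::complete_space, 'v, 'e::countable) markov_sys \<Rightarrow> 'v set set" where
  "generating_classes M = {c \<in> essential_classes M. \<exists>j\<in>c. generating_vertex M j}"


section \<open>Code space\<close>

text \<open>The edge alphabet is compactified to \<^typ>\<open>'e option\<close>, with \<^term>\<open>None\<close> as the point \<open>\<infinity>\<close>.\<close>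

definition code_top :: "'e option topology" where
  "code_top = Alexandroff_compactification (discrete_topology UNIV)"

definition borel_algebra :: "'b topology \<Rightarrow> 'b measure" where
  "borel_algebra X = sigma (topspace X) {U. openin X U}"

definition code_space :: "(int \<Rightarrow> 'e option) measure" where
  "code_space = borel_algebra (product_topology (\<lambda>_. code_top) UNIV)"

text \<open>One-sided codes are indexed from \<open>0\<close>: the coordinate \<open>\<sigma>\<^sub>k\<close>, \<open>k \<ge> 1\<close>, is \<open>\<sigma> (k - 1)\<close>.\<close>

definition code_space_plus :: "(nat \<Rightarrow> 'e option) measure" where
  "code_space_plus = borel_algebra (product_topology (\<lambda>_. code_top) UNIV)"

text \<open>\<open>cyl m [e\<^sub>m, \<dots>, e\<^sub>n]\<close> is \<open>\<^sub>m[e\<^sub>m, \<dots>, e\<^sub>n]\<close>, and \<open>cyl_plus [e\<^sub>1, \<dots>, e\<^sub>n]\<close> is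
  \<open>\<^sub>1[e\<^sub>1, \<dots>, e\<^sub>n]\<^sup>+\<close>.\<close>

definition cyl :: "int \<Rightarrow> 'e option list \<Rightarrow> (int \<Rightarrow> 'e option) set" where
  "cyl m es = {\<sigma>. \<forall>k<length es. \<sigma> (m + int k) = es ! k}"

definition cyl_plus :: "'e option list \<Rightarrow> (nat \<Rightarrow> 'e option) set" where
  "cyl_plus es = {\<sigma>. \<forall>k<length es. \<sigma> k = es ! k}"

definition shift :: "(int \<Rightarrow> 'e option) \<Rightarrow> int \<Rightarrow> 'e option" where
  "shift \<sigma> = (\<lambda>k. \<sigma> (k + 1))"

definition shift_invariant_measures :: "(int \<Rightarrow> 'e option) measure set" where
  "shift_invariant_measures =
     {\<Lambda>. prob_space \<Lambda> \<and> sets \<Lambda> = sets code_space \<and> distr \<Lambda> code_space shift = \<Lambda>}"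

text \<open>The \<open>\<sigma>\<close>-algebra generated by the cylinders \<open>\<^sub>m[e\<^sub>m, \<dots>, e\<^sub>0]\<close>, \<open>m \<le> 0\<close>.\<close>

definition past_algebra :: "(int \<Rightarrow> 'e option) measure" where
  "past_algebra = sigma UNIV {cyl m es | m es. m \<le> 0 \<and> m + int (length es) = 1}"

fun wbar :: "('a, 'v, 'e) markov_sys \<Rightarrow> 'e option \<Rightarrow> 'a \<Rightarrow> 'a" where
  "wbar M (Some e) x = wmap M e x"
| "wbar M None x = x"

fun prbbar :: "('a, 'v, 'e) markov_sys \<Rightarrow> 'e option \<Rightarrow> 'a \<Rightarrow> real" where
  "prbbar M (Some e) x = prb M e x"
| "prbbar M None x = 0"

text \<open>In the following, \<open>v\<close> is the fixed vertex \<open>n\<^sub>\<infinity>\<close>.\<close>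

fun srcbar :: "('a, 'v, 'e) markov_sys \<Rightarrow> 'v \<Rightarrow> 'e option \<Rightarrow> 'v" where
  "srcbar M v (Some e) = src M e"
| "srcbar M v None = v"

fun tgtbar :: "('a, 'v, 'e) markov_sys \<Rightarrow> 'v \<Rightarrow> 'e option \<Rightarrow> 'v" where
  "tgtbar M v (Some e) = tgt M e"
| "tgtbar M v None = v"

definition path_space :: "('a, 'v, 'e) markov_sys \<Rightarrow> 'v \<Rightarrow> (int \<Rightarrow> 'e option) set" where
  "path_space M v =
     {\<sigma>. \<forall>n. \<sigma> n \<noteq> None \<and> srcbar M v (\<sigma> (n + 1)) = tgtbar M v (\<sigma> n)}"

text \<open>\<open>cyl_prob M [e\<^sub>1, \<dots>, e\<^sub>k] x = p\<^sub>e\<^sub>1(x) p\<^sub>e\<^sub>2(w\<^sub>e\<^sub>1 x) \<dots>\<close>\<close>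

fun cyl_prob :: "('a, 'v, 'e) markov_sys \<Rightarrow> 'e option list \<Rightarrow> 'a \<Rightarrow> real" where
  "cyl_prob M [] x = 1"
| "cyl_prob M (e # es) x = prbbar M e x * cyl_prob M es (wbar M e x)"

definition path_measure ::
    "('a::complete_space, 'v, 'e::countable) markov_sys \<Rightarrow> 'a \<Rightarrow> (nat \<Rightarrow> 'e option) measure" where
  "path_measure M x =
     (THE P. prob_space P \<and> sets P = sets code_space_plus \<and>
        (\<forall>es. emeasure P (cyl_plus es) = ennreal (cyl_prob M es x)))"


section \<open>Coding map and non-degeneracy\<close>

text \<open>\<open>backward_comp M \<sigma> n\<close> is \<open>w\<^bsub>\<sigma>(0)\<^esub> \<circ> w\<^bsub>\<sigma>(-1)\<^esub> \<circ> \<dots> \<circ> w\<^bsub>\<sigma>(-n)\<^esub>\<close>.\<close>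

fun backward_comp :: "('a, 'v, 'e) markov_sys \<Rightarrow> (int \<Rightarrow> 'e option) \<Rightarrow> nat \<Rightarrow> 'a \<Rightarrow> 'a" where
  "backward_comp M \<sigma> 0 = wbar M (\<sigma> 0)"
| "backward_comp M \<sigma> (Suc n) = backward_comp M \<sigma> n \<circ> wbar M (\<sigma> (- int (Suc n)))"

text \<open>The argument \<open>pt\<close> is the fixed choice of points \<open>pt j \<in> K\<^sub>j\<close>.\<close>

definition coding_approx ::
    "('a, 'v, 'e) markov_sys \<Rightarrow> ('v \<Rightarrow> 'a) \<Rightarrow> 'v \<Rightarrow> (int \<Rightarrow> 'e option) \<Rightarrow> nat \<Rightarrow> 'a" where
  "coding_approx M pt v \<sigma> n = backward_comp M \<sigma> n (pt (srcbar M v (\<sigma> (- int n))))"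

definition coding_domain ::
    "('a::complete_space, 'v, 'e::countable) markov_sys \<Rightarrow> ('v \<Rightarrow> 'a) \<Rightarrow> 'v
      \<Rightarrow> (int \<Rightarrow> 'e option) set" where
  "coding_domain M pt v = {\<sigma> \<in> path_space M v. convergent (coding_approx M pt v \<sigma>)}"

definition coding_map ::
    "('a::complete_space, 'v, 'e::countable) markov_sys \<Rightarrow> ('v \<Rightarrow> 'a) \<Rightarrow> 'v
      \<Rightarrow> (int \<Rightarrow> 'e option) \<Rightarrow> 'a" where
  "coding_map M pt v \<sigma> =
     (if \<sigma> \<in> coding_domain M pt v then lim (coding_approx M pt v \<sigma>)
      else pt (tgtbar M v (\<sigma> 0)))"

definition ending_in :: "('a, 'v, 'e) markov_sys \<Rightarrow> 'v \<Rightarrow> 'v \<Rightarrow> (int \<Rightarrow> 'e option) set" where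
  "ending_in M v j = {\<sigma> \<in> path_space M v. tgtbar M v (\<sigma> 0) = j}"

definition prb_extension ::
    "('a::complete_space, 'v, 'e::countable) markov_sys \<Rightarrow> 'e \<Rightarrow> 'a \<Rightarrow> real" where
  "prb_extension M e =
     (THE g. continuous_on (closure (vert M (src M e))) g \<and>
        (\<forall>x\<in>vert M (src M e). g x = prb M e x) \<and>
        (\<forall>x. x \<notin> closure (vert M (src M e)) \<longrightarrow> g x = 0))"

definition equilibrium_candidates ::
    "('a::complete_space, 'v, 'e::countable) markov_sys \<Rightarrow> ('v \<Rightarrow> 'a) \<Rightarrow> 'v
      \<Rightarrow> (int \<Rightarrow> 'e option) measure set" where
  "equilibrium_candidates M pt v =
     {\<Lambda> \<in> shift_invariant_measures.
        emeasure \<Lambda> (coding_domain M pt v) = 1 \<and>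
        (\<forall>e. AE \<sigma> in \<Lambda>.
           real_cond_exp \<Lambda> past_algebra (indicator (cyl 1 [Some e])) \<sigma> =
             prb_extension M e (coding_map M pt v \<sigma>) * indicator (ending_in M v (src M e)) \<sigma>)}"

definition non_degenerate ::
    "('a::complete_space, 'v, 'e::countable) markov_sys \<Rightarrow> ('v \<Rightarrow> 'a) \<Rightarrow> 'v \<Rightarrow> bool" where
  "non_degenerate M pt v \<longleftrightarrow>
     (\<forall>\<Lambda>\<in>equilibrium_candidates M pt v.
        \<exists>j. emeasure \<Lambda> (ending_in M v j \<inter> coding_map M pt v -` vert M j) > 0)"


section \<open>Further conditions\<close>

definition absolute_continuity_condition ::
    "('a::complete_space, 'v, 'e::countable) markov_sys \<Rightarrow> bool" where
  "absolute_continuity_condition M \<longleftrightarrow>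
     (\<forall>j. \<forall>x\<in>vert M j. \<forall>y\<in>vert M j.
        absolutely_continuous (path_measure M y) (path_measure M x))"

definition bounded_displacement ::
    "('a::complete_space, 'v, 'e::countable) markov_sys \<Rightarrow> ('v \<Rightarrow> 'a) \<Rightarrow> bool" where
  "bounded_displacement M pt \<longleftrightarrow>
     (SUP j. SUP x\<in>vert M j. \<Sum>\<^sub>\<infinity>e\<in>{e. src M e = j}.
        ennreal (prb M e x * dist (wmap M e (pt (src M e))) (pt (tgt M e)))) < \<infinity>"

definition dominating_markov_chain ::
    "('a::complete_space, 'v, 'e::countable) markov_sys \<Rightarrow> bool" where
  "dominating_markov_chain M \<longleftrightarrow>
     (\<forall>j. (\<Sum>\<^sub>\<infinity>e\<in>{e. src M e = j}. SUP x\<in>vert M j. ennreal (prb M e x)) < \<infinity>)"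

text \<open>The summands \<open>- p\<^sub>e ln p\<^sub>e\<close> are nonnegative, and \<open>0 * ln 0 = 0\<close>.\<close>

definition bounded_entropy ::
    "('a::complete_space, 'v, 'e::countable) markov_sys \<Rightarrow> bool" where
  "bounded_entropy M \<longleftrightarrow>
     (\<exists>B. \<forall>x. (\<Sum>\<^sub>\<infinity>e. ennreal (- (prb M e x * ln (prb M e x)))) \<le> ennreal B)"

end

theory Submission
  imports Defs
begin

text \<open>The logarithm of \<open>P\<^sub>x\<close> of a cylinder is a Birkhoff sum along the skew product
  \<open>(x, \<sigma>) \<mapsto> (w\<^bsub>\<sigma>\<^sub>1\<^esub> x, S\<sigma>)\<close>. For an invariant measure \<open>\<mu>\<close> carried by a communication class, the path
  probability of an invariant event is a harmonic function, hence unchanged by almost every step of the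
  process. If moreover the event does not distinguish starting points in a common vertex set, absolute
  continuity propagates this through the class, and the event has path probability 0 from every
  point of the class or 1 from every point of the class. With the maximal ergodic inequality, the
  Birkhoff averages of an integrable function converge to its integral from every starting point of the
  class, provided that the Birkhoff sums from two points of a vertex set differ by a bounded amount
  along almost every path. For bounded Lipschitz functions this holds by contraction and gives
  uniqueness of \<open>\<mu>\<close>, hence ergodicity; for \<open>log p\<close> it holds because the ratio of the cylinder
  probabilities is a nonnegative martingale.

  For the existence of \<open>\<mu>\<close> on a generating class, a Krylov-Bogolyubov limit is taken on the code space,
  where no continuity across the boundaries of the vertex sets is needed. By contraction its
  two-sided extension lies in \<^const>\<open>equilibrium_candidates\<close>, so non-degeneracy yields a set of positive measure of codes
  whose coding point lies in the vertex set prescribed by the code. This set is shift invariant modulo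
  null sets, and the law of the coding map conditioned on it is invariant.\<close>

section \<open>Measures on sequence spaces\<close>

text \<open>The probabilities and maps are continuous only inside each vertex set, so
  \<open>U\<close> need not preserve continuous functions, and a weak limit of averaged laws on
  \<open>K\<close> need not be invariant; moreover \<open>K\<close> need not be separable. On the
  code space every estimate concerns finite words and survives a limit. What has to be recovered is
  the point of \<open>K\<close> behind a code: with the points \<open>pt j\<close> as substitutes
  for the unknown starting point, contraction makes the expected error after \<open>L\<close>
  letters of order \<open>a ^ L\<close>, uniformly in the averaging time. Tightness has two sources:
  the generating point controls which vertices are visited, the dominating chain controls the edges
  that leave one vertex. The event fed into the zero-one law is unboundedness of centred Birkhoff
  sums: it is exactly invariant, survives bounded changes, and supplies the positive partial sum
  that the maximal inequality asks for. Bounded entropy makes \<open>log p\<close> integrable, and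
  the sum over edges in the conclusion is then absolutely convergent.\<close>

abbreviation seqs :: "(nat \<Rightarrow> 'b) measure" where
  "seqs \<equiv> PiM UNIV (\<lambda>_. count_space UNIV)"

text \<open>The sets \<open>cyl_plus\<close> over an arbitrary alphabet: the two-sided extension
  works over pairs of letters instead of \<open>'e option\<close>.\<close>

definition cylinder :: "'b list \<Rightarrow> (nat \<Rightarrow> 'b) set" where
  "cylinder w = {\<sigma>. \<forall>k<length w. \<sigma> k = w ! k}"

lemma cylinder_Nil [simp]: "cylinder [] = UNIV"
  by (simp add: cylinder_def)

lemma cyl_plus_eq_cylinder: "cyl_plus = cylinder"
  by (simp add: fun_eq_iff cyl_plus_def cylinder_def)

lemma map_upt_eq_iff: "map f [0..<length w] = w \<longleftrightarrow> (\<forall>k<length w. f k = w ! k)"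
proof
  assume eq: "map f [0..<length w] = w"
  show "\<forall>k<length w. f k = w ! k"
  proof (intro allI impI)
    fix k assume "k < length w"
    then have "map f [0..<length w] ! k = f k" by simp
    then show "f k = w ! k" unfolding eq by simp
  qed
next
  assume "\<forall>k<length w. f k = w ! k"
  then show "map f [0..<length w] = w" by (intro nth_equalityI) auto
qed

lemma mem_cylinder_iff: "\<sigma> \<in> cylinder w \<longleftrightarrow> map \<sigma> [0..<length w] = w"
  by (simp add: cylinder_def map_upt_eq_iff)

lemma space_seqs [simp]: "space seqs = UNIV"
  by (simp add: space_PiM)

lemma measurable_seqs_component [measurable]:
  "(\<lambda>\<sigma>. \<sigma> n) \<in> measurable seqs (count_space UNIV)"
  by (rule measurable_component_singleton) simp

lemma cylinder_in_sets [measurable]: "cylinder w \<in> sets seqs"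
proof -
  have "{\<sigma> \<in> space seqs. \<forall>k<length w. \<sigma> k = w ! k} \<in> sets seqs"
    by measurable
  then show ?thesis by (simp add: cylinder_def)
qed

lemma measurable_map_seqs [measurable]:
  "(\<lambda>\<sigma> :: nat \<Rightarrow> 'b::countable. map \<sigma> [0..<n]) \<in> measurable seqs (count_space UNIV)"
proof (subst measurable_count_space_eq2_countable, safe)
  fix w :: "'b list"
  have "(\<lambda>\<sigma>. map \<sigma> [0..<n]) -` {w} = (if length w = n then cylinder w else {})"
    by (auto simp: mem_cylinder_iff)
  then show "(\<lambda>\<sigma>. map \<sigma> [0..<n]) -` {w} \<inter> space seqs \<in> sets seqs"
    by simp
qed auto

text \<open>Two cylinders are nested or disjoint; the empty set is added for the second
  case.\<close>

lemma Int_stable_cylinders: "Int_stable (insert {} (range cylinder))"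
proof -
  have *: "cylinder xs \<inter> cylinder ys \<in> insert {} (range cylinder)"
    if le: "length xs \<le> length ys" for xs ys :: "'b list"
  proof (cases "\<forall>k<length xs. xs ! k = ys ! k")
    case True
    then have "cylinder xs \<inter> cylinder ys = cylinder ys"
      using le by (auto simp: cylinder_def)
    then show ?thesis by simp
  next
    case False
    then have "cylinder xs \<inter> cylinder ys = {}"
      using le by (auto simp: cylinder_def)
    then show ?thesis by simp
  qed
  show ?thesis
  proof (rule Int_stableI)
    fix a b :: "(nat \<Rightarrow> 'b) set"
    assume "a \<in> insert {} (range cylinder)" "b \<in> insert {} (range cylinder)"
    then consider "a = {}" | "b = {}" | xs ys where "a = cylinder xs" "b = cylinder ys"
      by auto
    then show "a \<inter> b \<in> insert {} (range cylinder)"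
    proof cases
      case (3 xs ys)
      then show ?thesis using *[of xs ys] *[of ys xs] by (cases "length xs \<le> length ys") (auto simp: Int_commute)
    qed auto
  qed
qed

text \<open>Over a countable alphabet there are only countably many words, so a condition on one
  coordinate is a countable union of cylinders.\<close>

lemma sets_seqs_eq:
  "sets (seqs :: (nat \<Rightarrow> 'b::countable) measure) = sigma_sets UNIV (insert {} (range cylinder))"
proof
  let ?G = "insert {} (range cylinder) :: (nat \<Rightarrow> 'b) set set"
  interpret sigma_algebra UNIV "sigma_sets UNIV ?G"
    by (rule sigma_algebra_sigma_sets) auto
  have single: "{\<sigma>. \<sigma> i \<in> A} \<in> sigma_sets UNIV ?G" for i and A :: "'b set"
  proof -
    have "{\<sigma>. \<sigma> i \<in> A} = (\<Union>w\<in>{w. length w = Suc i \<and> w ! i \<in> A}. cylinder w)"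
    proof safe
      fix \<sigma> :: "nat \<Rightarrow> 'b" assume "\<sigma> i \<in> A"
      then show "\<sigma> \<in> (\<Union>w\<in>{w. length w = Suc i \<and> w ! i \<in> A}. cylinder w)"
        by (intro UN_I[of "map \<sigma> [0..<Suc i]"])
           (auto simp: mem_cylinder_iff nth_append simp del: upt_Suc)
    qed (auto simp: cylinder_def)
    also have "\<dots> \<in> sigma_sets UNIV ?G"
      by (intro countable_UN'') (auto intro: sigma_sets.Basic)
    finally show ?thesis .
  qed
  have "sets (seqs :: (nat \<Rightarrow> 'b) measure)
      = sigma_sets UNIV {{f. f i \<in> A} | i A. True}"
    unfolding sets_PiM_single by (simp add: PiE_def)
  also have "\<dots> \<subseteq> sigma_sets UNIV ?G"
    using single by (intro sigma_sets_mono) auto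
  finally show "sets seqs \<subseteq> sigma_sets UNIV ?G" .
  have "?G \<subseteq> sets seqs" by auto
  then show "sigma_sets UNIV ?G \<subseteq> sets seqs"
    using sets.sigma_sets_subset[of ?G seqs] by simp
qed

lemma seqs_measure_eqI:
  fixes P Q :: "(nat \<Rightarrow> 'b::countable) measure"
  assumes "finite_measure P" and P: "sets P = sets seqs" and Q: "sets Q = sets seqs"
    and eq: "\<And>w. emeasure P (cylinder w) = emeasure Q (cylinder w)"
  shows "P = Q"
proof (rule measure_eqI_generator_eq[OF Int_stable_cylinders, where \<Omega> = UNIV and A = "\<lambda>_. UNIV"])
  interpret finite_measure P by fact
  show "emeasure P UNIV \<noteq> \<infinity>" by simp
  show "range (\<lambda>_. UNIV) \<subseteq> insert {} (range cylinder)"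
    using cylinder_Nil by blast
  show "sets P = sigma_sets UNIV (insert {} (range cylinder))"
    "sets Q = sigma_sets UNIV (insert {} (range cylinder))"
    unfolding P Q by (rule sets_seqs_eq)+
qed (use eq in auto)

lemma nn_integral_pos_eq_point:
  "(\<integral>\<^sup>+b. (if b = c then f b else 0) \<partial>count_space UNIV) = (f c :: ennreal)"
  using nn_integral_count_space'[of "{c}" UNIV "\<lambda>b. if b = c then f b else 0"] by simp

text \<open>Ionescu-Tulcea with the conditional probabilities \<open>q (w @ [b]) / q w\<close> as
  kernels. All later measures on sequence spaces (path measures, limits, the two-sided extension)
  come from this lemma, so for each of them only the consistency of cylinder weights has to be
  checked.\<close>

lemma cylinder_measure_exists:
  fixes q :: "'b::countable list \<Rightarrow> ennreal"
  assumes q0: "q [] = 1" and q: "\<And>w. (\<integral>\<^sup>+b. q (w @ [b]) \<partial>count_space UNIV) = q w"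
  shows "\<exists>P. prob_space P \<and> sets P = sets seqs \<and> (\<forall>w. emeasure P (cylinder w) = q w)"
proof -
  have q_le: "q (w @ [b]) \<le> q w" for w b
    unfolding q[of w, symmetric] by (rule nn_integral_ge_point) simp
  have q_le1: "q w \<le> 1" for w
  proof (induction w rule: rev_induct)
    case (snoc b w)
    then show ?case using q_le[of w b] by (rule order_trans[rotated])
  qed (simp add: q0)
  have q_fin: "q w \<noteq> \<top>" for w
    using q_le1[of w] by (auto simp: top_unique)
  \<comment> \<open>Prefixes of weight 0 have no conditional distribution; a point mass keeps every
    kernel a probability measure.\<close>
  define k where "k w = (if q w = 0 then return (count_space UNIV) undefined
      else density (count_space UNIV) (\<lambda>b. q (w @ [b]) / q w))" for w
  have prob_k: "prob_space (k w)" for w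
  proof (cases "q w = 0")
    case False
    then show ?thesis using q_fin[of w]
      by (auto intro!: prob_spaceI ennreal_divide_self
            simp: k_def emeasure_density nn_integral_divide q less_top[symmetric] zero_less_iff_neq_zero)
  qed (auto simp: k_def intro: prob_space_return)
  have sets_k: "sets (k w) = sets (count_space UNIV)" for w
    by (simp add: k_def)
  define K where "K n \<omega> = k (map \<omega> [0..<n])" for n :: nat and \<omega> :: "nat \<Rightarrow> 'b"
  let ?M = "\<lambda>n::nat. count_space (UNIV::'b set)"
  have map_meas: "{\<omega> \<in> space (PiM {0..<n} ?M). map \<omega> [0..<n] = w} \<in> sets (PiM {0..<n} ?M)" for n w
  proof (cases "length w = n")
    case True
    have "{\<omega> \<in> space (PiM {0..<n} ?M). \<forall>k\<in>{0..<n}. \<omega> k = w ! k} \<in> sets (PiM {0..<n} ?M)"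
    proof (rule sets.sets_Collect_finite_All)
      fix k assume k: "k \<in> {0..<n}"
      have "(\<lambda>\<omega>. \<omega> k) \<in> measurable (PiM {0..<n} ?M) (count_space UNIV)"
        using k by (rule measurable_component_singleton)
      then show "{\<omega> \<in> space (PiM {0..<n} ?M). \<omega> k = w ! k} \<in> sets (PiM {0..<n} ?M)"
        by measurable
    qed simp
    also have "{\<omega> \<in> space (PiM {0..<n} ?M). \<forall>k\<in>{0..<n}. \<omega> k = w ! k}
        = {\<omega> \<in> space (PiM {0..<n} ?M). map \<omega> [0..<n] = w}"
      unfolding True[symmetric] map_upt_eq_iff by auto
    finally show ?thesis .
  next
    case False
    then have "{\<omega> \<in> space (PiM {0..<n} ?M). map \<omega> [0..<n] = w} = {}"
      by auto
    then show ?thesis by (simp only: sets.empty_sets)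
  qed
  have K_meas: "K n \<in> measurable (PiM {0..<n} ?M) (subprob_algebra (?M n))" for n
  proof -
    have 1: "(\<lambda>\<omega>. map \<omega> [0..<n]) \<in> measurable (PiM {0..<n} ?M) (count_space UNIV)"
      unfolding measurable_count_space_eq2_countable
      using map_meas[of n] by (auto simp: vimage_def Int_def conj_commute)
    have 2: "k \<in> measurable (count_space UNIV) (subprob_algebra (?M n))"
      using prob_k sets_k by (auto simp: space_subprob_algebra prob_space_imp_subprob_space)
    show ?thesis using measurable_compose[OF 1 2] by (simp add: K_def[abs_def])
  qed
  interpret IT: Ionescu_Tulcea K ?M
    by (rule Ionescu_Tulcea.intro[OF K_meas]) (simp add: K_def prob_k)
  define c where "c n w = {\<omega> \<in> space (PiM {0..<n} ?M). map \<omega> [0..<n] = w}" for n w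
  have c_sets[measurable]: "c n w \<in> sets (PiM {0..<n} ?M)" for n w
    unfolding c_def by (rule map_meas)
  have C: "emeasure (IT.C 0 (length w) (\<lambda>_. undefined)) (c (length w) w) = q w" for w
  proof (induction w rule: rev_induct)
    case Nil
    then show ?case by (simp add: c_def PiM_empty q0)
  next
    case (snoc b w)
    let ?n = "length w" and ?\<omega>0 = "\<lambda>_::nat. undefined :: 'b"
    have "?\<omega>0 \<in> space (PiM {0..<0} ?M)" by (simp add: space_PiM)
    note sp = IT.space_C[OF this, of ?n] and st = IT.sets_C[OF this, of ?n]
    have eP: "emeasure (IT.eP ?n \<omega>) (c (Suc ?n) (w @ [b]))
        = q (w @ [b]) / q w * indicator (c ?n w) \<omega>"
      if \<omega>: "\<omega> \<in> space (PiM {0..<?n} ?M)" and nz: "q w \<noteq> 0" for \<omega>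
    proof -
      have "emeasure (IT.eP ?n \<omega>) (c (Suc ?n) (w @ [b]))
          = emeasure (K ?n \<omega>) ((\<lambda>x. fun_upd \<omega> ?n x) -` c (Suc ?n) (w @ [b]) \<inter> UNIV)"
        using IT.emeasure_eP[OF \<omega> c_sets[of "Suc ?n" "w @ [b]"]] by simp
      also have "(\<lambda>x. fun_upd \<omega> ?n x) -` c (Suc ?n) (w @ [b]) \<inter> UNIV = (if map \<omega> [0..<?n] = w then {b} else {})"
        using \<omega> by (auto simp: c_def space_PiM PiE_iff extensional_def)
      also have "emeasure (K ?n \<omega>) \<dots> = q (w @ [b]) / q w * indicator (c ?n w) \<omega>"
        using \<omega> nz
        by (cases "map \<omega> [0..<?n] = w") (simp_all add: c_def K_def k_def emeasure_density
              nn_integral_indicator_singleton indicator_def[of "{\<omega> \<in> _. _ \<omega>}"])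
      finally show ?thesis .
    qed
    have "emeasure (IT.C 0 (Suc ?n) ?\<omega>0) (c (Suc ?n) (w @ [b]))
        = (\<integral>\<^sup>+\<omega>. emeasure (IT.eP ?n \<omega>) (c (Suc ?n) (w @ [b])) \<partial>IT.C 0 ?n ?\<omega>0)"
      using IT.measurable_eP[of ?n] sp
      by (simp, subst emeasure_bind[where N = "PiM {0..<Suc ?n} ?M"])
         (auto simp: measurable_cong_sets[OF st refl])
    also have "\<dots> = q (w @ [b])"
    proof (cases "q w = 0")
      case False
      have "(\<integral>\<^sup>+\<omega>. emeasure (IT.eP ?n \<omega>) (c (Suc ?n) (w @ [b])) \<partial>IT.C 0 ?n ?\<omega>0)
          = (\<integral>\<^sup>+\<omega>. q (w @ [b]) / q w * indicator (c ?n w) \<omega> \<partial>IT.C 0 ?n ?\<omega>0)"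
        using eP False sp by (intro nn_integral_cong) simp
      also have "\<dots> = q (w @ [b]) / q w * q w"
        using snoc st by (simp add: nn_integral_cmult_indicator)
      also have "\<dots> = q (w @ [b])"
      proof -
        have "q w / q w = 1"
          using False q_fin[of w]
          by (intro ennreal_divide_self) (auto simp: less_top[symmetric] zero_less_iff_neq_zero)
        then show ?thesis by (simp add: ennreal_divide_times)
      qed
      finally show ?thesis .
    next
      \<comment> \<open>Here the point mass chosen for null prefixes says nothing about
        \<open>q\<close>, but both sides vanish: the cylinder lies in one of measure
        \<open>q w = 0\<close>, and \<open>q (w @ [b]) \<le> q w\<close>.\<close>
      case True
      have le: "emeasure (IT.eP ?n \<omega>) (c (Suc ?n) (w @ [b])) \<le> indicator (c ?n w) \<omega>"
        if \<omega>: "\<omega> \<in> space (PiM {0..<?n} ?M)" for \<omega>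
      proof (cases "\<omega> \<in> c ?n w")
        case True
        then show ?thesis
          using prob_space.measure_le_1[OF IT.prob_space_eP[OF \<omega>]] by simp
      next
        case False
        then have "(\<lambda>x. fun_upd \<omega> ?n x) -` c (Suc ?n) (w @ [b]) = {}"
          using \<omega> by (auto simp: c_def space_PiM PiE_iff extensional_def)
        then show ?thesis
          using IT.emeasure_eP[OF \<omega> c_sets[of "Suc ?n" "w @ [b]"]] by simp
      qed
      have "(\<integral>\<^sup>+\<omega>. emeasure (IT.eP ?n \<omega>) (c (Suc ?n) (w @ [b])) \<partial>IT.C 0 ?n ?\<omega>0)
          \<le> (\<integral>\<^sup>+\<omega>. indicator (c ?n w) \<omega> \<partial>IT.C 0 ?n ?\<omega>0)"
        using le sp by (intro nn_integral_mono) simp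
      also have "\<dots> = q w" using snoc st by simp
      finally show ?thesis using True q_le[of w b] by simp
    qed
    finally show ?case by (simp only: length_append_singleton)
  qed
  show ?thesis
  proof (intro exI[of _ IT.PF.lim] conjI allI)
    show "sets IT.PF.lim = sets seqs" by simp
    show cyl: "emeasure IT.PF.lim (cylinder w) = q w" for w
    proof -
      have "cylinder w = IT.PF.emb UNIV {0..<length w} (c (length w) w)"
        by (auto simp: mem_cylinder_iff prod_emb_def c_def space_PiM PiE_iff map_upt_eq_iff)
      then have "emeasure IT.PF.lim (cylinder w) = emeasure (IT.CI {0..<length w}) (c (length w) w)"
        by (simp add: IT.lim)
      also have "\<dots> = emeasure (IT.C 0 (length w) (\<lambda>_. undefined)) (c (length w) w)"
        by (subst IT.emeasure_CI[of _ "length w"])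
           (auto simp: prod_emb_id[OF sets.sets_into_space[OF c_sets, unfolded space_PiM]])
      also have "\<dots> = q w" by (rule C)
      finally show ?thesis .
    qed
    show "prob_space IT.PF.lim"
      using cyl[of "[]"] q0 by (intro prob_spaceI) (simp add: space_PiM)
  qed
qed


text \<open>The compactification enlarges the neighbourhoods of \<open>None\<close> only, and
  neither passing to it nor to uncountable unions of open sets changes the \<sigma>-algebra: a basic
  open set around a point contains a set that fixes finitely many coordinates, and there are
  countably many such sets.\<close>

lemma sets_borel_algebra_code:
  "sets (borel_algebra (product_topology (\<lambda>_::'i::countable. code_top :: 'e::countable option topology) UNIV))
    = sets (PiM UNIV (\<lambda>_. count_space UNIV))"
proof -
  let ?X = "product_topology (\<lambda>_::'i. code_top :: 'e option topology) UNIV"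
  let ?P = "PiM UNIV (\<lambda>_::'i. count_space (UNIV :: 'e option set))"
  have top: "topspace (code_top :: 'e option topology) = UNIV"
    using option.exhaust by (auto simp: code_top_def)
  then have topX: "topspace ?X = UNIV"
    by (auto simp: PiE_def)
  have sets: "sets (borel_algebra ?X) = sigma_sets UNIV {U. openin ?X U}"
    unfolding borel_algebra_def topX by simp
  have open_in: "U \<in> sets ?P" if U: "openin ?X U" for U
  proof -
    \<comment> \<open>A finite list of constraints; with countable index set and alphabet there are
      countably many lists, which makes the union over all \<open>C l\<close> inside
      \<open>U\<close> a countable one.\<close>
    define C where "C l = {\<sigma> :: 'i \<Rightarrow> 'e option. \<forall>x\<in>set l. \<sigma> (fst x) = snd x}" for l
    have C: "C l \<in> sets ?P" for l
    proof -
      have "{\<sigma> \<in> space ?P. \<forall>x\<in>set l. \<sigma> (fst x) = snd x} \<in> sets ?P"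
      proof (rule sets.sets_Collect_finite_All)
        fix x :: "'i \<times> 'e option"
        have "(\<lambda>\<sigma>. \<sigma> (fst x)) \<in> measurable ?P (count_space UNIV)"
          by (rule measurable_component_singleton) simp
        then show "{\<sigma> \<in> space ?P. \<sigma> (fst x) = snd x} \<in> sets ?P"
          by measurable
      qed simp
      then show ?thesis by (simp add: C_def space_PiM)
    qed
    have "U = (\<Union>l\<in>{l. C l \<subseteq> U}. C l)"
    proof
      show "U \<subseteq> (\<Union>l\<in>{l. C l \<subseteq> U}. C l)"
      proof
        fix \<sigma> assume "\<sigma> \<in> U"
        then obtain V where V: "finite {i. V i \<noteq> (UNIV :: 'e option set)}" "\<And>i. \<sigma> i \<in> V i"
          "PiE UNIV V \<subseteq> U"
          using U unfolding openin_product_topology_alt top by (auto simp: PiE_iff)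
        obtain xs where xs: "set xs = {i. V i \<noteq> UNIV}"
          using finite_list[OF V(1)] by auto
        have "C (map (\<lambda>i. (i, \<sigma> i)) xs) \<subseteq> U"
        proof
          fix \<tau> assume "\<tau> \<in> C (map (\<lambda>i. (i, \<sigma> i)) xs)"
          then have "\<tau> i = \<sigma> i" if "V i \<noteq> UNIV" for i
            using that xs by (auto simp: C_def)
          then have "\<tau> i \<in> V i" for i
            using V(2)[of i] by (cases "V i = UNIV") auto
          then show "\<tau> \<in> U" using V(3) by (auto simp: PiE_iff)
        qed
        moreover have "\<sigma> \<in> C (map (\<lambda>i. (i, \<sigma> i)) xs)"
          by (simp add: C_def)
        ultimately show "\<sigma> \<in> (\<Union>l\<in>{l. C l \<subseteq> U}. C l)" by blast
      qed
    qed auto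
    also have "\<dots> \<in> sets ?P"
      using C by (intro sets.countable_UN') auto
    finally show ?thesis .
  qed
  interpret B: sigma_algebra UNIV "sigma_sets UNIV {U. openin ?X U}"
    by (rule sigma_algebra_sigma_sets) simp
  have some: "{\<sigma>. \<sigma> i = Some e} \<in> sigma_sets UNIV {U. openin ?X U}" for i :: 'i and e :: 'e
  proof -
    have "openin code_top {Some e}"
      using openin_Alexandroff_compactification_image_Some[of "discrete_topology UNIV" "{e}"]
      by (simp add: code_top_def)
    moreover have "continuous_map ?X code_top (\<lambda>\<sigma>. \<sigma> i)"
      by (rule continuous_map_product_projection) simp
    ultimately have "openin ?X {\<sigma> \<in> topspace ?X. \<sigma> i \<in> {Some e}}"
      by (intro openin_continuous_map_preimage)
    then show ?thesis by (intro sigma_sets.Basic) (simp add: top PiE_def)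
  qed
  have pt: "{\<sigma>. \<sigma> i = a} \<in> sigma_sets UNIV {U. openin ?X U}" for i :: 'i and a :: "'e option"
  proof (cases a)
    case None
    \<comment> \<open>The set \<open>{None}\<close> need not be open, so it is reached as a
      complement of open points.\<close>
    have "{\<sigma>. \<sigma> i = None} = UNIV - (\<Union>e. {\<sigma>. \<sigma> i = Some e})"
      by auto
    also have "\<dots> \<in> sigma_sets UNIV {U. openin ?X U}"
      using some by (intro B.compl_sets B.countable_UN'') auto
    finally show ?thesis by (simp add: None)
  qed (use some in simp)
  have single: "{\<sigma>. \<sigma> i \<in> A} \<in> sigma_sets UNIV {U. openin ?X U}" for i :: 'i and A :: "'e option set"
  proof -
    have "{\<sigma>. \<sigma> i \<in> A} = (\<Union>a\<in>A. {\<sigma>. \<sigma> i = a})" by auto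
    also have "\<dots> \<in> sigma_sets UNIV {U. openin ?X U}"
      using pt by (intro B.countable_UN'') auto
    finally show ?thesis .
  qed
  have "sets ?P = sigma_sets UNIV {{f. f i \<in> A} | i A. True}"
    unfolding sets_PiM_single by (simp add: PiE_def)
  also have "\<dots> \<subseteq> sigma_sets UNIV {U. openin ?X U}"
    using single by (intro sigma_sets_mono) auto
  finally have 1: "sets ?P \<subseteq> sigma_sets UNIV {U. openin ?X U}" .
  have "sigma_sets (space ?P) {U. openin ?X U} \<subseteq> sets ?P"
    by (rule sets.sigma_sets_subset) (use open_in in auto)
  then show ?thesis using 1 sets by (simp add: space_PiM)
qed

lemma sets_code_space_plus:
  "sets (code_space_plus :: (nat \<Rightarrow> 'e::countable option) measure) = sets seqs"
  unfolding code_space_plus_def by (rule sets_borel_algebra_code)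

lemma sets_code_space:
  "sets (code_space :: (int \<Rightarrow> 'e::countable option) measure) = sets (PiM UNIV (\<lambda>_. count_space UNIV))"
  unfolding code_space_def by (rule sets_borel_algebra_code)

text \<open>For summands weighted with \<open>prbbar\<close>, where \<open>None\<close> has weight
  0: sums over the compactified alphabet become sums over edges.\<close>

lemma nn_integral_count_space_option:
  "f None = 0 \<Longrightarrow> (\<integral>\<^sup>+a. f a \<partial>count_space UNIV) = (\<integral>\<^sup>+e. f (Some e) \<partial>count_space UNIV)"
  by (subst nn_integral_bij_count_space[of Some UNIV "range Some" f])
     (auto intro!: nn_integral_count_space_eq inj_on_imp_bij_betw simp: notin_range_Some)

lemma nn_integral_count_space_has_sum:
  fixes f :: "'b::countable \<Rightarrow> real"
  assumes "(f has_sum s) UNIV" and "\<And>b. 0 \<le> f b"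
  shows "(\<integral>\<^sup>+b. ennreal (f b) \<partial>count_space UNIV) = ennreal s"
proof -
  have "ennreal (infsum f UNIV) = (\<Sum>\<^sub>\<infinity>b. ennreal (f b))"
    using assms
    by (subst infsum_nonneg_is_SUPREMUM_ennreal)
       (auto simp: nonneg_infsum_complete sum_nonneg intro: has_sum_imp_summable)
  then show ?thesis
    using assms by (simp add: infsum_ennreal_eq_nn_integral infsumI)
qed

lemma measurable_case_nat_seqs [measurable]: "case_nat a \<in> measurable seqs seqs"
proof (rule measurable_PiM_single')
  fix i :: nat
  show "(\<lambda>\<sigma>. case i of 0 \<Rightarrow> a | Suc n \<Rightarrow> \<sigma> n) \<in> measurable seqs (count_space UNIV)"
    by (cases i) auto
qed auto

lemma case_nat_vimage_in_sets [simp]: "A \<in> sets seqs \<Longrightarrow> case_nat a -` A \<in> sets seqs"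
  using measurable_sets[OF measurable_case_nat_seqs, of A a] by simp

lemma measurable_shift_seqs [measurable]: "(\<lambda>\<sigma> n. \<sigma> (Suc n)) \<in> measurable seqs seqs"
  by (rule measurable_PiM_single') auto


section \<open>Path measures\<close>

locale markov =
  fixes M :: "('a::complete_space, 'v, 'e::countable) markov_sys"
  assumes M: "markov_system M"
begin

abbreviation "P \<equiv> path_measure M"

lemma measurable_wmap [measurable]: "wmap M e \<in> borel_measurable borel"
  and measurable_prb [measurable]: "prb M e \<in> borel_measurable borel"
  and prb_nonneg [simp]: "0 \<le> prb M e x"
  and prb_le_1 [simp]: "prb M e x \<le> 1"
  using M by (auto simp: markov_system_def)

lemma measurable_wbar [measurable]: "wbar M a \<in> borel_measurable borel"
  and measurable_prbbar [measurable]: "prbbar M a \<in> borel_measurable borel"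
  and prbbar_nonneg [simp]: "0 \<le> prbbar M a x"
  and prbbar_le_1 [simp]: "prbbar M a x \<le> 1"
proof -
  have "wbar M None = (\<lambda>x. x)" "wbar M (Some e) = wmap M e"
    "prbbar M None = (\<lambda>x. 0)" "prbbar M (Some e) = prb M e" for e by auto
  then show "wbar M a \<in> borel_measurable borel" "prbbar M a \<in> borel_measurable borel"
    "0 \<le> prbbar M a x" "prbbar M a x \<le> 1"
    by (cases a; simp)+
qed

lemma nn_integral_prb: "(\<integral>\<^sup>+e. ennreal (prb M e x) \<partial>count_space UNIV) = 1"
  using M by (subst nn_integral_count_space_has_sum[of _ 1]) (auto simp: markov_system_def)

lemma nn_integral_prbbar: "(\<integral>\<^sup>+a. ennreal (prbbar M a x) \<partial>count_space UNIV) = 1"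
  by (subst nn_integral_count_space_option) (simp_all add: nn_integral_prb)

lemma measurable_cyl_prob [measurable]: "cyl_prob M w \<in> borel_measurable borel"
proof (induction w)
  case (Cons a w)
  note [measurable] = Cons
  have "cyl_prob M (a # w) = (\<lambda>x. prbbar M a x * cyl_prob M w (wbar M a x))"
    by (simp add: fun_eq_iff)
  then show ?case by simp
qed (simp add: cyl_prob.simps(1)[abs_def])

lemma cyl_prob_nonneg [simp]: "0 \<le> cyl_prob M w x"
  by (induction w arbitrary: x) auto

lemma nn_integral_cyl_prob_snoc:
  "(\<integral>\<^sup>+a. ennreal (cyl_prob M (w @ [a]) x) \<partial>count_space UNIV) = ennreal (cyl_prob M w x)"
  by (induction w arbitrary: x) (simp_all add: nn_integral_prbbar ennreal_mult nn_integral_cmult)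

text \<open>Legitimates the definite description in \<open>path_measure\<close>: the weights are
  consistent because the probabilities sum to 1 at every point, and cylinders form a generating
  class closed under intersection.\<close>

lemma path_measure_unique_existence:
  "\<exists>!P. prob_space P \<and> sets P = sets code_space_plus \<and>
    (\<forall>w. emeasure P (cyl_plus w) = ennreal (cyl_prob M w x))"
proof -
  obtain Q where "prob_space Q" "sets Q = sets seqs" "\<And>w. emeasure Q (cylinder w) = ennreal (cyl_prob M w x)"
    using cylinder_measure_exists[of "\<lambda>w. ennreal (cyl_prob M w x)"] nn_integral_cyl_prob_snoc by auto
  then show ?thesis
    unfolding cyl_plus_eq_cylinder sets_code_space_plus
    by (intro ex1I[of _ Q]) (auto intro!: seqs_measure_eqI dest: prob_space.axioms(1))
qed

lemma prob_space_P: "prob_space (P x)"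
  and sets_P [measurable_cong, simp]: "sets (P x) = sets seqs"
  and emeasure_P_cylinder: "emeasure (P x) (cylinder w) = ennreal (cyl_prob M w x)"
  using theI'[OF path_measure_unique_existence[of x], folded path_measure_def]
  unfolding cyl_plus_eq_cylinder sets_code_space_plus by auto

sublocale P: prob_space "P x" for x
  by (rule prob_space_P)

lemma space_P [simp]: "space (P x) = UNIV"
  using sets_eq_imp_space_eq[OF sets_P] by simp

lemma measure_P_cylinder: "measure (P x) (cylinder w) = cyl_prob M w x"
  by (simp add: measure_def emeasure_P_cylinder)

lemma measurable_P [measurable]: "P \<in> measurable borel (prob_algebra seqs)"
proof (rule measurable_prob_algebra_generated[OF sets_seqs_eq Int_stable_cylinders])
  fix A :: "(nat \<Rightarrow> 'e option) set" assume "A \<in> insert {} (range cylinder)"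
  then show "(\<lambda>x. emeasure (P x) A) \<in> borel_measurable borel"
    by (auto simp: emeasure_P_cylinder)
qed (auto simp: prob_space_P)

lemma measurable_P_subprob [measurable]: "P \<in> measurable borel (subprob_algebra seqs)"
  using measurable_P by (rule measurable_prob_algebraD)

lemma prob_space_P_Cons: "prob_space (distr (P (wbar M a x)) seqs (case_nat a))"
  by (rule P.prob_space_distr) simp

lemma measurable_P_Cons:
  "sets N = UNIV \<Longrightarrow>
    (\<lambda>a. distr (P (wbar M a x)) seqs (case_nat a)) \<in> measurable N (subprob_algebra seqs)"
  using prob_space_P_Cons sets_eq_imp_space_eq[of N "count_space UNIV"]
  by (auto simp: measurable_def space_subprob_algebra intro!: prob_space_imp_subprob_space)

text \<open>First-step decomposition: draw the first letter \<open>a\<close> with weight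
  \<open>prbbar M a x\<close> and continue with a path from \<open>wbar M a x\<close>. This is the
  only form in which the Markov property enters the integral formulas below.\<close>

lemma P_eq_bind:
  "P x = density (count_space UNIV) (\<lambda>a. ennreal (prbbar M a x)) \<bind>
    (\<lambda>a. distr (P (wbar M a x)) seqs (case_nat a))" (is "_ = Giry_Monad.bind ?N ?K")
proof -
  interpret N: prob_space ?N
    by (rule prob_spaceI) (simp add: emeasure_density nn_integral_prbbar)
  have K: "?K \<in> measurable ?N (subprob_algebra seqs)"
    by (rule measurable_P_Cons) simp
  have prob: "prob_space (?N \<bind> ?K)"
    by (rule N.prob_space_bind[OF _ K]) (auto intro!: AE_I2 prob_space_P_Cons)
  show ?thesis
  proof (rule seqs_measure_eqI)
    show sets: "sets (?N \<bind> ?K) = sets seqs"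
      by (rule sets_bind) auto
    fix w :: "'e option list"
    show "emeasure (P x) (cylinder w) = emeasure (?N \<bind> ?K) (cylinder w)"
    proof (cases w)
      case Nil
      have "space (?N \<bind> ?K) = UNIV" using sets_eq_imp_space_eq[OF sets] by simp
      then show ?thesis
        using Nil prob_space.emeasure_space_1[OF prob] P.emeasure_space_1[of x] by simp
    next
      case (Cons b w')
      have vim: "case_nat a -` cylinder (b # w') = (if a = b then cylinder w' else {})" for a
        by (auto simp: cylinder_def nth_Cons split: nat.splits)
      have "emeasure (?N \<bind> ?K) (cylinder w) = (\<integral>\<^sup>+a. emeasure (?K a) (cylinder w) \<partial>?N)"
        by (rule emeasure_bind[OF _ K]) auto
      also have "\<dots> = (\<integral>\<^sup>+a. (if a = b then ennreal (prbbar M a x) * emeasure (P (wbar M a x)) (cylinder w') else 0)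
          \<partial>count_space UNIV)"
        unfolding Cons
        by (subst nn_integral_density) (auto simp: emeasure_distr vim intro!: nn_integral_cong)
      also have "\<dots> = emeasure (P x) (cylinder w)"
        by (simp add: nn_integral_pos_eq_point emeasure_P_cylinder Cons ennreal_mult)
      finally show ?thesis ..
    qed
  qed (auto intro: P.finite_measure_axioms)
qed

lemma nn_integral_P:
  assumes f [measurable]: "f \<in> borel_measurable seqs"
  shows "(\<integral>\<^sup>+\<sigma>. f \<sigma> \<partial>P x) =
    (\<integral>\<^sup>+a. ennreal (prbbar M a x) * (\<integral>\<^sup>+\<sigma>. f (case_nat a \<sigma>) \<partial>P (wbar M a x)) \<partial>count_space UNIV)"
proof -
  let ?N = "density (count_space UNIV) (\<lambda>a. ennreal (prbbar M a x))"
  let ?K = "\<lambda>a. distr (P (wbar M a x)) seqs (case_nat a)"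
  have K: "?K \<in> measurable ?N (subprob_algebra seqs)"
    by (rule measurable_P_Cons) simp
  have "(\<integral>\<^sup>+\<sigma>. f \<sigma> \<partial>P x) = (\<integral>\<^sup>+a. (\<integral>\<^sup>+\<sigma>. f \<sigma> \<partial>?K a) \<partial>?N)"
    by (subst P_eq_bind) (rule nn_integral_bind[OF f K])
  also have "\<dots> = (\<integral>\<^sup>+a. ennreal (prbbar M a x) * (\<integral>\<^sup>+\<sigma>. f \<sigma> \<partial>?K a) \<partial>count_space UNIV)"
    by (subst nn_integral_density) auto
  also have "\<dots> = (\<integral>\<^sup>+a. ennreal (prbbar M a x) * (\<integral>\<^sup>+\<sigma>. f (case_nat a \<sigma>) \<partial>P (wbar M a x)) \<partial>count_space UNIV)"
    by (subst nn_integral_distr) auto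
  finally show ?thesis .
qed

lemma emeasure_P:
  assumes A [measurable]: "A \<in> sets seqs"
  shows "emeasure (P x) A =
    (\<integral>\<^sup>+a. ennreal (prbbar M a x) * emeasure (P (wbar M a x)) (case_nat a -` A) \<partial>count_space UNIV)"
proof -
  have *: "(\<lambda>\<sigma>. indicator A (case_nat a \<sigma>)) = (indicator (case_nat a -` A) :: _ \<Rightarrow> ennreal)" for a
    by (auto simp: indicator_def fun_eq_iff)
  have "emeasure (P x) A = (\<integral>\<^sup>+\<sigma>. indicator A \<sigma> \<partial>P x)" by simp
  also have "\<dots> = (\<integral>\<^sup>+a. ennreal (prbbar M a x) *
      (\<integral>\<^sup>+\<sigma>. indicator A (case_nat a \<sigma>) \<partial>P (wbar M a x)) \<partial>count_space UNIV)"
    by (rule nn_integral_P[OF borel_measurable_indicator[OF A]])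
  finally show ?thesis by (simp add: *)
qed

end

section \<open>Limits of measures on sequence spaces\<close>

lemma sum_le_nn_integral_count_space:
  fixes f :: "'b \<Rightarrow> ennreal"
  assumes "finite F"
  shows "(\<Sum>b\<in>F. f b) \<le> (\<integral>\<^sup>+b. f b \<partial>count_space UNIV)"
proof -
  have "(\<Sum>b\<in>F. f b) = (\<integral>\<^sup>+b. f b * indicator F b \<partial>count_space UNIV)"
    using assms by (simp add: nn_integral_count_space_indicator[symmetric] nn_integral_count_space_finite)
  also have "\<dots> \<le> (\<integral>\<^sup>+b. f b \<partial>count_space UNIV)"
    by (intro nn_integral_mono) (auto simp: indicator_def)
  finally show ?thesis .
qed

lemma nn_integral_count_space_SUP:
  fixes f :: "'b::countable \<Rightarrow> ennreal"
  shows "(\<integral>\<^sup>+b. f b \<partial>count_space UNIV) = (SUP F\<in>{F. finite F}. \<Sum>b\<in>F. f b)"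
  unfolding infsum_ennreal_eq_nn_integral[symmetric] by (subst nonneg_infsum_complete) auto

text \<open>The diagonal argument as compactness: a countable power of \<open>[0,1]\<close> is
  compact and metrizable, hence sequentially compact.\<close>

lemma convergent_subsequence_pointwise:
  fixes q :: "nat \<Rightarrow> 'b::countable \<Rightarrow> real"
  assumes "\<And>n b. 0 \<le> q n b \<and> q n b \<le> 1"
  shows "\<exists>r l. strict_mono (r :: nat \<Rightarrow> nat) \<and> (\<forall>b. (\<lambda>n. q (r n) b) \<longlonglongrightarrow> l b)"
proof -
  let ?S = "PiE UNIV (\<lambda>_::'b. {0..1::real})"
  have "compactin (product_topology (\<lambda>_. euclidean) UNIV) ?S"
    by (subst compactin_PiE) auto
  then have "compact ?S" by (simp add: euclidean_product_topology)
  then have "seq_compact ?S" by (simp add: compact_eq_seq_compact_metric)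
  moreover have "\<forall>n. q n \<in> ?S" using assms by auto
  ultimately obtain l r where r: "strict_mono r" "(q \<circ> r) \<longlonglongrightarrow> l"
    unfolding seq_compact_def by blast
  have "(\<lambda>n. q (r n) b) \<longlonglongrightarrow> l b" for b
  proof -
    have "isCont (\<lambda>f. f b :: real) l"
    proof -
      have "continuous_on UNIV (\<lambda>f :: 'b \<Rightarrow> real. f b)" by (rule continuous_on_product_coordinates)
      then show ?thesis unfolding continuous_on_eq_continuous_at[OF open_UNIV] by blast
    qed
    from isCont_tendsto_compose[OF this r(2)] show ?thesis by (simp add: o_def)
  qed
  then show ?thesis using r(1) by blast
qed

text \<open>Interchange of a limit with a countable sum. The hypothesis \<open>lo\<close> is
  tightness, with one finite set for all \<open>n\<close>; the vanishing error
  \<open>\<delta>\<close> admits families whose sums are only asymptotically equal to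
  \<open>s\<close>. It shows that limits of cylinder weights are again consistent.\<close>

lemma nn_integral_limit_of_tight:
  fixes f :: "nat \<Rightarrow> 'b::countable \<Rightarrow> real"
  assumes nonneg: "\<And>n b. 0 \<le> f n b" and f: "\<And>b. (\<lambda>n. f n b) \<longlonglongrightarrow> l b"
    and s: "s \<longlonglongrightarrow> s'" and \<delta>: "\<delta> \<longlonglongrightarrow> 0"
    and up: "\<And>F n. finite F \<Longrightarrow> (\<Sum>b\<in>F. f n b) \<le> s n + \<delta> n"
    and lo: "\<And>\<epsilon>. 0 < \<epsilon> \<Longrightarrow> \<exists>F. finite F \<and> (\<forall>n. s n \<le> (\<Sum>b\<in>F. f n b) + \<epsilon> + \<delta> n)"
  shows "(\<integral>\<^sup>+b. ennreal (l b) \<partial>count_space UNIV) = ennreal s'"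
proof (rule antisym)
  have l_nonneg: "0 \<le> l b" for b
    by (rule LIMSEQ_le_const[OF f]) (use nonneg in auto)
  have lim_sum: "(\<lambda>n. \<Sum>b\<in>F. f n b) \<longlonglongrightarrow> (\<Sum>b\<in>F. l b)" for F
    by (intro tendsto_sum f)
  show "(\<integral>\<^sup>+b. ennreal (l b) \<partial>count_space UNIV) \<le> ennreal s'"
    unfolding nn_integral_count_space_SUP
  proof (rule SUP_least)
    fix F :: "'b set" assume "F \<in> {F. finite F}"
    then have F: "finite F" by simp
    have "(\<Sum>b\<in>F. l b) \<le> s' + 0"
      using up[OF F] by (intro LIMSEQ_le[OF lim_sum tendsto_add[OF s \<delta>]]) auto
    then show "(\<Sum>b\<in>F. ennreal (l b)) \<le> ennreal s'"
      using l_nonneg by (simp add: ennreal_leI)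
  qed
  show "ennreal s' \<le> (\<integral>\<^sup>+b. ennreal (l b) \<partial>count_space UNIV)"
  proof (rule ennreal_le_epsilon)
    fix \<epsilon> :: real assume \<epsilon>: "0 < \<epsilon>"
    obtain F where F: "finite F" "\<forall>n. s n \<le> (\<Sum>b\<in>F. f n b) + \<epsilon> + \<delta> n"
      using lo[OF \<epsilon>] by blast
    have "s' \<le> (\<Sum>b\<in>F. l b) + \<epsilon> + 0"
      using F(2) by (intro LIMSEQ_le[OF s tendsto_add[OF tendsto_add[OF lim_sum tendsto_const] \<delta>]]) auto
    then have "ennreal s' \<le> ennreal (\<Sum>b\<in>F. l b) + ennreal \<epsilon>"
      using l_nonneg \<epsilon> by (simp add: ennreal_plus[symmetric] sum_nonneg ennreal_leI del: ennreal_plus)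
    also have "ennreal (\<Sum>b\<in>F. l b) = (\<Sum>b\<in>F. ennreal (l b))" using l_nonneg by simp
    also have "\<dots> \<le> (\<integral>\<^sup>+b. ennreal (l b) \<partial>count_space UNIV)"
      by (rule sum_le_nn_integral_count_space[OF F(1)])
    finally show "ennreal s' \<le> (\<integral>\<^sup>+b. ennreal (l b) \<partial>count_space UNIV) + ennreal \<epsilon>" by simp
  qed
qed

abbreviation shift_seq :: "(nat \<Rightarrow> 'b) \<Rightarrow> nat \<Rightarrow> 'b" where
  "shift_seq \<sigma> \<equiv> (\<lambda>n. \<sigma> (Suc n))"

lemma cylinder_snoc: "cylinder (w @ [b]) = cylinder w \<inter> {\<sigma>. \<sigma> (length w) = b}"
  by (auto simp: cylinder_def nth_append less_Suc_eq)

lemma cylinder_Cons: "cylinder (b # w) = {\<sigma>. \<sigma> 0 = b} \<inter> shift_seq -` cylinder w"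
  by (auto simp: cylinder_def nth_Cons split: nat.splits)

lemma coordinate_in_sets [measurable]: "{\<sigma>. \<sigma> k \<in> A} \<in> sets seqs"
  using measurable_sets[OF measurable_seqs_component, of A k] by (simp add: vimage_def)

lemma shift_vimage_in_sets: "A \<in> sets seqs \<Longrightarrow> shift_seq -` A \<in> sets seqs"
  using measurable_sets[OF measurable_shift_seqs, of A] by simp

lemma disjoint_cylinder_snoc: "disjoint_family_on (\<lambda>b. cylinder (w @ [b])) F"
  by (auto simp: disjoint_family_on_def cylinder_snoc)

lemma disjoint_cylinder_Cons: "disjoint_family_on (\<lambda>b. cylinder (b # w)) F"
  by (auto simp: disjoint_family_on_def cylinder_Cons)

text \<open>The Krylov-Bogolyubov construction. Tightness of the single coordinates replaces compactness of
  the alphabet.\<close>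

lemma stationary_limit_exists:
  fixes Q :: "nat \<Rightarrow> (nat \<Rightarrow> 'b::countable) measure"
  assumes prob: "\<And>n. prob_space (Q n)" and sets: "\<And>n. sets (Q n) = sets seqs"
    and tight: "\<And>\<epsilon>. 0 < \<epsilon> \<Longrightarrow> \<exists>F. finite F \<and> (\<forall>n. measure (Q n) {\<sigma>. \<sigma> 0 \<notin> F} \<le> \<epsilon>)"
    and \<delta>: "\<delta> \<longlonglongrightarrow> 0"
    and stat: "\<And>n A. A \<in> sets seqs \<Longrightarrow> \<bar>measure (Q n) (shift_seq -` A) - measure (Q n) A\<bar> \<le> \<delta> n"
  shows "\<exists>r Q'. strict_mono (r :: nat \<Rightarrow> nat) \<and> prob_space Q' \<and> sets Q' = sets seqs \<and>
    (\<forall>w. (\<lambda>n. measure (Q (r n)) (cylinder w)) \<longlonglongrightarrow> measure Q' (cylinder w)) \<and>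
    distr Q' seqs shift_seq = Q'"
proof -
  interpret Q: prob_space "Q n" for n by (rule prob)
  have cyl: "cylinder w \<in> sets (Q n)" for w n by (simp add: sets)
  have co: "{\<sigma>. \<sigma> k \<in> A} \<in> sets (Q n)" for k A n by (simp add: sets coordinate_in_sets)
  have co': "{\<sigma>. \<sigma> k = b} \<in> sets (Q n)" "{\<sigma>. \<sigma> k \<notin> A} \<in> sets (Q n)" for k A b n
    using co[of k "{b}" n] co[of k "- A" n] by simp_all
  have sh: "shift_seq -` cylinder w \<in> sets (Q n)" for w n
    using shift_vimage_in_sets[OF cylinder_in_sets] by (simp add: sets)
  obtain r q where r: "strict_mono (r :: nat \<Rightarrow> nat)"
    and q: "\<And>w. (\<lambda>n. measure (Q (r n)) (cylinder w)) \<longlonglongrightarrow> q w"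
    using convergent_subsequence_pointwise[of "\<lambda>n w. measure (Q n) (cylinder w)"] by auto
  have \<delta>r: "(\<lambda>n. \<delta> (r n)) \<longlonglongrightarrow> 0" using LIMSEQ_subseq_LIMSEQ[OF \<delta> r] by (simp add: o_def)
  have \<delta>_nonneg: "0 \<le> \<delta> n" for n using stat[of "{}" n] by simp
  have q_nonneg: "0 \<le> q w" for w by (rule LIMSEQ_le_const[OF q]) auto
  have q_Nil: "q [] = 1"
    using q[of "[]"] Q.prob_space sets_eq_imp_space_eq[OF sets] LIMSEQ_unique[OF tendsto_const] by fastforce
  \<comment> \<open>Tightness is assumed for coordinate 0 only; each shift to the next coordinate
    costs one \<open>\<delta> n\<close>.\<close>
  have coord: "measure (Q n) {\<sigma>. \<sigma> m \<notin> F} \<le> measure (Q n) {\<sigma>. \<sigma> 0 \<notin> F} + real m * \<delta> n" for m n F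
  proof (induction m)
    case (Suc m)
    have "shift_seq -` {\<sigma>. \<sigma> m \<notin> F} = {\<sigma>. \<sigma> (Suc m) \<notin> F}" by auto
    then show ?case
      using stat[of "{\<sigma>. \<sigma> m \<notin> F}" n] co'(2)[of m F n] Suc by (simp add: sets algebra_simps)
  qed simp
  \<comment> \<open>Consistency under appending a letter is what the existence of a limit measure
    requires.\<close>
  have right: "(\<integral>\<^sup>+b. ennreal (q (w @ [b])) \<partial>count_space UNIV) = ennreal (q w)" for w
  proof (rule nn_integral_limit_of_tight[OF _ q q, where \<delta> = "\<lambda>n. real (length w) * \<delta> (r n)"])
    show "(\<lambda>n. real (length w) * \<delta> (r n)) \<longlonglongrightarrow> 0"
      using tendsto_mult_right_zero[OF \<delta>r] .
    have split: "measure (Q n) (cylinder w) = (\<Sum>b\<in>F. measure (Q n) (cylinder (w @ [b])))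
        + measure (Q n) (cylinder w \<inter> {\<sigma>. \<sigma> (length w) \<notin> F})" if "finite F" for F n
    proof -
      have "measure (Q n) (\<Union>b\<in>F. cylinder (w @ [b])) = (\<Sum>b\<in>F. measure (Q n) (cylinder (w @ [b])))"
        using that cyl by (intro Q.finite_measure_finite_Union) (auto simp: disjoint_cylinder_snoc)
      moreover have "measure (Q n) ((\<Union>b\<in>F. cylinder (w @ [b])) \<union> (cylinder w \<inter> {\<sigma>. \<sigma> (length w) \<notin> F}))
          = measure (Q n) (\<Union>b\<in>F. cylinder (w @ [b])) + measure (Q n) (cylinder w \<inter> {\<sigma>. \<sigma> (length w) \<notin> F})"
        using that cyl co' by (intro Q.finite_measure_Union sets.finite_UN sets.Int) (auto simp: cylinder_snoc)
      moreover have "(\<Union>b\<in>F. cylinder (w @ [b])) \<union> (cylinder w \<inter> {\<sigma>. \<sigma> (length w) \<notin> F}) = cylinder w"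
        by (auto simp: cylinder_snoc)
      ultimately show ?thesis by simp
    qed
    show "(\<Sum>b\<in>F. measure (Q (r n)) (cylinder (w @ [b])))
        \<le> measure (Q (r n)) (cylinder w) + real (length w) * \<delta> (r n)" if "finite F" for F n
      unfolding split[OF that] using \<delta>_nonneg by (simp add: add_nonneg_nonneg)
    show "\<exists>F. finite F \<and> (\<forall>n. measure (Q (r n)) (cylinder w)
        \<le> (\<Sum>b\<in>F. measure (Q (r n)) (cylinder (w @ [b]))) + \<epsilon> + real (length w) * \<delta> (r n))" if \<epsilon>: "0 < \<epsilon>" for \<epsilon>
    proof -
      obtain F where F: "finite F" "\<And>n. measure (Q n) {\<sigma>. \<sigma> 0 \<notin> F} \<le> \<epsilon>" using tight[OF \<epsilon>] by blast
      have "measure (Q n) (cylinder w \<inter> {\<sigma>. \<sigma> (length w) \<notin> F}) \<le> \<epsilon> + real (length w) * \<delta> n" for n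
      proof -
        have "measure (Q n) (cylinder w \<inter> {\<sigma>. \<sigma> (length w) \<notin> F}) \<le> measure (Q n) {\<sigma>. \<sigma> (length w) \<notin> F}"
          using co' by (intro Q.finite_measure_mono) auto
        then show ?thesis using coord[of n "length w" F] F(2)[of n] by linarith
      qed
      then show ?thesis using F(1) unfolding split[OF F(1)] by (intro exI[of _ F]) (auto simp: add.assoc)
    qed
  qed simp
  \<comment> \<open>Consistency under prepending a letter is shift invariance of the limit, read on
    cylinders.\<close>
  have left: "(\<integral>\<^sup>+b. ennreal (q (b # w)) \<partial>count_space UNIV) = ennreal (q w)" for w
  proof (rule nn_integral_limit_of_tight[OF _ q q \<delta>r])
    have split: "measure (Q n) (shift_seq -` cylinder w) = (\<Sum>b\<in>F. measure (Q n) (cylinder (b # w)))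
        + measure (Q n) (shift_seq -` cylinder w \<inter> {\<sigma>. \<sigma> 0 \<notin> F})" if "finite F" for F n
    proof -
      have "measure (Q n) (\<Union>b\<in>F. cylinder (b # w)) = (\<Sum>b\<in>F. measure (Q n) (cylinder (b # w)))"
        using that cyl by (intro Q.finite_measure_finite_Union) (auto simp: disjoint_cylinder_Cons)
      moreover have "measure (Q n) ((\<Union>b\<in>F. cylinder (b # w)) \<union> (shift_seq -` cylinder w \<inter> {\<sigma>. \<sigma> 0 \<notin> F}))
          = measure (Q n) (\<Union>b\<in>F. cylinder (b # w)) + measure (Q n) (shift_seq -` cylinder w \<inter> {\<sigma>. \<sigma> 0 \<notin> F})"
        using that cyl co' sh by (intro Q.finite_measure_Union sets.finite_UN sets.Int) (auto simp: cylinder_Cons)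
      moreover have "(\<Union>b\<in>F. cylinder (b # w)) \<union> (shift_seq -` cylinder w \<inter> {\<sigma>. \<sigma> 0 \<notin> F}) = shift_seq -` cylinder w"
        by (auto simp: cylinder_Cons)
      ultimately show ?thesis by simp
    qed
    have near: "\<bar>measure (Q n) (shift_seq -` cylinder w) - measure (Q n) (cylinder w)\<bar> \<le> \<delta> n" for n
      by (rule stat) simp
    show "(\<Sum>b\<in>F. measure (Q (r n)) (cylinder (b # w))) \<le> measure (Q (r n)) (cylinder w) + \<delta> (r n)"
      if "finite F" for F n
    proof -
      have "0 \<le> measure (Q (r n)) (shift_seq -` cylinder w \<inter> {\<sigma>. \<sigma> 0 \<notin> F})" by simp
      then show ?thesis using split[OF that, of "r n"] near[of "r n"] by linarith
    qed
    show "\<exists>F. finite F \<and> (\<forall>n. measure (Q (r n)) (cylinder w)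
        \<le> (\<Sum>b\<in>F. measure (Q (r n)) (cylinder (b # w))) + \<epsilon> + \<delta> (r n))" if \<epsilon>: "0 < \<epsilon>" for \<epsilon>
    proof -
      obtain F where F: "finite F" "\<And>n. measure (Q n) {\<sigma>. \<sigma> 0 \<notin> F} \<le> \<epsilon>" using tight[OF \<epsilon>] by blast
      have "measure (Q n) (cylinder w) \<le> (\<Sum>b\<in>F. measure (Q n) (cylinder (b # w))) + \<epsilon> + \<delta> n" for n
      proof -
        have "measure (Q n) (shift_seq -` cylinder w \<inter> {\<sigma>. \<sigma> 0 \<notin> F}) \<le> measure (Q n) {\<sigma>. \<sigma> 0 \<notin> F}"
          using co' by (intro Q.finite_measure_mono) auto
        then show ?thesis using split[OF F(1), of n] near[of n] F(2)[of n] by linarith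
      qed
      then show ?thesis using F(1) by blast
    qed
  qed simp
  obtain Q' where Q': "prob_space Q'" "sets Q' = sets seqs" "\<And>w. emeasure Q' (cylinder w) = ennreal (q w)"
    using cylinder_measure_exists[of "\<lambda>w. ennreal (q w)"] right q_Nil by auto
  interpret Q': prob_space Q' by fact
  have "distr Q' seqs shift_seq = Q'"
  proof (rule seqs_measure_eqI)
    have meas: "shift_seq \<in> measurable Q' seqs"
      by (simp only: measurable_cong_sets[OF Q'(2) refl] measurable_shift_seqs)
    interpret D: prob_space "distr Q' seqs shift_seq" by (rule Q'.prob_space_distr[OF meas])
    show "finite_measure (distr Q' seqs shift_seq)" by (rule D.finite_measure_axioms)
    fix w :: "'b list"
    have sp: "space Q' = UNIV" using sets_eq_imp_space_eq[OF Q'(2)] by simp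
    have "emeasure (distr Q' seqs shift_seq) (cylinder w) = emeasure Q' (shift_seq -` cylinder w)"
      using emeasure_distr[OF meas cylinder_in_sets] sp by simp
    also have "shift_seq -` cylinder w = (\<Union>b. cylinder (b # w))"
      by (auto simp: cylinder_Cons)
    also have "emeasure Q' \<dots> = (\<integral>\<^sup>+b. emeasure Q' (cylinder (b # w)) \<partial>count_space UNIV)"
      using Q'(2) by (intro emeasure_UN_countable) (auto simp: disjoint_cylinder_Cons)
    also have "\<dots> = emeasure Q' (cylinder w)" by (simp add: Q'(3) left)
    finally show "emeasure (distr Q' seqs shift_seq) (cylinder w) = emeasure Q' (cylinder w)" .
  qed (use Q' in auto)
  moreover have "measure Q' (cylinder w) = q w" for w
    using Q'(3) q_nonneg by (simp add: measure_def)
  ultimately show ?thesis using r q Q' by (intro exI[of _ r] exI[of _ Q']) auto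
qed

section \<open>Limits of integrals of functions of finitely many letters\<close>

lemma nn_integral_prefix:
  fixes h :: "'b::countable list \<Rightarrow> ennreal"
  assumes "sets Q = sets seqs"
  shows "(\<integral>\<^sup>+\<sigma>. h (map \<sigma> [0..<L]) \<partial>Q) = (\<integral>\<^sup>+w. h w * emeasure Q (cylinder w) \<partial>count_space {w. length w = L})"
proof -
  have sp: "space Q = UNIV" using sets_eq_imp_space_eq[OF assms] by simp
  have cyl: "cylinder w \<in> sets Q" for w using assms by simp
  have "(\<integral>\<^sup>+\<sigma>. h (map \<sigma> [0..<L]) \<partial>Q)
      = (\<integral>\<^sup>+\<sigma>. (\<integral>\<^sup>+w. h w * indicator (cylinder w) \<sigma> \<partial>count_space {w. length w = L}) \<partial>Q)"
  proof (rule nn_integral_cong)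
    fix \<sigma> :: "nat \<Rightarrow> 'b"
    let ?v = "map \<sigma> [0..<L]"
    have "(\<integral>\<^sup>+w. h w * indicator (cylinder w) \<sigma> \<partial>count_space {w. length w = L})
        = (\<Sum>w\<in>{?v}. h w * indicator (cylinder w) \<sigma>)"
      by (rule nn_integral_count_space') (auto simp: indicator_def mem_cylinder_iff split: if_splits)
    then show "h ?v = (\<integral>\<^sup>+w. h w * indicator (cylinder w) \<sigma> \<partial>count_space {w. length w = L})"
      by (simp add: mem_cylinder_iff)
  qed
  also have "\<dots> = (\<integral>\<^sup>+w. (\<integral>\<^sup>+\<sigma>. h w * indicator (cylinder w) \<sigma> \<partial>Q) \<partial>count_space {w. length w = L})"
    using cyl by (intro nn_integral_count_space_nn_integral) auto
  also have "\<dots> = (\<integral>\<^sup>+w. h w * emeasure Q (cylinder w) \<partial>count_space {w. length w = L})"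
    using cyl by (simp add: nn_integral_cmult_indicator)
  finally show ?thesis .
qed

text \<open>Fatou's lemma for the sum over words of length \<open>L\<close>. Prefix functions such
  as distances between orbits are unbounded, so only this one inequality passes to the limit for
  them.\<close>

lemma nn_integral_prefix_liminf:
  fixes h :: "'b::countable list \<Rightarrow> ennreal"
  assumes Q: "\<And>n. prob_space (Q n)" "\<And>n. sets (Q n) = sets seqs"
    and Q': "prob_space Q'" "sets Q' = sets seqs"
    and lim: "\<And>w. (\<lambda>n. measure (Q n) (cylinder w)) \<longlonglongrightarrow> measure Q' (cylinder w)"
  shows "(\<integral>\<^sup>+\<sigma>. h (map \<sigma> [0..<L]) \<partial>Q') \<le> liminf (\<lambda>n. \<integral>\<^sup>+\<sigma>. h (map \<sigma> [0..<L]) \<partial>Q n)"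
proof -
  have em: "emeasure (Q n) A = ennreal (measure (Q n) A)" "emeasure Q' A = ennreal (measure Q' A)" for n A
    using Q(1)[of n] Q'(1) by (simp_all add: finite_measure.emeasure_eq_measure prob_space.axioms(1))
  have "(\<lambda>n. h w * emeasure (Q n) (cylinder w)) \<longlonglongrightarrow> h w * emeasure Q' (cylinder w)" if "h w \<noteq> \<top>" for w
    unfolding em using that lim by (intro ennreal_tendsto_cmult tendsto_ennrealI) (simp add: less_top)
  then have fin: "h w * emeasure Q' (cylinder w) \<le> liminf (\<lambda>n. h w * emeasure (Q n) (cylinder w))"
    if "h w \<noteq> \<top>" for w
    using lim_imp_Liminf[OF sequentially_bot] that by (metis order_refl)
  have *: "h w * emeasure Q' (cylinder w) \<le> liminf (\<lambda>n. h w * emeasure (Q n) (cylinder w))" for w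
  proof (cases "h w = \<top>")
    \<comment> \<open>Multiplication by \<infinity> is discontinuous at 0, so this weight is treated
      by whether the limit measure charges the cylinder.\<close>
    case True
    show ?thesis
    proof (cases "measure Q' (cylinder w) = 0")
      case False
      then have "0 < measure Q' (cylinder w)" by (simp add: less_le)
      then have "eventually (\<lambda>n. 0 < measure (Q n) (cylinder w)) sequentially"
        using lim by (rule order_tendstoD(1)[rotated])
      then have "eventually (\<lambda>n. h w * emeasure (Q n) (cylinder w) = \<top>) sequentially"
        by eventually_elim (simp add: True em ennreal_top_mult)
      then have "(\<lambda>n. h w * emeasure (Q n) (cylinder w)) \<longlonglongrightarrow> \<top>"
        by (rule tendsto_eventually)
      then show ?thesis by (simp add: lim_imp_Liminf)
    qed (simp add: em)
  qed (rule fin)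
  show ?thesis
    unfolding nn_integral_prefix[OF Q(2)] nn_integral_prefix[OF Q'(2)]
    using * by (intro order_trans[OF _ nn_integral_liminf] nn_integral_mono) auto
qed

text \<open>Fatou applied to \<open>h\<close> and to \<open>1 - h\<close>; the total mass 1 turns
  the second lower bound into an upper bound for \<open>h\<close>.\<close>

lemma integral_prefix_tendsto:
  fixes h :: "'b::countable list \<Rightarrow> real"
  assumes Q: "\<And>n. prob_space (Q n)" "\<And>n. sets (Q n) = sets seqs"
    and Q': "prob_space Q'" "sets Q' = sets seqs"
    and lim: "\<And>w. (\<lambda>n. measure (Q n) (cylinder w)) \<longlonglongrightarrow> measure Q' (cylinder w)"
    and h: "\<And>w. 0 \<le> h w" "\<And>w. h w \<le> 1"
  shows "(\<lambda>n. \<integral>\<sigma>. h (map \<sigma> [0..<L]) \<partial>Q n) \<longlonglongrightarrow> (\<integral>\<sigma>. h (map \<sigma> [0..<L]) \<partial>Q')"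
proof -
  have meas: "(\<lambda>\<sigma>. g (map \<sigma> [0..<L])) \<in> borel_measurable N" if "sets N = sets seqs" for g :: "'b list \<Rightarrow> real" and N
    unfolding measurable_cong_sets[OF that refl]
    by (rule measurable_compose[OF measurable_map_seqs]) (simp only: measurable_count_space_eq1 space_borel, simp)
  have int: "integrable N (\<lambda>\<sigma>. g (map \<sigma> [0..<L]))"
    and nn: "(\<integral>\<^sup>+\<sigma>. ennreal (g (map \<sigma> [0..<L])) \<partial>N) = ennreal (\<integral>\<sigma>. g (map \<sigma> [0..<L]) \<partial>N)"
    if "prob_space N" and N: "sets N = sets seqs" and g: "\<And>w. 0 \<le> g w" "\<And>w. g w \<le> 1" for g :: "'b list \<Rightarrow> real" and N
  proof -
    interpret prob_space N by fact
    show int: "integrable N (\<lambda>\<sigma>. g (map \<sigma> [0..<L]))"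
      by (rule integrable_const_bound[where B = 1, OF _ meas[OF N]]) (use g in auto)
    show "(\<integral>\<^sup>+\<sigma>. ennreal (g (map \<sigma> [0..<L])) \<partial>N) = ennreal (\<integral>\<sigma>. g (map \<sigma> [0..<L]) \<partial>N)"
      using g by (intro nn_integral_eq_integral int) auto
  qed
  let ?I = "\<lambda>g N. \<integral>\<sigma>. g (map \<sigma> [0..<L]) \<partial>N"
  have lower: "ereal (?I g Q') \<le> liminf (\<lambda>n. ereal (?I g (Q n)))"
    if g: "\<And>w. 0 \<le> g w" "\<And>w. g w \<le> 1" for g :: "'b list \<Rightarrow> real"
  proof (rule le_Liminf_iff[THEN iffD2], intro allI impI)
    fix y assume y: "y < ereal (?I g Q')"
    have I_nonneg: "0 \<le> ?I g N" for N using g by (simp add: integral_nonneg_AE)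
    show "eventually (\<lambda>n. y < ereal (?I g (Q n))) sequentially"
    proof (cases "y < 0")
      case True
      then show ?thesis using I_nonneg by (intro always_eventually allI) (metis ereal_less_eq(5) less_le_trans)
    next
      case False
      then obtain t where t: "y = ereal t" "0 \<le> t" using y by (cases y) auto
      have "ennreal (?I g Q') \<le> liminf (\<lambda>n. ennreal (?I g (Q n)))"
      proof -
        have "(\<integral>\<^sup>+\<sigma>. ennreal (g (map \<sigma> [0..<L])) \<partial>N) = ennreal (?I g N)"
          if "prob_space N" "sets N = sets seqs" for N
          using that g by (rule nn)
        then show ?thesis
          using nn_integral_prefix_liminf[OF Q Q' lim, of "\<lambda>w. ennreal (g w)" L] Q Q' by simp
      qed
      moreover have "ennreal t < ennreal (?I g Q')" using t y by (simp add: ennreal_less_iff)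
      ultimately have "eventually (\<lambda>n. ennreal t < ennreal (?I g (Q n))) sequentially"
        unfolding le_Liminf_iff by blast
      then show ?thesis by eventually_elim (use t in \<open>simp add: ennreal_less_iff\<close>)
    qed
  qed
  have compl: "?I (\<lambda>w. 1 - h w) N = 1 - ?I h N" if "prob_space N" "sets N = sets seqs" for N
  proof -
    interpret prob_space N by fact
    show ?thesis using int[where g = h, OF that h] by (simp add: prob_space)
  qed
  show ?thesis
  proof (rule tendstoI)
    fix \<epsilon> :: real assume \<epsilon>: "0 < \<epsilon>"
    have "ereal (?I h Q' - \<epsilon>) < ereal (?I h Q')" using \<epsilon> by simp
    then have 1: "eventually (\<lambda>n. ereal (?I h Q' - \<epsilon>) < ereal (?I h (Q n))) sequentially"
      using lower[of h, OF h] unfolding le_Liminf_iff by blast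
    have less: "ereal (?I (\<lambda>w. 1 - h w) Q' - \<epsilon>) < ereal (?I (\<lambda>w. 1 - h w) Q')" using \<epsilon> by simp
    have 2: "eventually (\<lambda>n. ereal (?I (\<lambda>w. 1 - h w) Q' - \<epsilon>) < ereal (?I (\<lambda>w. 1 - h w) (Q n))) sequentially"
    proof -
      have "ereal (?I (\<lambda>w. 1 - h w) Q') \<le> liminf (\<lambda>n. ereal (?I (\<lambda>w. 1 - h w) (Q n)))"
        by (rule lower) (use h in auto)
      with less show ?thesis unfolding le_Liminf_iff by blast
    qed
    show "eventually (\<lambda>n. dist (?I h (Q n)) (?I h Q') < \<epsilon>) sequentially"
      using 1 2[unfolded compl[OF Q] compl[OF Q']] by eventually_elim (auto simp: dist_real_def)
  qed
qed

lemma emeasure_prefix_eqI: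
  fixes Q R :: "(nat \<Rightarrow> 'b::countable) measure"
  assumes Q: "sets Q = sets seqs" and R: "sets R = sets seqs"
    and eq: "\<And>w. length w = L \<Longrightarrow> emeasure Q (cylinder w) = emeasure R (cylinder w)"
  shows "emeasure Q {\<sigma>. map \<sigma> [0..<L] \<in> A} = emeasure R {\<sigma>. map \<sigma> [0..<L] \<in> A}"
proof -
  have un: "{\<sigma>. map \<sigma> [0..<L] \<in> A} = (\<Union>w\<in>{w \<in> A. length w = L}. cylinder w)"
    by (auto simp: mem_cylinder_iff)
  have disj: "disjoint_family_on cylinder {w \<in> A. length w = L}"
    by (auto simp: disjoint_family_on_def mem_cylinder_iff)
  have "emeasure N {\<sigma>. map \<sigma> [0..<L] \<in> A} = (\<integral>\<^sup>+w. emeasure N (cylinder w) \<partial>count_space {w \<in> A. length w = L})"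
    if "sets N = sets seqs" for N
    unfolding un using that disj by (intro emeasure_UN_countable) auto
  then show ?thesis using eq Q R by (auto intro!: nn_integral_cong)
qed

section \<open>Two-sided extension of a stationary measure\<close>

definition window :: "int \<Rightarrow> (int \<Rightarrow> 'b) \<Rightarrow> nat \<Rightarrow> 'b" where
  "window m \<sigma> = (\<lambda>k. \<sigma> (m + int k))"

abbreviation biseqs :: "(int \<Rightarrow> 'b) measure" where
  "biseqs \<equiv> PiM UNIV (\<lambda>_. count_space UNIV)"

lemma space_biseqs [simp]: "space biseqs = UNIV"
  by (simp add: space_PiM)

lemma measurable_biseqs_component: "(\<lambda>\<sigma>. \<sigma> k) \<in> measurable biseqs (count_space UNIV)"
  by (rule measurable_component_singleton) simp

lemma measurable_window: "window m \<in> measurable biseqs seqs"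
  unfolding window_def by (rule measurable_PiM_single') (auto intro: measurable_biseqs_component)

text \<open>The two-sided process is coded over the alphabet of pairs \<open>(\<sigma>\<^sub>k, \<sigma>\<^sub>-\<^sub>1\<^sub>-\<^sub>k)\<close>.\<close>

lemma two_sided_extension_exists:
  fixes Q :: "(nat \<Rightarrow> 'b::countable) measure"
  assumes Q: "prob_space Q" "sets Q = sets seqs" and stat: "distr Q seqs shift_seq = Q"
  shows "\<exists>\<Lambda>. prob_space \<Lambda> \<and> sets \<Lambda> = sets biseqs \<and> (\<forall>m. distr \<Lambda> seqs (window m) = Q)"
proof -
  interpret Q: prob_space Q by fact
  have sp: "space Q = UNIV" using sets_eq_imp_space_eq[OF Q(2)] by simp
  have cyl: "cylinder w \<in> sets Q" for w using Q(2) by simp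
  have shift: "shift_seq \<in> measurable Q seqs"
    by (simp only: measurable_cong_sets[OF Q(2) refl] measurable_shift_seqs)
  have stat_em: "emeasure Q (shift_seq -` A) = emeasure Q A" if "A \<in> sets seqs" for A
    using emeasure_distr[OF shift that] by (simp add: stat sp)
  have right: "(\<integral>\<^sup>+b. emeasure Q (cylinder (w @ [b])) \<partial>count_space UNIV) = emeasure Q (cylinder w)" for w
  proof -
    have "cylinder w = (\<Union>b. cylinder (w @ [b]))" by (auto simp: cylinder_snoc)
    moreover have "emeasure Q (\<Union>b. cylinder (w @ [b])) = (\<integral>\<^sup>+b. emeasure Q (cylinder (w @ [b])) \<partial>count_space UNIV)"
      using cyl by (intro emeasure_UN_countable) (auto simp: disjoint_cylinder_snoc)
    ultimately show ?thesis by simp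
  qed
  have left: "(\<integral>\<^sup>+b. emeasure Q (cylinder (b # w)) \<partial>count_space UNIV) = emeasure Q (cylinder w)" for w
  proof -
    have "emeasure Q (cylinder w) = emeasure Q (shift_seq -` cylinder w)" by (simp add: stat_em)
    also have "shift_seq -` cylinder w = (\<Union>b. cylinder (b # w))" by (auto simp: cylinder_Cons)
    also have "emeasure Q \<dots> = (\<integral>\<^sup>+b. emeasure Q (cylinder (b # w)) \<partial>count_space UNIV)"
      using cyl by (intro emeasure_UN_countable) (auto simp: disjoint_cylinder_Cons)
    finally show ?thesis by simp
  qed
  \<comment> \<open>The block at positions \<open>-N, ..., N - 1\<close> described by
    \<open>N\<close> pairs: second components, reversed, are the letters at negative positions,
    first components those from 0 on.\<close>
  define u where "u w = rev (map snd w) @ map fst w" for w :: "('b \<times> 'b) list"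
  \<comment> \<open>A further pair extends the block by one letter at each end, so consistency needs
    both \<open>left\<close> and \<open>right\<close>; the former is stationarity.\<close>
  have "(\<integral>\<^sup>+a. emeasure Q (cylinder (u (w @ [a]))) \<partial>count_space UNIV) = emeasure Q (cylinder (u w))" for w
  proof -
    have "(\<integral>\<^sup>+a. emeasure Q (cylinder (u (w @ [a]))) \<partial>count_space UNIV)
        = (\<integral>\<^sup>+b. (\<integral>\<^sup>+c. emeasure Q (cylinder (c # (u w @ [b]))) \<partial>count_space UNIV) \<partial>count_space UNIV)"
      by (subst nn_integral_fst_count_space[symmetric]) (simp add: u_def)
    then show ?thesis by (simp add: left right del: append_Cons)
  qed
  then obtain R where R: "prob_space R" "sets R = sets seqs" "\<And>w. emeasure R (cylinder w) = emeasure Q (cylinder (u w))"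
    using cylinder_measure_exists[of "\<lambda>w. emeasure Q (cylinder (u w))"] Q.emeasure_space_1 sp
    by (auto simp: u_def)
  interpret R: prob_space R by fact
  have spR: "space R = UNIV" using sets_eq_imp_space_eq[OF R(2)] by simp
  define \<Phi> where "\<Phi> \<tau> = (\<lambda>k::int. if 0 \<le> k then fst (\<tau> (nat k)) else snd (\<tau> (nat (- 1 - k))))" for \<tau> :: "nat \<Rightarrow> 'b \<times> 'b"
  have \<Phi>: "\<Phi> \<in> measurable R biseqs"
    unfolding measurable_cong_sets[OF R(2) refl] \<Phi>_def
  proof (rule measurable_PiM_single')
    fix k :: int
    have proj: "(\<lambda>\<tau>. f (\<tau> n)) \<in> measurable seqs (count_space (UNIV :: 'b set))" for f :: "'b \<times> 'b \<Rightarrow> 'b" and n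
      by (rule measurable_compose[OF measurable_seqs_component]) simp
    show "(\<lambda>\<tau>. if 0 \<le> k then fst (\<tau> (nat k)) else snd (\<tau> (nat (- 1 - k)))) \<in> measurable seqs (count_space (UNIV :: 'b set))"
    proof (cases "0 \<le> k")
      case True
      then show ?thesis using proj[of fst "nat k"] by (simp only: if_True)
    next
      case False
      then show ?thesis using proj[of snd "nat (- 1 - k)"] by (simp only: if_False)
    qed
  qed auto
  define \<Lambda> where "\<Lambda> = distr R biseqs \<Phi>"
  have sets\<Lambda>: "sets \<Lambda> = sets biseqs" by (simp add: \<Lambda>_def)
  have win: "window m \<in> measurable \<Lambda> seqs" for m
    by (simp only: measurable_cong_sets[OF sets\<Lambda> refl] measurable_window)
  interpret \<Lambda>: prob_space \<Lambda> unfolding \<Lambda>_def by (rule R.prob_space_distr[OF \<Phi>])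
  have sp\<Lambda>: "space \<Lambda> = UNIV" using sets_eq_imp_space_eq[OF sets\<Lambda>] by simp
  \<comment> \<open>Every word of length \<open>2 * N\<close> is \<open>u w\<close> for some word
    \<open>w\<close> of \<open>N\<close> pairs, so blocks centred at the origin have the law
    prescribed by \<open>Q\<close>.\<close>
  have sym: "emeasure (distr \<Lambda> seqs (window (- int N))) (cylinder v) = emeasure Q (cylinder v)"
    if len: "length v = 2 * N" for N v
  proof -
    define w where "w = zip (drop N v) (rev (take N v))"
    have w: "length w = N" "u w = v" using len by (auto simp: w_def u_def)
    have vim: "\<Phi> -` window (- int N) -` cylinder v = cylinder w"
    proof -
      have "window (- int N) (\<Phi> \<tau>) \<in> cylinder v \<longleftrightarrow> \<tau> \<in> cylinder w" for \<tau>
      proof -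
        have "window (- int N) (\<Phi> \<tau>) \<in> cylinder v
            \<longleftrightarrow> (\<forall>k<N. snd (\<tau> (N - 1 - k)) = v ! k) \<and> (\<forall>k<N. fst (\<tau> k) = v ! (N + k))"
        proof -
          have "(\<forall>k<2 * N. window (- int N) (\<Phi> \<tau>) k = v ! k) \<longleftrightarrow>
              (\<forall>k<N. window (- int N) (\<Phi> \<tau>) k = v ! k) \<and> (\<forall>k<N. window (- int N) (\<Phi> \<tau>) (N + k) = v ! (N + k))"
          proof safe
            fix k assume a: "\<forall>k<N. window (- int N) (\<Phi> \<tau>) k = v ! k"
              "\<forall>k<N. window (- int N) (\<Phi> \<tau>) (N + k) = v ! (N + k)" "k < 2 * N"
            show "window (- int N) (\<Phi> \<tau>) k = v ! k"
              using a(1)[rule_format, of k] a(2)[rule_format, of "k - N"] a(3) by (cases "k < N") auto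
          qed auto
          moreover have "window (- int N) (\<Phi> \<tau>) k = snd (\<tau> (N - 1 - k))" if "k < N" for k
          proof -
            have "nat (- 1 - (- int N + int k)) = N - 1 - k" using that by simp
            then show ?thesis using that by (simp add: window_def \<Phi>_def)
          qed
          moreover have "window (- int N) (\<Phi> \<tau>) (N + k) = fst (\<tau> k)" for k
            by (simp add: window_def \<Phi>_def)
          ultimately show ?thesis by (simp add: cylinder_def len)
        qed
        also have "(\<forall>k<N. snd (\<tau> (N - 1 - k)) = v ! k) \<longleftrightarrow> (\<forall>k<N. snd (\<tau> k) = v ! (N - 1 - k))"
        proof safe
          fix k assume "\<forall>k<N. snd (\<tau> (N - 1 - k)) = v ! k" "k < N"
          then show "snd (\<tau> k) = v ! (N - 1 - k)" by (elim allE[of _ "N - 1 - k"]) auto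
        next
          fix k assume "\<forall>k<N. snd (\<tau> k) = v ! (N - 1 - k)" "k < N"
          then show "snd (\<tau> (N - 1 - k)) = v ! k" by (elim allE[of _ "N - 1 - k"]) auto
        qed
        also have "(\<forall>k<N. snd (\<tau> k) = v ! (N - 1 - k)) \<and> (\<forall>k<N. fst (\<tau> k) = v ! (N + k)) \<longleftrightarrow> \<tau> \<in> cylinder w"
        proof -
          have "w ! k = (v ! (N + k), v ! (N - 1 - k))" if "k < N" for k
            using that len by (simp add: w_def rev_nth)
          then show ?thesis using w(1) by (auto simp: cylinder_def prod_eq_iff)
        qed
        finally show ?thesis .
      qed
      then show ?thesis by auto
    qed
    have "window (- int N) -` cylinder v \<in> sets biseqs"
      using measurable_sets[OF measurable_window cylinder_in_sets, of "- int N" v] by simp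
    then show ?thesis
      using emeasure_distr[OF win cylinder_in_sets, of "- int N" v] R(3)[of w]
      by (simp add: sp\<Lambda> \<Lambda>_def emeasure_distr[OF \<Phi>] spR vim w)
  qed
  have "distr \<Lambda> seqs (window m) = Q" for m
  proof (rule seqs_measure_eqI)
    interpret D: prob_space "distr \<Lambda> seqs (window m)" by (rule \<Lambda>.prob_space_distr[OF win])
    show "finite_measure (distr \<Lambda> seqs (window m))" by (rule D.finite_measure_axioms)
    fix w :: "'b list"
    \<comment> \<open>A radius large enough for the centred block to contain the positions
      \<open>m, ..., m + length w - 1\<close>; \<open>k\<close> is the offset of \<open>m\<close>
      inside the block.\<close>
    define N where "N = nat \<bar>m\<bar> + length w"
    define k where "k = nat (m + int N)"
    have k: "int k = m + int N" "k + length w \<le> 2 * N" by (auto simp: k_def N_def)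
    define A where "A = {v. take (length w) (drop k v) = w}"
    have win_k: "window m \<sigma> = (\<lambda>j. window (- int N) \<sigma> (k + j))" for \<sigma>
      using k(1) by (auto simp: window_def fun_eq_iff algebra_simps)
    have in_A: "map \<tau> [0..<2 * N] \<in> A \<longleftrightarrow> (\<lambda>j. \<tau> (k + j)) \<in> cylinder w" for \<tau>
    proof -
      have "take (length w) (drop k (map \<tau> [0..<2 * N])) = map (\<lambda>j. \<tau> (k + j)) [0..<length w]"
        using k(2) by (intro nth_equalityI) auto
      then show ?thesis by (simp add: A_def mem_cylinder_iff)
    qed
    have shift_k: "emeasure Q {\<tau>. (\<lambda>j. \<tau> (k + j)) \<in> cylinder w} = emeasure Q (cylinder w)" for k
    proof (induction k)
      case (Suc k)
      have "{\<tau>. (\<lambda>j. \<tau> (k + j)) \<in> cylinder w} \<in> sets seqs"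
      proof -
        have "(\<lambda>\<tau> j. \<tau> (k + j)) \<in> measurable seqs (seqs :: (nat \<Rightarrow> 'b) measure)"
          by (rule measurable_PiM_single') auto
        from measurable_sets[OF this cylinder_in_sets[of w]] show ?thesis by (simp add: vimage_def)
      qed
      from stat_em[OF this] Suc show ?case by simp
    qed simp
    have pre: "{\<tau>. map \<tau> [0..<2 * N] \<in> A} \<in> sets seqs"
      using measurable_sets[OF measurable_map_seqs, of A "2 * N"] by (simp add: vimage_def)
    have "emeasure (distr \<Lambda> seqs (window m)) (cylinder w) = emeasure \<Lambda> (window m -` cylinder w)"
      using emeasure_distr[OF win cylinder_in_sets] by (simp add: sp\<Lambda>)
    also have "window m -` cylinder w = window (- int N) -` {\<tau>. map \<tau> [0..<2 * N] \<in> A}"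
      by (auto simp: in_A win_k)
    also have "emeasure \<Lambda> \<dots> = emeasure (distr \<Lambda> seqs (window (- int N))) {\<tau>. map \<tau> [0..<2 * N] \<in> A}"
      using emeasure_distr[OF win pre] by (simp add: sp\<Lambda>)
    also have "\<dots> = emeasure Q {\<tau>. map \<tau> [0..<2 * N] \<in> A}"
      using Q(2) sym by (intro emeasure_prefix_eqI) auto
    also have "\<dots> = emeasure Q (cylinder w)" using shift_k[of k] by (simp add: in_A)
    finally show "emeasure (distr \<Lambda> seqs (window m)) (cylinder w) = emeasure Q (cylinder w)" .
  qed (use Q in auto)
  then show ?thesis using sets\<Lambda> \<Lambda>.prob_space_axioms by blast
qed

section \<open>The maximal ergodic inequality\<close>

text \<open>Garsia's argument. The set where one of the first \<open>n\<close> partial sums is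
  positive carries a nonnegative integral of \<open>h\<close>, and by \<open>pos\<close> these sets
  exhaust the space.\<close>

lemma (in prob_space) maximal_ergodic:
  fixes h :: "'a \<Rightarrow> real"
  assumes T [measurable]: "T \<in> measurable M M" and inv: "distr M M T = M"
    and h: "integrable M h"
    and pos: "AE x in M. \<exists>n. 0 < (\<Sum>k<n. h ((T ^^ k) x))"
  shows "0 \<le> (\<integral>x. h x \<partial>M)"
proof -
  \<comment> \<open>The recursion yields \<open>m n\<close>, the maximum of 0 and the first
    \<open>n\<close> partial sums; in this form the relation between \<open>m (Suc n)\<close> and
    \<open>m n\<close> composed with \<open>T\<close> is immediate.\<close>
  define m where "m = rec_nat (\<lambda>_. 0) (\<lambda>_ f x. max 0 (h x + f (T x)))"
  have m0: "m 0 x = 0" and mSuc: "m (Suc n) x = max 0 (h x + m n (T x))" for n x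
    by (simp_all add: m_def)
  have [measurable]: "h \<in> borel_measurable M" using h by auto
  have int_T: "integrable M (\<lambda>x. f (T x))" "(\<integral>x. f (T x) \<partial>M) = (\<integral>x. f x \<partial>M)"
    if f: "integrable M f" for f :: "'a \<Rightarrow> real"
  proof -
    have [measurable]: "f \<in> borel_measurable M" using f by auto
    show "integrable M (\<lambda>x. f (T x))"
      using f inv by (subst integrable_distr_eq[symmetric, where N = M]) auto
    show "(\<integral>x. f (T x) \<partial>M) = (\<integral>x. f x \<partial>M)"
      using inv by (subst integral_distr[symmetric, where N = M]) auto
  qed
  have int: "integrable M (m n)" for n
  proof (induction n)
    case (Suc n)
    have "m (Suc n) = (\<lambda>x. max 0 (h x + m n (T x)))" by (simp add: fun_eq_iff mSuc)
    then show ?case using h int_T(1)[OF Suc] by (simp add: integrable_max)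
  qed (simp add: m0[abs_def])
  have mono: "m n x \<le> m (Suc n) x" for n x
  proof (induction n arbitrary: x)
    case (Suc n)
    show ?case using Suc[of "T x"] unfolding mSuc[of "Suc n"] mSuc[of n] by auto
  qed (simp add: m0 mSuc)
  have S_le: "(\<Sum>k<n. h ((T ^^ k) x)) \<le> m N x" if "n \<le> N" for n N x
    using that
  proof (induction N arbitrary: n x)
    case (Suc N)
    show ?case
    proof (cases n)
      case (Suc n')
      have "(\<Sum>k<n. h ((T ^^ k) x)) = h x + (\<Sum>k<n'. h ((T ^^ k) (T x)))"
        unfolding Suc sum.lessThan_Suc_shift by (simp add: funpow_swap1)
      also have "\<dots> \<le> m (Suc N) x"
        unfolding mSuc using Suc.IH[of n' "T x"] Suc Suc.prems by (intro max.coboundedI2) simp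
      finally show ?thesis .
    qed (simp add: mSuc)
  qed (simp add: m0)
  let ?h = "\<lambda>n x. h x * indicator {x. 0 < m (Suc n) x} x"
  have [measurable]: "m n \<in> borel_measurable M" for n using int[of n] by auto
  have int_h: "integrable M (?h n)" for n
    by (rule Bochner_Integration.integrable_bound[OF h]) (auto simp: indicator_def)
  have "0 \<le> (\<integral>x. ?h n x \<partial>M)" for n
  proof -
    have "0 \<le> (\<integral>x. m (Suc n) x \<partial>M) - (\<integral>x. m n x \<partial>M)"
      using integral_mono[OF int int mono, of n] by simp
    also have "\<dots> = (\<integral>x. m (Suc n) x - m n (T x) \<partial>M)"
      using int int_T[OF int[of n]] by simp
    \<comment> \<open>Where \<open>m (Suc n)\<close> is positive the difference equals
      \<open>h\<close>; elsewhere it is \<open>- m n (T x)\<close>, which is at most 0.\<close>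
    also have "\<dots> \<le> (\<integral>x. ?h n x \<partial>M)"
    proof (rule integral_mono)
      have nonneg: "0 \<le> m n x" for x by (cases n) (auto simp: m0 mSuc)
      show "m (Suc n) x - m n (T x) \<le> ?h n x" for x
        using nonneg[of "T x"] by (auto simp: mSuc indicator_def max_def)
    qed (use int int_T[OF int[of n]] int_h in auto)
    finally show ?thesis .
  qed
  moreover have "(\<lambda>n. \<integral>x. ?h n x \<partial>M) \<longlonglongrightarrow> (\<integral>x. h x \<partial>M)"
  proof (rule integral_dominated_convergence[where w = "\<lambda>x. \<bar>h x\<bar>"])
    show "AE x in M. (\<lambda>n. ?h n x) \<longlonglongrightarrow> h x"
      using pos
    proof eventually_elim
      case (elim x)
      then obtain n where n: "0 < (\<Sum>k<n. h ((T ^^ k) x))" by auto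
      have "?h N x = h x" if "n \<le> N" for N
        using S_le[of n "Suc N" x] n that by (auto simp: indicator_def)
      then show ?case
        by (intro tendsto_eventually) (auto simp: eventually_sequentially)
    qed
    show "AE x in M. norm (?h n x) \<le> \<bar>h x\<bar>" for n
      by (auto simp: indicator_def)
  qed (use h in auto)
  ultimately show ?thesis
    by (intro LIMSEQ_le_const) auto
qed


section \<open>The skew product of the code shift\<close>

context markov
begin

lemma markov_op_eq:
  "markov_op M f x = (\<integral>\<^sup>+a. ennreal (prbbar M a x) * f (wbar M a x) \<partial>count_space UNIV)"
  unfolding markov_op_def infsum_ennreal_eq_nn_integral
  by (subst nn_integral_count_space_option) auto

lemma measurable_markov_op [measurable]:
  assumes [measurable]: "f \<in> borel_measurable borel"
  shows "markov_op M f \<in> borel_measurable borel"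
  unfolding markov_op_eq[abs_def]
proof (rule sigma_finite_measure.borel_measurable_nn_integral)
  have "(\<lambda>z. ennreal (prbbar M (snd z) (fst z)) * f (wbar M (snd z) (fst z)))
      \<in> borel_measurable (borel \<Otimes>\<^sub>M count_space UNIV)"
    by (rule measurable_compose_countable[where g = snd and
          f = "\<lambda>a z. ennreal (prbbar M a (fst z)) * f (wbar M a (fst z))"]) auto
  then show "(\<lambda>(x, a). ennreal (prbbar M a x) * f (wbar M a x))
      \<in> borel_measurable (borel \<Otimes>\<^sub>M count_space UNIV)"
    by (simp add: case_prod_unfold)
qed (simp add: sigma_finite_measure_count_space_countable)

lemma measurable_path_section:
  "f \<in> borel_measurable (borel \<Otimes>\<^sub>M seqs) \<Longrightarrow> (\<lambda>\<sigma>. f (x, \<sigma>)) \<in> borel_measurable seqs"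
  using measurable_compose[OF measurable_Pair1'[of x borel seqs], of f borel] by simp

lemma measurable_path_integral:
  assumes "f \<in> borel_measurable (borel \<Otimes>\<^sub>M seqs)"
  shows "(\<lambda>x. \<integral>\<^sup>+\<sigma>. f (x, \<sigma>) \<partial>P x) \<in> borel_measurable borel"
  by (rule nn_integral_measurable_subprob_algebra2[OF _ measurable_P_subprob]) (simp add: assms)

text \<open>The Markov property for functions of the first letter and the remaining path, the shape
  produced by composing with \<open>skew\<close>.\<close>

lemma nn_integral_P_skew:
  assumes f: "\<And>a. (\<lambda>\<sigma>. f a \<sigma>) \<in> borel_measurable seqs"
  shows "(\<integral>\<^sup>+\<sigma>. f (\<sigma> 0) (\<lambda>n. \<sigma> (Suc n)) \<partial>P x)
    = (\<integral>\<^sup>+a. ennreal (prbbar M a x) * (\<integral>\<^sup>+\<sigma>. f a \<sigma> \<partial>P (wbar M a x)) \<partial>count_space UNIV)"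
proof -
  have "(\<lambda>\<sigma>. f (\<sigma> 0) (\<lambda>n. \<sigma> (Suc n))) \<in> borel_measurable seqs"
    by (rule measurable_compose_countable[where f = "\<lambda>a \<sigma>. f a (\<lambda>n. \<sigma> (Suc n))"])
       (auto intro: measurable_compose[OF measurable_shift_seqs f])
  then show ?thesis by (subst nn_integral_P) auto
qed

definition skew :: "'a \<times> (nat \<Rightarrow> 'e option) \<Rightarrow> 'a \<times> (nat \<Rightarrow> 'e option)" where
  "skew z = (wbar M (snd z 0) (fst z), \<lambda>n. snd z (Suc n))"

lemma measurable_skew [measurable]:
  "skew \<in> measurable (borel \<Otimes>\<^sub>M seqs) (borel \<Otimes>\<^sub>M seqs)"
proof -
  have 1: "(\<lambda>z. snd z 0) \<in> measurable (borel \<Otimes>\<^sub>M seqs) (count_space (UNIV :: 'e option set))"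
    using measurable_compose[OF measurable_snd measurable_seqs_component] .
  have "(\<lambda>z. wbar M (snd z 0) (fst z)) \<in> borel_measurable (borel \<Otimes>\<^sub>M seqs)"
    by (rule measurable_compose_countable[where f = "\<lambda>a z. wbar M a (fst z)", OF _ 1]) simp
  moreover have "(\<lambda>z n. snd z (Suc n)) \<in> measurable (borel \<Otimes>\<^sub>M seqs) (seqs :: (nat \<Rightarrow> 'e option) measure)"
    using measurable_compose[OF measurable_snd measurable_shift_seqs] .
  ultimately show ?thesis
    unfolding skew_def[abs_def] by (rule measurable_Pair)
qed

definition path_law :: "'a measure \<Rightarrow> ('a \<times> (nat \<Rightarrow> 'e option)) measure" where
  "path_law \<mu> = Giry_Monad.bind \<mu> (\<lambda>x. distr (P x) (borel \<Otimes>\<^sub>M seqs) (Pair x))"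

lemma measurable_path_kernel:
  assumes [measurable_cong]: "sets \<mu> = sets borel"
  shows "(\<lambda>x. distr (P x) (borel \<Otimes>\<^sub>M seqs) (Pair x)) \<in> measurable \<mu> (subprob_algebra (borel \<Otimes>\<^sub>M seqs))"
  by (rule measurable_distr2[where M = seqs]) auto

lemma sets_path_law:
  assumes "sets \<mu> = sets borel"
  shows "sets (path_law \<mu>) = sets (borel \<Otimes>\<^sub>M seqs)"
  unfolding path_law_def using sets_eq_imp_space_eq[OF assms] by (intro sets_bind) auto

lemma nn_integral_path_law:
  assumes \<mu>: "sets \<mu> = sets borel" and f [measurable]: "f \<in> borel_measurable (borel \<Otimes>\<^sub>M seqs)"
  shows "(\<integral>\<^sup>+z. f z \<partial>path_law \<mu>) = (\<integral>\<^sup>+x. \<integral>\<^sup>+\<sigma>. f (x, \<sigma>) \<partial>P x \<partial>\<mu>)"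
  unfolding path_law_def
  by (subst nn_integral_bind[OF f measurable_path_kernel[OF \<mu>]]) (simp add: nn_integral_distr)

lemma nn_integral_invariant:
  assumes \<mu>: "\<mu> \<in> invariant_measures M" and [measurable]: "f \<in> borel_measurable borel"
  shows "(\<integral>\<^sup>+x. markov_op M f x \<partial>\<mu>) = (\<integral>\<^sup>+x. f x \<partial>\<mu>)"
  using \<mu> nn_integral_markov_dual[OF M, of \<mu> f] by (simp add: invariant_measures_def)

lemma prob_space_path_law:
  assumes "prob_space \<mu>" "sets \<mu> = sets borel"
  shows "prob_space (path_law \<mu>)"
  unfolding path_law_def
  using assms by (intro prob_space.prob_space_bind[OF _ _ measurable_path_kernel])
    (auto intro!: AE_I2 P.prob_space_distr)

text \<open>After integrating out the path, one skew step turns the function \<open>F\<close> of the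
  starting point into \<open>markov_op M F\<close>, and both have the same integral because \<mu> is
  invariant.\<close>

lemma distr_path_law_skew:
  assumes \<mu>: "\<mu> \<in> invariant_measures M"
  shows "distr (path_law \<mu>) (path_law \<mu>) skew = path_law \<mu>"
proof (rule measure_eqI)
  have sets [measurable_cong]: "sets \<mu> = sets borel" using \<mu> by (simp add: invariant_measures_def)
  note sets' [measurable_cong] = sets_path_law[OF sets]
  fix A assume "A \<in> sets (distr (path_law \<mu>) (path_law \<mu>) skew)"
  then have A [measurable]: "A \<in> sets (borel \<Otimes>\<^sub>M seqs)" by (simp add: sets')
  define I where "I z = (indicator A z :: ennreal)" for z
  have I: "I \<in> borel_measurable (borel \<Otimes>\<^sub>M seqs)"
    unfolding I_def using A by (rule borel_measurable_indicator)
  have I': "(\<lambda>z. I (skew z)) \<in> borel_measurable (borel \<Otimes>\<^sub>M seqs)"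
    using measurable_compose[OF measurable_skew I] .
  have skew: "skew \<in> measurable (path_law \<mu>) (path_law \<mu>)"
    unfolding measurable_cong_sets[OF sets' sets'] by (rule measurable_skew)
  define F where "F y = (\<integral>\<^sup>+\<sigma>. I (y, \<sigma>) \<partial>P y)" for y
  have F: "F \<in> borel_measurable borel"
    unfolding F_def by (rule measurable_path_integral[OF I])
  have "emeasure (distr (path_law \<mu>) (path_law \<mu>) skew) A = (\<integral>\<^sup>+z. I z \<partial>distr (path_law \<mu>) (path_law \<mu>) skew)"
    unfolding I_def by (rule nn_integral_indicator[symmetric]) (simp add: sets' A)
  also have "\<dots> = (\<integral>\<^sup>+z. I (skew z) \<partial>path_law \<mu>)"
    by (rule nn_integral_distr[OF skew]) (simp add: measurable_cong_sets[OF sets' refl] I)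
  also have "\<dots> = (\<integral>\<^sup>+x. \<integral>\<^sup>+\<sigma>. I (skew (x, \<sigma>)) \<partial>P x \<partial>\<mu>)"
    by (rule nn_integral_path_law[OF sets I'])
  also have "\<dots> = (\<integral>\<^sup>+x. markov_op M F x \<partial>\<mu>)"
    unfolding F_def skew_def markov_op_eq fst_conv snd_conv
    by (intro nn_integral_cong nn_integral_P_skew measurable_path_section I)
  also have "\<dots> = (\<integral>\<^sup>+x. F x \<partial>\<mu>)"
    using \<mu> F by (rule nn_integral_invariant)
  also have "\<dots> = (\<integral>\<^sup>+z. I z \<partial>path_law \<mu>)"
    unfolding F_def by (rule nn_integral_path_law[OF sets I, symmetric])
  also have "\<dots> = emeasure (path_law \<mu>) A"
    unfolding I_def by (intro nn_integral_indicator) (simp add: sets' A)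
  finally show "emeasure (distr (path_law \<mu>) (path_law \<mu>) skew) A = emeasure (path_law \<mu>) A" .
qed simp

lemma AE_path_law:
  assumes \<mu>: "sets \<mu> = sets borel" and B [measurable]: "B \<in> sets (borel \<Otimes>\<^sub>M seqs)"
  shows "(AE z in path_law \<mu>. z \<in> B) \<longleftrightarrow> (AE x in \<mu>. AE \<sigma> in P x. (x, \<sigma>) \<in> B)"
proof -
  define I where "I z = (indicator B z :: ennreal)" for z
  have I_meas: "I \<in> borel_measurable (borel \<Otimes>\<^sub>M seqs)"
    unfolding I_def using B by (rule borel_measurable_indicator)
  define J where "J z = 1 - I z" for z
  have J: "J \<in> borel_measurable (borel \<Otimes>\<^sub>M seqs)"
    unfolding J_def[abs_def] using I_meas by measurable
  have J_eq: "J z = 0 \<longleftrightarrow> z \<in> B" for z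
    by (auto simp: J_def I_def indicator_def)
  have "(AE z in path_law \<mu>. z \<in> B) \<longleftrightarrow> (\<integral>\<^sup>+z. J z \<partial>path_law \<mu>) = 0"
    using J by (simp add: nn_integral_0_iff_AE measurable_cong_sets[OF sets_path_law[OF \<mu>] refl] J_eq)
  also have "\<dots> \<longleftrightarrow> (AE x in \<mu>. (\<integral>\<^sup>+\<sigma>. J (x, \<sigma>) \<partial>P x) = 0)"
    using measurable_path_integral[OF J]
    by (simp add: nn_integral_path_law[OF \<mu> J] nn_integral_0_iff_AE measurable_cong_sets[OF \<mu> refl])
  also have "\<dots> \<longleftrightarrow> (AE x in \<mu>. AE \<sigma> in P x. (x, \<sigma>) \<in> B)"
    using measurable_path_section[OF J]
    by (simp add: nn_integral_0_iff_AE measurable_cong_sets[OF sets_P refl] J_eq)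
  finally show ?thesis .
qed

end

section \<open>Communication classes\<close>

lemma accessible_trans:
  assumes "accessible M j k" "accessible M k l"
  shows "accessible M j l"
proof (cases "j = k \<or> k = l")
  case False
  then obtain xs ys where xs: "edge_path M xs" "src M (hd xs) = j" "tgt M (last xs) = k"
    and ys: "edge_path M ys" "src M (hd ys) = k" "tgt M (last ys) = l"
    using assms by (auto simp: accessible_def)
  then have "edge_path M (xs @ ys)" "src M (hd (xs @ ys)) = j" "tgt M (last (xs @ ys)) = l"
    by (auto simp: edge_path_def successively_append_iff)
  then show ?thesis unfolding accessible_def by blast
qed (use assms in auto)

lemma accessible_edge: "accessible M (src M e) (tgt M e)"
  unfolding accessible_def by (intro disjI2 exI[of _ "[e]"]) (simp add: edge_path_def)

lemma accessible_induct:
  assumes "accessible M j k" "Z j" and step: "\<And>e. Z (src M e) \<Longrightarrow> Z (tgt M e)"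
  shows "Z k"
proof -
  have "Z (tgt M (last es))" if "edge_path M es" "Z (src M (hd es))" for es
    using that
  proof (induction es)
    case (Cons e es)
    then show ?case
      using step[of e] by (cases es) (auto simp: edge_path_def)
  qed (simp add: edge_path_def)
  then show ?thesis using assms by (auto simp: accessible_def)
qed

lemma essential_classE:
  assumes "c \<in> essential_classes M"
  obtains j where "essential M j" "c = {k. essential M k \<and> communicate M j k}" "j \<in> c"
proof -
  obtain j where "essential M j" "c = {k. essential M j \<and> essential M k \<and> communicate M j k}"
    using assms by (auto simp: essential_classes_def quotient_def)
  then show ?thesis
    by (intro that[of j]) (auto simp: communicate_def accessible_def)
qed

lemma essential_class_accessible:
  assumes "c \<in> essential_classes M" "j \<in> c" "k \<in> c"
  shows "accessible M j k"
  using assms by (elim essential_classE) (auto simp: communicate_def intro: accessible_trans)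

text \<open>Essentiality of a representative lets every vertex reached from the class return to it,
  and the same return paths make the new vertex essential.\<close>

lemma essential_class_closed:
  assumes c: "c \<in> essential_classes M" and j: "j \<in> c" and jk: "accessible M j k"
  shows "k \<in> c"
proof -
  obtain i where i: "essential M i" "c = {k. essential M k \<and> communicate M i k}"
    using c by (elim essential_classE)
  have ik: "accessible M i k"
    using i j jk by (auto simp: communicate_def intro: accessible_trans)
  then have com: "communicate M i k" using i by (auto simp: essential_def)
  have "communicate M k l" if kl: "accessible M k l" for l
  proof -
    have "communicate M i l" using i ik kl by (auto simp: essential_def intro: accessible_trans)
    then show ?thesis using kl ik by (auto simp: communicate_def intro: accessible_trans)
  qed
  then show ?thesis using i com by (auto simp: essential_def)
qed


section \<open>A zero-one law\<close>

text \<open>An event independent of all cylinders is independent of itself: the measures with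
  densities \<open>indicator A\<close> and the constant \<open>r\<close> agree on cylinders, hence
  on \<open>A\<close>. With \<open>r\<close> the probability of \<open>A\<close> this forces 0 or
  1.\<close>

lemma emeasure_eq_of_cylinders:
  fixes N :: "(nat \<Rightarrow> 'b::countable) measure"
  assumes fin: "finite_measure N" and N: "sets N = sets seqs" and A: "A \<in> sets seqs"
    and eq: "\<And>w. emeasure N (A \<inter> cylinder w) = r * emeasure N (cylinder w)"
  shows "emeasure N A = r * emeasure N A"
proof -
  have A': "A \<in> sets N" using A N by simp
  have cyl: "cylinder w \<in> sets N" for w using N by simp
  have "density N (indicator A) = density N (\<lambda>_. r)"
  proof (rule seqs_measure_eqI)
    interpret finite_measure N by fact
    show "finite_measure (density N (indicator A))"
    proof (rule finite_measureI)
      have "emeasure (density N (indicator A)) (space (density N (indicator A))) \<le> emeasure N (space N)"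
        using emeasure_restricted[OF A' sets.top] by (simp add: emeasure_mono)
      then show "emeasure (density N (indicator A)) (space (density N (indicator A))) \<noteq> \<infinity>"
        by (auto simp: top_unique)
    qed
    show "emeasure (density N (indicator A)) (cylinder w) = emeasure (density N (\<lambda>_. r)) (cylinder w)" for w
      by (simp only: emeasure_restricted[OF A' cyl] emeasure_density_const[OF cyl] eq)
  qed (simp_all add: N)
  then have "emeasure (density N (indicator A)) A = emeasure (density N (\<lambda>_. r)) A" by simp
  then show ?thesis
    by (simp only: emeasure_restricted[OF A' A'] emeasure_density_const[OF A'] Int_absorb)
qed

context markov
begin

lemma vert_tgt: "x \<in> vert M (src M e) \<Longrightarrow> wmap M e x \<in> vert M (tgt M e)"
  using M unfolding markov_system_def by blast

lemma prb_pos_vert: "0 < prb M e x \<Longrightarrow> x \<in> vert M (src M e)"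
  using M by (auto simp: markov_system_def)

lemma ex_prb_pos: "\<exists>x. 0 < prb M e x"
  using M by (simp add: markov_system_def)

lemma vert_unique: "x \<in> vert M j \<Longrightarrow> x \<in> vert M k \<Longrightarrow> j = k"
  using M by (auto simp: markov_system_def disjoint_family_on_def)

lemma ex_vert: "\<exists>j. x \<in> vert M j"
  using M by (auto simp: markov_system_def)

lemma vert_borel [measurable]: "vert M j \<in> sets borel"
  using M by (auto simp: markov_system_def)

lemma countable_vertices: "countable (UNIV :: 'v set)"
proof -
  have "surj (src M)" using M by (simp add: markov_system_def)
  then show ?thesis using countable_image[of "UNIV :: 'e set" "src M"] by simp
qed

lemma nn_integral_count_space_eq_0:
  fixes f :: "'b::countable \<Rightarrow> ennreal"
  shows "(\<integral>\<^sup>+a. f a \<partial>count_space UNIV) = 0 \<longleftrightarrow> (\<forall>a. f a = 0)"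
  by (subst nn_integral_0_iff_AE) (auto simp: AE_count_space)

lemma AE_P_Cons:
  assumes ae: "AE \<sigma> in P x. R \<sigma>" and pos: "0 < prbbar M a x"
  shows "AE \<sigma> in P (wbar M a x). R (case_nat a \<sigma>)"
proof -
  obtain N where N: "{\<sigma> \<in> space (P x). \<not> R \<sigma>} \<subseteq> N" "emeasure (P x) N = 0" "N \<in> sets (P x)"
    using ae by (elim AE_E)
  from N(3) have N_sets: "N \<in> sets seqs" by simp
  have "ennreal (prbbar M a x) * emeasure (P (wbar M a x)) (case_nat a -` N) = 0"
    using N(2) unfolding emeasure_P[OF N_sets] nn_integral_count_space_eq_0 by blast
  then have "emeasure (P (wbar M a x)) (case_nat a -` N) = 0"
    using pos by (simp add: ennreal_eq_0_iff)
  then show ?thesis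
    by (rule AE_I[rotated]) (use N N_sets in auto)
qed

text \<open>For a \<mu>-null set \<open>N\<close>, invariance gives the function
  \<open>markov_op M (indicator N)\<close> integral 0, so almost no point reaches \<open>N\<close>
  in one step of positive probability.\<close>

lemma AE_invariant_step:
  assumes \<mu>: "\<mu> \<in> invariant_measures M" and ae: "AE x in \<mu>. R x"
  shows "AE x in \<mu>. \<forall>a. 0 < prbbar M a x \<longrightarrow> R (wbar M a x)"
proof -
  have sets: "sets \<mu> = sets borel" and sp: "space \<mu> = UNIV"
    using \<mu> sets_eq_imp_space_eq[of \<mu> borel] by (auto simp: invariant_measures_def)
  obtain N where N: "{x \<in> space \<mu>. \<not> R x} \<subseteq> N" "emeasure \<mu> N = 0" "N \<in> sets \<mu>"
    using ae by (elim AE_E)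
  have ind: "indicator N \<in> borel_measurable borel"
    using N(3) unfolding sets by (rule borel_measurable_indicator)
  have "(\<integral>\<^sup>+x. markov_op M (indicator N) x \<partial>\<mu>) = (\<integral>\<^sup>+x. indicator N x \<partial>\<mu>)"
    using \<mu> ind by (rule nn_integral_invariant)
  also have "\<dots> = 0" using N by simp
  finally have "AE x in \<mu>. markov_op M (indicator N) x = 0"
    unfolding nn_integral_0_iff_AE[OF measurable_markov_op[OF ind, folded measurable_cong_sets[OF sets refl]]] .
  then show ?thesis
  proof eventually_elim
    case (elim x)
    show ?case
    proof (intro allI impI)
      fix a assume "0 < prbbar M a x"
      moreover have "ennreal (prbbar M a x) * indicator N (wbar M a x) = 0"
        using elim unfolding markov_op_eq nn_integral_count_space_eq_0 by blast
      ultimately have "wbar M a x \<notin> N" by (auto simp: indicator_def ennreal_eq_0_iff)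
      then show "R (wbar M a x)" using N(1) sp by auto
    qed
  qed
qed

definition section_prob :: "('a \<times> (nat \<Rightarrow> 'e option)) set \<Rightarrow> 'a \<Rightarrow> real" where
  "section_prob B x = measure (P x) {\<sigma>. (x, \<sigma>) \<in> B}"

lemma section_sets: "B \<in> sets (borel \<Otimes>\<^sub>M seqs) \<Longrightarrow> {\<sigma>. (x, \<sigma>) \<in> B} \<in> sets seqs"
  using sets_Pair1[of B borel seqs x] by (simp add: vimage_def)

lemma section_Cons:
  assumes "\<And>z. skew z \<in> B \<longleftrightarrow> z \<in> B"
  shows "case_nat a -` {\<sigma>. (x, \<sigma>) \<in> B} = {\<sigma>. (wbar M a x, \<sigma>) \<in> B}"
proof -
  have "(x, case_nat a \<sigma>) \<in> B \<longleftrightarrow> (wbar M a x, \<sigma>) \<in> B" for \<sigma>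
    using assms[of "(x, case_nat a \<sigma>)"] by (simp add: skew_def)
  then show ?thesis by auto
qed

lemma measurable_section_prob:
  assumes B: "B \<in> sets (borel \<Otimes>\<^sub>M seqs)"
  shows "(\<lambda>x. ennreal (section_prob B x)) \<in> borel_measurable borel"
proof -
  define I where "I z = (indicator B z :: ennreal)" for z
  have I: "I \<in> borel_measurable (borel \<Otimes>\<^sub>M seqs)"
    unfolding I_def using B by (rule borel_measurable_indicator)
  have "ennreal (section_prob B x) = (\<integral>\<^sup>+\<sigma>. I (x, \<sigma>) \<partial>P x)" for x
  proof -
    have "(\<lambda>\<sigma>. I (x, \<sigma>)) = indicator {\<sigma>. (x, \<sigma>) \<in> B}"
      by (auto simp: I_def indicator_def)
    then show ?thesis
      using section_sets[OF B, of x] by (simp add: section_prob_def P.emeasure_eq_measure)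
  qed
  then show ?thesis using measurable_path_integral[OF I] by simp
qed

lemma section_prob_harmonic:
  assumes B: "B \<in> sets (borel \<Otimes>\<^sub>M seqs)" and inv: "\<And>z. skew z \<in> B \<longleftrightarrow> z \<in> B"
  shows "(\<integral>\<^sup>+a. ennreal (prbbar M a x) * ennreal (section_prob B (wbar M a x)) \<partial>count_space UNIV)
    = ennreal (section_prob B x)"
  using emeasure_P[OF section_sets[OF B], of x] unfolding section_Cons[OF inv]
  by (simp add: section_prob_def P.emeasure_eq_measure)

lemma section_prob_nonneg [simp]: "0 \<le> section_prob B x"
  and section_prob_le_1 [simp]: "section_prob B x \<le> 1"
  by (simp_all add: section_prob_def)

text \<open>A bounded harmonic function is almost surely constant along the stationary process, because
  its increments are orthogonal and stationarity forces their second moment to vanish.\<close>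

lemma section_prob_step:
  assumes \<mu>: "\<mu> \<in> invariant_measures M"
    and B: "B \<in> sets (borel \<Otimes>\<^sub>M seqs)" and inv: "\<And>z. skew z \<in> B \<longleftrightarrow> z \<in> B"
  shows "AE x in \<mu>. \<forall>a. 0 < prbbar M a x \<longrightarrow> section_prob B (wbar M a x) = section_prob B x"
proof -
  have sets: "sets \<mu> = sets borel" and prob: "prob_space \<mu>"
    using \<mu> by (auto simp: invariant_measures_def)
  interpret prob_space \<mu> by fact
  define k where "k = section_prob B"
  have k: "0 \<le> k x" "k x \<le> 1" for x by (simp_all add: k_def)
  define k2 where "k2 x = ennreal (k x) * ennreal (k x)" for x
  have k2_eq: "k2 x = ennreal (k x * k x)" for x using k by (simp add: k2_def ennreal_mult)
  have k_meas: "(\<lambda>x. ennreal (k x)) \<in> borel_measurable borel"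
    unfolding k_def by (rule measurable_section_prob[OF B])
  then have k2_meas: "k2 \<in> borel_measurable borel" unfolding k2_def[abs_def] by measurable
  define D where "D x = (\<integral>\<^sup>+a. ennreal (prbbar M a x * (k (wbar M a x) - k x)\<^sup>2) \<partial>count_space UNIV)" for x
  \<comment> \<open>Harmonicity evaluates the cross term of the square and gives
    \<open>D = U k2 - k2\<close>, the expected squared increment; \<open>k2 x\<close> is added twice
    so that no subtraction occurs in \<open>ennreal\<close>.\<close>
  have id: "D x + (k2 x + k2 x) = markov_op M k2 x + k2 x" for x
  proof -
    have "D x + (k2 x + k2 x) = D x + ennreal (2 * k x) * ennreal (k x)"
      using k by (simp add: k2_eq ennreal_plus[symmetric] ennreal_mult[symmetric])
    also have "\<dots> = D x + ennreal (2 * k x) *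
        (\<integral>\<^sup>+a. ennreal (prbbar M a x) * ennreal (k (wbar M a x)) \<partial>count_space UNIV)"
      unfolding k_def section_prob_harmonic[OF B inv] ..
    also have "\<dots> = (\<integral>\<^sup>+a. ennreal (prbbar M a x * (k (wbar M a x) - k x)\<^sup>2)
        + ennreal (2 * k x) * (ennreal (prbbar M a x) * ennreal (k (wbar M a x))) \<partial>count_space UNIV)"
      unfolding D_def by (simp add: nn_integral_add nn_integral_cmult)
    also have "\<dots> = (\<integral>\<^sup>+a. ennreal (prbbar M a x) * k2 (wbar M a x) + ennreal (prbbar M a x) * k2 x
        \<partial>count_space UNIV)"
    proof (rule nn_integral_cong)
      fix a
      let ?p = "prbbar M a x" and ?k = "k (wbar M a x)"
      have "ennreal (?p * (?k - k x)\<^sup>2) + ennreal (2 * k x) * (ennreal ?p * ennreal ?k)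
          = ennreal (?p * (?k - k x)\<^sup>2 + 2 * k x * (?p * ?k))"
        using k by (simp add: ennreal_mult[symmetric])
      also have "?p * (?k - k x)\<^sup>2 + 2 * k x * (?p * ?k) = ?p * (?k * ?k) + ?p * (k x * k x)"
        by (simp add: power2_eq_square algebra_simps)
      also have "ennreal \<dots> = ennreal ?p * k2 (wbar M a x) + ennreal ?p * k2 x"
        using k by (simp add: k2_eq ennreal_mult[symmetric])
      finally show "ennreal (?p * (?k - k x)\<^sup>2) + ennreal (2 * k x) * (ennreal ?p * ennreal ?k)
          = ennreal ?p * k2 (wbar M a x) + ennreal ?p * k2 x" .
    qed
    also have "\<dots> = markov_op M k2 x + k2 x"
      by (simp add: nn_integral_add nn_integral_multc nn_integral_prbbar markov_op_eq)
    finally show ?thesis .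
  qed
  have fin: "k2 x \<le> 1" for x
    unfolding k2_eq using k[of x] by (simp add: mult_le_one)
  have D_eq: "D = (\<lambda>x. (markov_op M k2 x + k2 x) - (k2 x + k2 x))"
  proof
    fix x
    have "k2 x + k2 x \<noteq> \<top>" using fin[of x] by (auto simp: top_unique)
    then show "D x = (markov_op M k2 x + k2 x) - (k2 x + k2 x)"
      unfolding id[symmetric] by (rule ennreal_add_diff_cancel_right[symmetric])
  qed
  have D_meas: "D \<in> borel_measurable borel"
    unfolding D_eq
    by (intro borel_measurable_add measurable_markov_op k2_meas borel_measurable_minus_ennreal)
  note meas = D_meas k2_meas measurable_markov_op[OF k2_meas]
  have meas': "D \<in> borel_measurable \<mu>" "k2 \<in> borel_measurable \<mu>" "markov_op M k2 \<in> borel_measurable \<mu>"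
    using meas by (simp_all only: measurable_cong_sets[OF sets refl])
  let ?I = "\<integral>\<^sup>+x. k2 x \<partial>\<mu>"
  have "(\<integral>\<^sup>+x. D x + (k2 x + k2 x) \<partial>\<mu>) = (\<integral>\<^sup>+x. markov_op M k2 x + k2 x \<partial>\<mu>)"
    by (simp add: id)
  then have "(\<integral>\<^sup>+x. D x \<partial>\<mu>) + (?I + ?I) = ?I + ?I"
    using meas' nn_integral_invariant[OF \<mu> k2_meas] by (simp add: nn_integral_add)
  moreover have "?I \<le> (\<integral>\<^sup>+x. 1 \<partial>\<mu>)" by (intro nn_integral_mono fin)
  then have "?I + ?I \<noteq> \<top>" by (auto simp: emeasure_space_1 top_unique)
  ultimately have "(\<integral>\<^sup>+x. D x \<partial>\<mu>) = 0"
    using ennreal_add_left_cancel[of "?I + ?I" "\<integral>\<^sup>+x. D x \<partial>\<mu>" 0] by (simp add: add.commute)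
  then have "AE x in \<mu>. D x = 0"
    using meas'(1) by (simp only: nn_integral_0_iff_AE)
  then show ?thesis
  proof eventually_elim
    case (elim x)
    show ?case
    proof (intro allI impI)
      fix a assume "0 < prbbar M a x"
      moreover have "ennreal (prbbar M a x * (k (wbar M a x) - k x)\<^sup>2) = 0"
        using elim unfolding D_def nn_integral_count_space_eq_0 by blast
      ultimately show "section_prob B (wbar M a x) = section_prob B x"
        by (simp add: ennreal_eq_0_iff mult_le_0_iff k_def)
    qed
  qed
qed

text \<open>Since the section probability does not change along steps of positive weight,
  conditioning on a finite word leaves it unchanged; the section is then independent of all
  cylinders and so of itself.\<close>

lemma zero_one_AE:
  assumes \<mu>: "\<mu> \<in> invariant_measures M"
    and B: "B \<in> sets (borel \<Otimes>\<^sub>M seqs)" and inv: "\<And>z. skew z \<in> B \<longleftrightarrow> z \<in> B"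
  shows "AE x in \<mu>. section_prob B x = 0 \<or> section_prob B x = 1"
proof -
  let ?B = "\<lambda>x. {\<sigma>. (x, \<sigma>) \<in> B}"
  have "AE x in \<mu>. emeasure (P x) (?B x \<inter> cylinder w) = ennreal (cyl_prob M w x) * ennreal (section_prob B x)" for w
  proof (induction w)
    case Nil
    then show ?case by (simp add: section_prob_def P.emeasure_eq_measure)
  next
    case (Cons a w)
    \<comment> \<open>The induction hypothesis is needed at \<open>wbar M a x\<close>: invariance of
      \<mu> carries it there for every letter of positive weight, and \<open>section_prob\<close>
      has the same value at both points.\<close>
    show ?case
      using AE_invariant_step[OF \<mu> Cons] section_prob_step[OF \<mu> B inv]
    proof eventually_elim
      case (elim x)
      have vim: "case_nat b -` (?B x \<inter> cylinder (a # w)) = (if b = a then ?B (wbar M a x) \<inter> cylinder w else {})" for b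
      proof -
        have "case_nat b -` cylinder (a # w) = (if b = a then cylinder w else {})"
          by (auto simp: cylinder_def nth_Cons split: nat.splits)
        then show ?thesis using section_Cons[OF inv, of b x] by auto
      qed
      have A: "?B x \<inter> cylinder (a # w) \<in> sets seqs"
        by (intro sets.Int section_sets B cylinder_in_sets)
      have "emeasure (P x) (?B x \<inter> cylinder (a # w))
          = (\<integral>\<^sup>+b. (if b = a then ennreal (prbbar M b x) * emeasure (P (wbar M b x)) (?B (wbar M b x) \<inter> cylinder w) else 0)
              \<partial>count_space UNIV)"
        unfolding emeasure_P[OF A] vim by (intro nn_integral_cong) auto
      also have "\<dots> = ennreal (prbbar M a x) * emeasure (P (wbar M a x)) (?B (wbar M a x) \<inter> cylinder w)"
        by (simp add: nn_integral_pos_eq_point)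
      also have "\<dots> = ennreal (cyl_prob M (a # w) x) * ennreal (section_prob B x)"
        using elim by (cases "prbbar M a x = 0") (auto simp: less_le ennreal_mult mult.assoc)
      finally show ?case .
    qed
  qed
  then have "AE x in \<mu>. \<forall>w. emeasure (P x) (?B x \<inter> cylinder w) = ennreal (cyl_prob M w x) * ennreal (section_prob B x)"
    by (subst AE_all_countable) auto
  then show ?thesis
  proof eventually_elim
    case (elim x)
    have Bx: "?B x \<in> sets seqs" by (rule section_sets[OF B])
    have "emeasure (P x) (?B x) = ennreal (section_prob B x) * emeasure (P x) (?B x)"
      using Bx elim by (intro emeasure_eq_of_cylinders P.finite_measure_axioms sets_P)
        (simp_all only: emeasure_P_cylinder mult.commute)
    then have "section_prob B x = section_prob B x * section_prob B x"
      by (simp add: ennreal_mult[symmetric] section_prob_def P.emeasure_eq_measure)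
    then show ?case by auto
  qed
qed

text \<open>Inside a vertex set, \<open>P y\<close> is absolutely continuous with respect to
  \<open>P x\<close>, and \<open>insens\<close> exchanges the starting point in the event itself.
  Across an edge, conditioning on that letter and invariance of \<open>B\<close> carry the property
  from a source point to its image.\<close>

lemma AE_class_propagate:
  assumes acc: "absolute_continuity_condition M"
    and B: "B \<in> sets (borel \<Otimes>\<^sub>M seqs)" and inv: "\<And>z. skew z \<in> B \<longleftrightarrow> z \<in> B"
    and insens: "\<And>j x y. x \<in> vert M j \<Longrightarrow> y \<in> vert M j \<Longrightarrow> AE \<sigma> in P x. (x, \<sigma>) \<in> B \<longleftrightarrow> (y, \<sigma>) \<in> B"
    and c: "c \<in> essential_classes M"
    and x: "x \<in> class_union M c" and ae: "AE \<sigma> in P x. (x, \<sigma>) \<in> B"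
    and y: "y \<in> class_union M c"
  shows "AE \<sigma> in P y. (y, \<sigma>) \<in> B"
proof -
  have vertex: "AE \<sigma> in P y. (y, \<sigma>) \<in> B"
    if xy: "x \<in> vert M j" "y \<in> vert M j" and "AE \<sigma> in P x. (x, \<sigma>) \<in> B" for x y j
  proof -
    have "absolutely_continuous (P x) (P y)"
      using acc xy by (auto simp: absolute_continuity_condition_def)
    then have "AE \<sigma> in P y. (x, \<sigma>) \<in> B"
      using that(3) by (rule absolutely_continuous_AE[rotated 1]) simp
    with insens[OF xy(2,1)] show ?thesis by eventually_elim simp
  qed
  obtain j k where j: "j \<in> c" "x \<in> vert M j" and k: "k \<in> c" "y \<in> vert M k"
    using x y by (auto simp: class_union_def)
  define Z where "Z i \<longleftrightarrow> (\<forall>x\<in>vert M i. AE \<sigma> in P x. (x, \<sigma>) \<in> B)" for i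
  have "Z k"
  proof (rule accessible_induct[where Z = Z and M = M and j = j])
    show "accessible M j k" using c j k by (intro essential_class_accessible)
    show "Z j" unfolding Z_def using vertex[OF j(2) _ ae] by blast
    fix e assume Ze: "Z (src M e)"
    \<comment> \<open>A single point giving the edge positive weight is enough, since the property
      at its image spreads over the whole target vertex set.\<close>
    obtain u where u: "0 < prb M e u" using ex_prb_pos ..
    then have u_v: "u \<in> vert M (src M e)" by (rule prb_pos_vert)
    have "AE \<sigma> in P u. (u, \<sigma>) \<in> B" using Ze u_v by (simp add: Z_def)
    then have "AE \<sigma> in P (wbar M (Some e) u). (u, case_nat (Some e) \<sigma>) \<in> B"
      using u by (intro AE_P_Cons) simp_all
    then have "AE \<sigma> in P (wmap M e u). (u, case_nat (Some e) \<sigma>) \<in> B"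
      by (simp only: wbar.simps)
    moreover have "(u, case_nat (Some e) \<sigma>) \<in> B \<longleftrightarrow> (wmap M e u, \<sigma>) \<in> B" for \<sigma>
      using inv[of "(u, case_nat (Some e) \<sigma>)"] by (simp add: skew_def)
    ultimately have "AE \<sigma> in P (wmap M e u). (wmap M e u, \<sigma>) \<in> B" by simp
    then show "Z (tgt M e)"
      unfolding Z_def using vertex[OF vert_tgt[OF u_v]] by blast
  qed
  then show ?thesis using k by (simp add: Z_def)
qed

lemma AE_in_iff_section_prob:
  assumes B: "B \<in> sets (borel \<Otimes>\<^sub>M seqs)"
  shows "(AE \<sigma> in P x. (x, \<sigma>) \<in> B) \<longleftrightarrow> section_prob B x = 1"
    and "(AE \<sigma> in P x. (x, \<sigma>) \<notin> B) \<longleftrightarrow> section_prob B x = 0"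
proof -
  have Bx: "{\<sigma>. (x, \<sigma>) \<in> B} \<in> P.events x" using section_sets[OF B] by simp
  show "(AE \<sigma> in P x. (x, \<sigma>) \<in> B) \<longleftrightarrow> section_prob B x = 1"
    using P.AE_in_set_eq_1[OF Bx] by (simp add: section_prob_def)
  show "(AE \<sigma> in P x. (x, \<sigma>) \<notin> B) \<longleftrightarrow> section_prob B x = 0"
    using P.prob_eq_0[OF Bx] by (simp add: section_prob_def)
qed

text \<open>One \<mu>-typical point of the class decides between the two cases; the complement of
  \<open>B\<close> is invariant and insensitive as well, so both cases propagate in the same
  way.\<close>

lemma zero_one_class:
  assumes acc: "absolute_continuity_condition M"
    and \<mu>: "\<mu> \<in> invariant_measures M"
    and c: "c \<in> essential_classes M" and \<mu>c: "AE x in \<mu>. x \<in> class_union M c"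
    and B: "B \<in> sets (borel \<Otimes>\<^sub>M seqs)" and inv: "\<And>z. skew z \<in> B \<longleftrightarrow> z \<in> B"
    and insens: "\<And>j x y. x \<in> vert M j \<Longrightarrow> y \<in> vert M j \<Longrightarrow> AE \<sigma> in P x. (x, \<sigma>) \<in> B \<longleftrightarrow> (y, \<sigma>) \<in> B"
  shows "(\<forall>x\<in>class_union M c. AE \<sigma> in P x. (x, \<sigma>) \<in> B)
    \<or> (\<forall>x\<in>class_union M c. AE \<sigma> in P x. (x, \<sigma>) \<notin> B)"
proof -
  interpret prob_space \<mu> using \<mu> by (auto simp: invariant_measures_def)
  have "\<exists>x. x \<in> class_union M c \<and> (section_prob B x = 0 \<or> section_prob B x = 1)"
  proof (rule ccontr)
    assume none: "\<nexists>x. x \<in> class_union M c \<and> (section_prob B x = 0 \<or> section_prob B x = 1)"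
    have "AE x in \<mu>. False"
      using zero_one_AE[OF \<mu> B inv] \<mu>c by eventually_elim (use none in blast)
    then show False by simp
  qed
  then obtain x where x: "x \<in> class_union M c" "section_prob B x = 0 \<or> section_prob B x = 1"
    by blast
  from x(2) show ?thesis
  proof
    assume "section_prob B x = 1"
    then have ae: "AE \<sigma> in P x. (x, \<sigma>) \<in> B" using AE_in_iff_section_prob(1)[OF B] by simp
    have "AE \<sigma> in P y. (y, \<sigma>) \<in> B" if "y \<in> class_union M c" for y
    proof (rule AE_class_propagate[where x = x, OF acc B _ _ c x(1)])
      show "AE \<sigma> in P x. (x, \<sigma>) \<in> B \<longleftrightarrow> (y, \<sigma>) \<in> B" if "x \<in> vert M j" "y \<in> vert M j" for j x y
        using that by (rule insens)
    qed (fact that inv ae)+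
    then show ?thesis by blast
  next
    have B': "- B \<in> sets (borel \<Otimes>\<^sub>M seqs)"
      using sets.compl_sets[OF B] by (simp add: space_pair_measure Compl_eq_Diff_UNIV)
    assume "section_prob B x = 0"
    then have ae: "AE \<sigma> in P x. (x, \<sigma>) \<in> - B" using AE_in_iff_section_prob(2)[OF B] by simp
    have "AE \<sigma> in P y. (y, \<sigma>) \<in> - B" if "y \<in> class_union M c" for y
    proof (rule AE_class_propagate[where x = x, OF acc B' _ _ c x(1)])
      show "skew z \<in> - B \<longleftrightarrow> z \<in> - B" for z using inv[of z] by simp
      show "AE \<sigma> in P x. (x, \<sigma>) \<in> - B \<longleftrightarrow> (y, \<sigma>) \<in> - B" if "x \<in> vert M j" "y \<in> vert M j" for j x y
        using insens[OF that] by simp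
    qed (fact that ae)+
    then show ?thesis by simp
  qed
qed

end

section \<open>Birkhoff averages along a communication class\<close>

context markov
begin

text \<open>Written through the finite prefix, so that functions of finitely many orbit points
  factor through a countable set of words. This gives measurability in \<sigma> of distances between
  orbits although the metric of a nonseparable \<open>K\<close> need not be measurable for the
  product of the Borel \<sigma>-algebras.\<close>

definition orb :: "(nat \<Rightarrow> 'e option) \<Rightarrow> nat \<Rightarrow> 'a \<Rightarrow> 'a" where
  "orb \<sigma> n x = fold (wbar M) (map \<sigma> [0..<n]) x"

lemma orb_0 [simp]: "orb \<sigma> 0 x = x"
  by (simp add: orb_def)

lemma orb_Suc: "orb \<sigma> (Suc n) x = wbar M (\<sigma> n) (orb \<sigma> n x)"
  by (simp add: orb_def)

lemma orb_case_nat: "orb (case_nat a \<sigma>) (Suc n) x = orb \<sigma> n (wbar M a x)"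
  by (induction n) (simp_all add: orb_Suc)

lemma skew_funpow: "(skew ^^ n) (x, \<sigma>) = (orb \<sigma> n x, \<lambda>k. \<sigma> (k + n))"
  by (induction n) (simp_all add: skew_def orb_Suc)

lemma measurable_prefix:
  fixes h :: "'e option list \<Rightarrow> 'b::topological_space"
  shows "(\<lambda>\<sigma>. h (map \<sigma> [0..<n])) \<in> borel_measurable seqs"
  by (rule measurable_compose[OF measurable_map_seqs]) (simp only: measurable_count_space_eq1 space_borel, simp)

lemma borel_measurable_dist_orb [measurable]:
  "(\<lambda>\<sigma>. dist (orb \<sigma> n x) (orb \<sigma> n y)) \<in> borel_measurable seqs"
  unfolding orb_def by (rule measurable_prefix)

definition birkhoff :: "('a \<times> (nat \<Rightarrow> 'e option) \<Rightarrow> real) \<Rightarrow> nat \<Rightarrow> 'a \<times> (nat \<Rightarrow> 'e option) \<Rightarrow> real" where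
  "birkhoff g n z = (\<Sum>k<n. g ((skew ^^ k) z))"

lemma birkhoff_Suc: "birkhoff g (Suc n) z = g z + birkhoff g n (skew z)"
  unfolding birkhoff_def sum.lessThan_Suc_shift by (simp add: funpow_swap1)

lemma birkhoff_uminus: "birkhoff (\<lambda>z. - g z) n z = - birkhoff g n z"
  by (simp add: birkhoff_def sum_negf)

lemma measurable_skew_funpow: "skew ^^ n \<in> measurable (borel \<Otimes>\<^sub>M seqs) (borel \<Otimes>\<^sub>M seqs)"
proof (induction n)
  case (Suc n)
  have "skew ^^ Suc n = (\<lambda>z. skew ((skew ^^ n) z))" by (simp add: fun_eq_iff)
  then show ?case using measurable_compose[OF Suc measurable_skew] by simp
qed (simp add: measurable_ident id_def[symmetric])

lemma measurable_birkhoff: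
  assumes "g \<in> borel_measurable (borel \<Otimes>\<^sub>M seqs)"
  shows "birkhoff g n \<in> borel_measurable (borel \<Otimes>\<^sub>M seqs)"
  unfolding birkhoff_def[abs_def]
  by (intro borel_measurable_sum measurable_compose[OF measurable_skew_funpow assms])

text \<open>If the sums of \<open>g - \<alpha>\<close> were unbounded above for all starting points
  of the class, the maximal inequality would make the integral of \<open>g - \<alpha>\<close>
  nonnegative. The zero-one law leaves boundedness almost surely, from every point.\<close>

lemma birkhoff_upper:
  assumes acc: "absolute_continuity_condition M"
    and \<mu>: "\<mu> \<in> invariant_measures M"
    and c: "c \<in> essential_classes M" and \<mu>c: "AE x in \<mu>. x \<in> class_union M c"
    and g: "g \<in> borel_measurable (borel \<Otimes>\<^sub>M seqs)" and int: "integrable (path_law \<mu>) g"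
    and bdd: "\<And>j x y. x \<in> vert M j \<Longrightarrow> y \<in> vert M j \<Longrightarrow>
        AE \<sigma> in P x. \<exists>K. \<forall>n. \<bar>birkhoff g n (x, \<sigma>) - birkhoff g n (y, \<sigma>)\<bar> \<le> K"
    and \<alpha>: "(\<integral>z. g z \<partial>path_law \<mu>) < \<alpha>"
    and x: "x \<in> class_union M c"
  shows "AE \<sigma> in P x. \<exists>K. \<forall>n. birkhoff g n (x, \<sigma>) \<le> K + real n * \<alpha>"
proof -
  have sets: "sets \<mu> = sets borel" and prob: "prob_space \<mu>"
    using \<mu> by (auto simp: invariant_measures_def)
  \<comment> \<open>Unboundedness is unaffected by removing the first summand and by any bounded
    change of the sums, which gives exact invariance and insensitivity; it also contains some
    positive partial sum.\<close>
  define B where "B = {z. \<forall>K::nat. \<exists>n. real K < birkhoff g n z - real n * \<alpha>}"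
  have B: "B \<in> sets (borel \<Otimes>\<^sub>M seqs)"
  proof -
    note [measurable] = measurable_birkhoff[OF g]
    have "{z \<in> space (borel \<Otimes>\<^sub>M seqs). \<forall>K::nat. \<exists>n. real K < birkhoff g n z - real n * \<alpha>}
        \<in> sets (borel \<Otimes>\<^sub>M seqs)"
      by measurable
    then show ?thesis by (simp add: B_def space_pair_measure)
  qed
  have inv: "skew z \<in> B \<longleftrightarrow> z \<in> B" for z
  proof
    assume skew_B: "skew z \<in> B"
    show "z \<in> B"
      unfolding B_def
    proof safe
      fix K :: nat
      obtain K' :: nat where "real K + \<bar>g z - \<alpha>\<bar> \<le> real K'" using real_arch_simple by blast
      moreover obtain n where "real K' < birkhoff g n (skew z) - real n * \<alpha>"
        using skew_B by (auto simp: B_def)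
      ultimately have "real K < birkhoff g (Suc n) z - real (Suc n) * \<alpha>"
        by (simp add: birkhoff_Suc algebra_simps)
      then show "\<exists>n. real K < birkhoff g n z - real n * \<alpha>" ..
    qed
  next
    assume z_B: "z \<in> B"
    show "skew z \<in> B"
      unfolding B_def
    proof safe
      fix K :: nat
      obtain K' :: nat where K': "real K + \<bar>g z - \<alpha>\<bar> \<le> real K'" using real_arch_simple by blast
      obtain n where n: "real K' < birkhoff g n z - real n * \<alpha>"
        using z_B by (auto simp: B_def)
      \<comment> \<open>The index is not 0, because the empty sum does not exceed
        \<open>real K'\<close>.\<close>
      then obtain m where "n = Suc m" by (cases n) (auto simp: birkhoff_def)
      with n K' have "real K < birkhoff g m (skew z) - real m * \<alpha>"
        by (simp add: birkhoff_Suc algebra_simps)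
      then show "\<exists>n. real K < birkhoff g n (skew z) - real n * \<alpha>" ..
    qed
  qed
  have mem_B: "(y, \<sigma>) \<in> B"
    if xB: "(x, \<sigma>) \<in> B" and K: "\<forall>n. \<bar>birkhoff g n (x, \<sigma>) - birkhoff g n (y, \<sigma>)\<bar> \<le> K" for x y \<sigma> K
    unfolding B_def
  proof safe
    fix N :: nat
    obtain N' :: nat where N': "real N + K \<le> real N'" using real_arch_simple by blast
    obtain n where n: "real N' < birkhoff g n (x, \<sigma>) - real n * \<alpha>"
      using xB by (auto simp: B_def)
    have "real N < birkhoff g n (y, \<sigma>) - real n * \<alpha>"
      using N' n K[rule_format, of n] by linarith
    then show "\<exists>n. real N < birkhoff g n (y, \<sigma>) - real n * \<alpha>" ..
  qed
  have insens: "AE \<sigma> in P x. (x, \<sigma>) \<in> B \<longleftrightarrow> (y, \<sigma>) \<in> B" if "x \<in> vert M j" "y \<in> vert M j" for j x y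
    using bdd[OF that]
  proof eventually_elim
    case (elim \<sigma>)
    then obtain K where K: "\<forall>n. \<bar>birkhoff g n (x, \<sigma>) - birkhoff g n (y, \<sigma>)\<bar> \<le> K" ..
    then have "\<forall>n. \<bar>birkhoff g n (y, \<sigma>) - birkhoff g n (x, \<sigma>)\<bar> \<le> K"
      by (simp add: abs_minus_commute)
    with K show ?case using mem_B by blast
  qed
  have "\<not> (\<forall>x\<in>class_union M c. AE \<sigma> in P x. (x, \<sigma>) \<in> B)"
  proof
    assume "\<forall>x\<in>class_union M c. AE \<sigma> in P x. (x, \<sigma>) \<in> B"
    then have "AE x in \<mu>. AE \<sigma> in P x. (x, \<sigma>) \<in> B"
      using \<mu>c by (auto elim: eventually_mono)
    then have ae: "AE z in path_law \<mu>. z \<in> B"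
      using AE_path_law[OF sets B] by simp
    interpret L: prob_space "path_law \<mu>" using prob sets by (rule prob_space_path_law)
    have "0 \<le> (\<integral>z. g z - \<alpha> \<partial>path_law \<mu>)"
    proof (rule L.maximal_ergodic)
      show "skew \<in> measurable (path_law \<mu>) (path_law \<mu>)"
        using measurable_skew by (simp only: measurable_cong_sets[OF sets_path_law[OF sets] sets_path_law[OF sets]])
      show "distr (path_law \<mu>) (path_law \<mu>) skew = path_law \<mu>"
        by (rule distr_path_law_skew[OF \<mu>])
      show "integrable (path_law \<mu>) (\<lambda>z. g z - \<alpha>)" using int by simp
      show "AE z in path_law \<mu>. \<exists>n. 0 < (\<Sum>k<n. g ((skew ^^ k) z) - \<alpha>)"
        using ae
      proof eventually_elim
        case (elim z)
        then obtain n where "real 0 < birkhoff g n z - real n * \<alpha>" unfolding B_def by blast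
        then show ?case by (intro exI[of _ n]) (simp add: birkhoff_def sum_subtractf)
      qed
    qed
    then show False using int \<alpha> by (simp add: L.prob_space)
  qed
  then have "AE \<sigma> in P x. (x, \<sigma>) \<notin> B"
    using zero_one_class[OF acc \<mu> c \<mu>c B inv] insens x by blast
  then show ?thesis
  proof eventually_elim
    case (elim \<sigma>)
    then obtain K :: nat where "\<forall>n. \<not> real K < birkhoff g n (x, \<sigma>) - real n * \<alpha>"
      by (auto simp: B_def)
    then show ?case by (intro exI[of _ "real K"]) (auto simp: not_less algebra_simps)
  qed
qed

text \<open>The one-sided bound is applied to \<open>g\<close> and to \<open>- g\<close> at distance
  \<open>1 / Suc m\<close> from the integral; countably many levels keep the exceptional set
  null.\<close>

lemma birkhoff_class:
  assumes acc: "absolute_continuity_condition M"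
    and \<mu>: "\<mu> \<in> invariant_measures M"
    and c: "c \<in> essential_classes M" and \<mu>c: "AE x in \<mu>. x \<in> class_union M c"
    and g: "g \<in> borel_measurable (borel \<Otimes>\<^sub>M seqs)" and int: "integrable (path_law \<mu>) g"
    and bdd: "\<And>j x y. x \<in> vert M j \<Longrightarrow> y \<in> vert M j \<Longrightarrow>
        AE \<sigma> in P x. \<exists>K. \<forall>n. \<bar>birkhoff g n (x, \<sigma>) - birkhoff g n (y, \<sigma>)\<bar> \<le> K"
    and x: "x \<in> class_union M c"
  shows "AE \<sigma> in P x. (\<lambda>n. 1 / real n * birkhoff g n (x, \<sigma>)) \<longlonglongrightarrow> (\<integral>z. g z \<partial>path_law \<mu>)"
proof -
  let ?I = "\<integral>z. g z \<partial>path_law \<mu>"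
  have up: "AE \<sigma> in P x. \<forall>m. \<exists>K. \<forall>n. birkhoff g n (x, \<sigma>) \<le> K + real n * (?I + 1 / real (Suc m))"
    unfolding AE_all_countable
  proof
    fix m
    show "AE \<sigma> in P x. \<exists>K. \<forall>n. birkhoff g n (x, \<sigma>) \<le> K + real n * (?I + 1 / real (Suc m))"
      by (rule birkhoff_upper[OF acc \<mu> c \<mu>c g int _ _ x]) (use bdd in auto)
  qed
  have lo: "AE \<sigma> in P x. \<forall>m. \<exists>K. \<forall>n. birkhoff (\<lambda>z. - g z) n (x, \<sigma>) \<le> K + real n * (- ?I + 1 / real (Suc m))"
    unfolding AE_all_countable
  proof
    fix m
    have bdd': "AE \<sigma> in P x. \<exists>K. \<forall>n. \<bar>birkhoff (\<lambda>z. - g z) n (x, \<sigma>) - birkhoff (\<lambda>z. - g z) n (y, \<sigma>)\<bar> \<le> K"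
      if "x \<in> vert M j" "y \<in> vert M j" for j x y
    proof -
      have "\<bar>- a - - b\<bar> = \<bar>a - b\<bar>" for a b :: real by linarith
      then show ?thesis using bdd[OF that] by (simp only: birkhoff_uminus)
    qed
    show "AE \<sigma> in P x. \<exists>K. \<forall>n. birkhoff (\<lambda>z. - g z) n (x, \<sigma>) \<le> K + real n * (- ?I + 1 / real (Suc m))"
      by (rule birkhoff_upper[OF acc \<mu> c \<mu>c _ _ _ _ x]) (use bdd' g int in auto)
  qed
  from up lo show ?thesis
  proof eventually_elim
    case (elim \<sigma>)
    have tail: "eventually (\<lambda>n. f n / real n < \<beta> + \<epsilon>) sequentially"
      if "\<forall>m. \<exists>K. \<forall>n. f n \<le> K + real n * (\<beta> + 1 / real (Suc m))" and \<epsilon>: "0 < \<epsilon>"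
      for f :: "nat \<Rightarrow> real" and \<beta> \<epsilon>
    proof -
      obtain m where m: "1 / real (Suc m) < \<epsilon>" using nat_approx_posE[OF \<epsilon>] by (auto simp: inverse_eq_divide)
      have "\<exists>K. \<forall>n. f n \<le> K + real n * (\<beta> + 1 / real (Suc m))" using that(1) by (rule spec)
      then obtain K where K: "\<forall>n. f n \<le> K + real n * (\<beta> + 1 / real (Suc m))" ..
      have "(\<lambda>n. K / real n) \<longlonglongrightarrow> 0" by (rule lim_const_over_n)
      then have "eventually (\<lambda>n. K / real n < \<epsilon> - 1 / real (Suc m)) sequentially"
        using m by (intro order_tendstoD) auto
      with eventually_gt_at_top[of 0] show ?thesis
      proof eventually_elim
        case (elim n)
        have "f n / real n \<le> (K + real n * (\<beta> + 1 / real (Suc m))) / real n"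
          using K elim by (intro divide_right_mono) auto
        also have "\<dots> = K / real n + (\<beta> + 1 / real (Suc m))"
          using elim by (simp add: add_divide_distrib)
        finally show ?case using elim by linarith
      qed
    qed
    show ?case
    proof (rule LIMSEQ_I, goal_cases)
      case (1 \<epsilon>)
      have "eventually (\<lambda>n. norm (1 / real n * birkhoff g n (x, \<sigma>) - ?I) < \<epsilon>) sequentially"
        using tail[OF elim(1) 1] tail[OF elim(2) 1]
        by eventually_elim (auto simp: birkhoff_uminus)
      then show ?case by (simp add: eventually_sequentially)
    qed
  qed
qed


section \<open>Uniqueness of the invariant measure of a class\<close>

lemma infsum_src_eq:
  assumes "\<And>e. src M e \<noteq> j \<Longrightarrow> f e = 0"
  shows "(\<Sum>\<^sub>\<infinity>e\<in>{e. src M e = j}. f e) = (\<integral>\<^sup>+e. f e \<partial>count_space UNIV)"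
proof -
  have "(\<Sum>\<^sub>\<infinity>e\<in>{e. src M e = j}. f e) = (\<Sum>\<^sub>\<infinity>e. f e)"
    using assms by (intro infsum_cong_neutral) auto
  then show ?thesis by (simp add: infsum_ennreal_eq_nn_integral)
qed

lemma prb_eq_0: "x \<in> vert M j \<Longrightarrow> src M e \<noteq> j \<Longrightarrow> prb M e x = 0"
  using prb_pos_vert[of e x] vert_unique[of x j "src M e"] prb_nonneg[of e x] by (metis less_le)

lemma nn_integral_dist_step:
  assumes con: "\<And>j x y. x \<in> vert M j \<Longrightarrow> y \<in> vert M j \<Longrightarrow>
      (\<Sum>\<^sub>\<infinity>e\<in>{e. src M e = j}. ennreal (prb M e x * dist (wmap M e x) (wmap M e y))) \<le> ennreal (a * dist x y)"
    and x: "x \<in> vert M j" and y: "y \<in> vert M j"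
  shows "(\<integral>\<^sup>+b. ennreal (prbbar M b x) * ennreal (dist (wbar M b x) (wbar M b y)) \<partial>count_space UNIV)
    \<le> ennreal (a * dist x y)"
  using con[OF x y] prb_eq_0[OF x]
  by (subst nn_integral_count_space_option) (simp_all add: infsum_src_eq ennreal_mult)

lemma same_vertex_step:
  assumes "0 < prbbar M b x" "x \<in> vert M j" "y \<in> vert M j"
  obtains k where "wbar M b x \<in> vert M k" "wbar M b y \<in> vert M k"
proof (cases b)
  case (Some e)
  then have "src M e = j" using assms prb_pos_vert[of e x] vert_unique by auto
  then show ?thesis using that[of "tgt M e"] assms vert_tgt Some by auto
qed (use assms in auto)

text \<open>Both orbits are driven by the same letters, drawn with the probabilities seen from
  \<open>x\<close>. Letters of positive weight keep the two points in a common vertex set, where the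
  contraction applies again.\<close>

lemma nn_integral_dist_orb:
  assumes con: "\<And>j x y. x \<in> vert M j \<Longrightarrow> y \<in> vert M j \<Longrightarrow>
      (\<Sum>\<^sub>\<infinity>e\<in>{e. src M e = j}. ennreal (prb M e x * dist (wmap M e x) (wmap M e y))) \<le> ennreal (a * dist x y)"
    and a: "0 \<le> a" and x: "x \<in> vert M j" and y: "y \<in> vert M j"
  shows "(\<integral>\<^sup>+\<sigma>. ennreal (dist (orb \<sigma> n x) (orb \<sigma> n y)) \<partial>P x) \<le> ennreal (a ^ n * dist x y)"
  using x y
proof (induction n arbitrary: x y j)
  case 0
  then show ?case using P.emeasure_space_1[of x] by simp
next
  case (Suc n)
  have "(\<integral>\<^sup>+\<sigma>. ennreal (dist (orb \<sigma> (Suc n) x) (orb \<sigma> (Suc n) y)) \<partial>P x)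
      = (\<integral>\<^sup>+b. ennreal (prbbar M b x) *
          (\<integral>\<^sup>+\<sigma>. ennreal (dist (orb \<sigma> n (wbar M b x)) (orb \<sigma> n (wbar M b y))) \<partial>P (wbar M b x)) \<partial>count_space UNIV)"
    by (subst nn_integral_P) (simp_all add: orb_case_nat)
  also have "\<dots> \<le> (\<integral>\<^sup>+b. ennreal (a ^ n) *
      (ennreal (prbbar M b x) * ennreal (dist (wbar M b x) (wbar M b y))) \<partial>count_space UNIV)"
  proof (rule nn_integral_mono)
    fix b
    show "ennreal (prbbar M b x) *
          (\<integral>\<^sup>+\<sigma>. ennreal (dist (orb \<sigma> n (wbar M b x)) (orb \<sigma> n (wbar M b y))) \<partial>P (wbar M b x))
        \<le> ennreal (a ^ n) * (ennreal (prbbar M b x) * ennreal (dist (wbar M b x) (wbar M b y)))"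
    proof (cases "prbbar M b x = 0")
      case False
      then have "0 < prbbar M b x" using prbbar_nonneg[of b x] by linarith
      then obtain k where "wbar M b x \<in> vert M k" "wbar M b y \<in> vert M k"
        using same_vertex_step Suc.prems by metis
      from mult_left_mono[OF Suc.IH[OF this], of "ennreal (prbbar M b x)"] a
      show ?thesis by (simp add: ennreal_mult mult.left_commute)
    qed simp
  qed
  also have "\<dots> \<le> ennreal (a ^ n) * ennreal (a * dist x y)"
    using nn_integral_dist_step[OF con Suc.prems] by (simp add: nn_integral_cmult mult_left_mono)
  also have "\<dots> = ennreal (a ^ Suc n * dist x y)"
    using a by (simp add: ennreal_mult[symmetric] mult_ac)
  finally show ?case .
qed

text \<open>The distances of the two orbits have a geometric series as expected sum, so their sum is
  finite almost surely and bounds all differences at once.\<close>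

lemma birkhoff_lipschitz_bounded:
  assumes con: "contractive M" and xy: "x \<in> vert M j" "y \<in> vert M j"
    and f: "\<And>x y. \<bar>f x - f y\<bar> \<le> L * dist x y"
  shows "AE \<sigma> in P x. \<exists>K. \<forall>n. \<bar>birkhoff (\<lambda>z. f (fst z)) n (x, \<sigma>) - birkhoff (\<lambda>z. f (fst z)) n (y, \<sigma>)\<bar> \<le> K"
proof -
  obtain a where a: "0 < a" "a < 1" and con': "\<And>j x y. x \<in> vert M j \<Longrightarrow> y \<in> vert M j \<Longrightarrow>
      (\<Sum>\<^sub>\<infinity>e\<in>{e. src M e = j}. ennreal (prb M e x * dist (wmap M e x) (wmap M e y))) \<le> ennreal (a * dist x y)"
    using con unfolding contractive_def by blast
  let ?d = "\<lambda>\<sigma> n. ennreal (dist (orb \<sigma> n x) (orb \<sigma> n y))"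
  have "(\<integral>\<^sup>+\<sigma>. (\<Sum>n. ?d \<sigma> n) \<partial>P x) = (\<Sum>n. \<integral>\<^sup>+\<sigma>. ?d \<sigma> n \<partial>P x)"
    by (rule nn_integral_suminf) simp
  also have "\<dots> \<le> (\<Sum>n. ennreal (a ^ n * dist x y))"
    using a xy by (intro suminf_le nn_integral_dist_orb[OF con']) auto
  also have "\<dots> = ennreal (\<Sum>n. a ^ n * dist x y)"
    using a by (intro suminf_ennreal2) (auto intro!: summable_mult2 summable_geometric)
  finally have "(\<integral>\<^sup>+\<sigma>. (\<Sum>n. ?d \<sigma> n) \<partial>P x) \<noteq> \<infinity>"
    by (auto simp: top_unique)
  then have "AE \<sigma> in P x. (\<Sum>n. ?d \<sigma> n) \<noteq> \<infinity>"
    by (rule nn_integral_PInf_AE[rotated]) measurable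
  then show ?thesis
  proof eventually_elim
    case (elim \<sigma>)
    define s where "s = enn2real (\<Sum>n. ?d \<sigma> n)"
    have s: "ennreal s = (\<Sum>n. ?d \<sigma> n)" using elim by (simp add: s_def less_top)
    have "\<bar>birkhoff (\<lambda>z. f (fst z)) n (x, \<sigma>) - birkhoff (\<lambda>z. f (fst z)) n (y, \<sigma>)\<bar> \<le> \<bar>L\<bar> * s" for n
    proof -
      have "ennreal (\<Sum>k<n. dist (orb \<sigma> k x) (orb \<sigma> k y)) = (\<Sum>k<n. ?d \<sigma> k)" by simp
      also have "\<dots> \<le> (\<Sum>n. ?d \<sigma> n)" by (rule sum_le_suminf) auto
      finally have *: "(\<Sum>k<n. dist (orb \<sigma> k x) (orb \<sigma> k y)) \<le> s"
        unfolding s[symmetric] by (subst (asm) ennreal_le_iff) (simp_all add: s_def)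
      have "\<bar>birkhoff (\<lambda>z. f (fst z)) n (x, \<sigma>) - birkhoff (\<lambda>z. f (fst z)) n (y, \<sigma>)\<bar>
          = \<bar>\<Sum>k<n. f (orb \<sigma> k x) - f (orb \<sigma> k y)\<bar>"
        by (simp add: birkhoff_def skew_funpow sum_subtractf)
      also have "\<dots> \<le> (\<Sum>k<n. \<bar>f (orb \<sigma> k x) - f (orb \<sigma> k y)\<bar>)" by (rule sum_abs)
      also have "\<dots> \<le> (\<Sum>k<n. \<bar>L\<bar> * dist (orb \<sigma> k x) (orb \<sigma> k y))"
      proof (rule sum_mono)
        fix k
        have "L * dist (orb \<sigma> k x) (orb \<sigma> k y) \<le> \<bar>L\<bar> * dist (orb \<sigma> k x) (orb \<sigma> k y)"
          by (intro mult_right_mono) auto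
        then show "\<bar>f (orb \<sigma> k x) - f (orb \<sigma> k y)\<bar> \<le> \<bar>L\<bar> * dist (orb \<sigma> k x) (orb \<sigma> k y)"
          using f[of "orb \<sigma> k x" "orb \<sigma> k y"] by linarith
      qed
      also have "\<dots> \<le> \<bar>L\<bar> * s"
        unfolding sum_distrib_left[symmetric] using * by (intro mult_left_mono) auto
      finally show ?thesis .
    qed
    then show ?case by blast
  qed
qed

lemma distr_path_law_fst:
  assumes sets: "sets \<mu> = sets borel"
  shows "distr (path_law \<mu>) borel fst = \<mu>"
proof (rule measure_eqI)
  fix A :: "'a set" assume A0: "A \<in> sets (distr (path_law \<mu>) borel fst)"
  then have A: "A \<in> sets borel" by simp
  define I where "I z = (indicator A (fst z) :: ennreal)" for z :: "'a \<times> (nat \<Rightarrow> 'e option)"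
  have I: "I \<in> borel_measurable (borel \<Otimes>\<^sub>M seqs)"
    unfolding I_def using A by (intro measurable_compose[OF measurable_fst borel_measurable_indicator])
  have fst: "fst \<in> measurable (path_law \<mu>) borel"
    by (simp only: measurable_cong_sets[OF sets_path_law[OF sets] refl] measurable_fst)
  have "emeasure (distr (path_law \<mu>) borel fst) A = (\<integral>\<^sup>+x. indicator A x \<partial>distr (path_law \<mu>) borel fst)"
    by (rule nn_integral_indicator[symmetric]) (rule A0)
  also have "\<dots> = (\<integral>\<^sup>+z. I z \<partial>path_law \<mu>)"
    unfolding I_def by (rule nn_integral_distr[OF fst borel_measurable_indicator]) (rule A0)
  also have "\<dots> = (\<integral>\<^sup>+x. indicator A x \<partial>\<mu>)"
    unfolding nn_integral_path_law[OF sets I] using P.emeasure_space_1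
    by (intro nn_integral_cong) (simp add: I_def)
  also have "\<dots> = emeasure \<mu> A" using A sets by simp
  finally show "emeasure (distr (path_law \<mu>) borel fst) A = emeasure \<mu> A" .
qed (simp add: sets)

text \<open>From one starting point, almost surely the same Birkhoff averages converge to both
  integrals; hence bounded Lipschitz functions have equal integrals. They approximate indicators of
  closed sets, which determine a Borel probability measure on a metric space.\<close>

lemma invariant_measure_unique:
  assumes acc: "absolute_continuity_condition M" and con: "contractive M"
    and c: "c \<in> essential_classes M"
    and \<mu>: "\<mu> \<in> invariant_measures M" "AE x in \<mu>. x \<in> class_union M c"
    and \<nu>: "\<nu> \<in> invariant_measures M" "AE x in \<nu>. x \<in> class_union M c"
  shows "\<mu> = \<nu>"
proof -
  obtain j where "j \<in> c" using c by (elim essential_classE)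
  moreover have "vert M j \<noteq> {}" using M by (simp add: markov_system_def)
  ultimately obtain x where x: "x \<in> class_union M c" by (auto simp: class_union_def)
  have lim: "AE \<sigma> in P x. (\<lambda>n. 1 / real n * birkhoff (\<lambda>z. f (fst z)) n (x, \<sigma>)) \<longlonglongrightarrow> (\<integral>x. f x \<partial>\<mu>)"
    if \<mu>: "\<mu> \<in> invariant_measures M" "AE x in \<mu>. x \<in> class_union M c"
      and f: "f \<in> borel_measurable borel" "\<And>x y. \<bar>f x - f y\<bar> \<le> L * dist x y" "\<And>x. \<bar>f x\<bar> \<le> 1"
    for \<mu> f L
  proof -
    have sets: "sets \<mu> = sets borel" and prob: "prob_space \<mu>"
      using \<mu> by (auto simp: invariant_measures_def)
    interpret L: prob_space "path_law \<mu>" using prob sets by (rule prob_space_path_law)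
    have meas: "(\<lambda>z. f (fst z)) \<in> borel_measurable (borel \<Otimes>\<^sub>M (seqs :: (nat \<Rightarrow> 'e option) measure))"
      using measurable_compose[OF measurable_fst f(1)] .
    then have meas': "(\<lambda>z. f (fst z)) \<in> borel_measurable (path_law \<mu>)"
      by (simp only: measurable_cong_sets[OF sets_path_law[OF sets] refl])
    have int: "integrable (path_law \<mu>) (\<lambda>z. f (fst z))"
      by (rule L.integrable_const_bound[OF _ meas', where B = 1]) (use f(3) in simp)
    have "(\<integral>z. f (fst z) \<partial>path_law \<mu>) = (\<integral>x. f x \<partial>distr (path_law \<mu>) borel fst)"
      by (rule integral_distr[symmetric, OF _ f(1)])
        (simp only: measurable_cong_sets[OF sets_path_law[OF sets] refl] measurable_fst)
    also have "\<dots> = (\<integral>x. f x \<partial>\<mu>)" by (simp only: distr_path_law_fst[OF sets])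
    finally show ?thesis
      using birkhoff_class[OF acc \<mu>(1) c \<mu>(2) meas int birkhoff_lipschitz_bounded[OF con _ _ f(2)] x]
      by simp
  qed
  have eq: "(\<integral>x. f x \<partial>\<mu>) = (\<integral>x. f x \<partial>\<nu>)"
    if f: "f \<in> borel_measurable borel" "\<And>x y. \<bar>f x - f y\<bar> \<le> L * dist x y" "\<And>x. \<bar>f x\<bar> \<le> 1" for f L
  proof -
    have "AE \<sigma> in P x. (\<integral>x. f x \<partial>\<mu>) = (\<integral>x. f x \<partial>\<nu>)"
      using lim[OF \<mu> f] lim[OF \<nu> f] by eventually_elim (rule LIMSEQ_unique)
    then show ?thesis by simp
  qed
  have closed_eq: "emeasure \<mu> A = emeasure \<nu> A" if A: "closed A" for A
  \<comment> \<open>The distance to the empty set is 0 by convention in \<open>infdist\<close>, so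
    the approximating functions below would not tend to its indicator.\<close>
  proof (cases "A = {}")
    case False
    \<comment> \<open>An \<open>m\<close>-Lipschitz function that is 1 on \<open>A\<close> and
      vanishes at distance at least \<open>1 / m\<close>.\<close>
    define f where "f m x = max 0 (1 - real m * infdist x A)" for m :: nat and x
    have f_cont: "continuous_on UNIV (f m)" for m
      unfolding f_def by (intro continuous_intros continuous_on_infdist)
    have f_meas: "f m \<in> borel_measurable borel" for m
      using f_cont by (rule borel_measurable_continuous_onI)
    have f_lip: "\<bar>f m x - f m y\<bar> \<le> real m * dist x y" for m x y
    proof -
      have "\<bar>f m x - f m y\<bar> \<le> \<bar>real m * infdist x A - real m * infdist y A\<bar>"
        unfolding f_def by linarith
      also have "\<dots> = real m * \<bar>infdist x A - infdist y A\<bar>"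
        by (simp add: right_diff_distrib[symmetric] abs_mult)
      also have "\<dots> \<le> real m * dist x y"
        using infdist_triangle_abs[of x A y] by (intro mult_left_mono) auto
      finally show ?thesis .
    qed
    have f_bd: "\<bar>f m x\<bar> \<le> 1" for m x
      using infdist_nonneg[of x A] by (auto simp: f_def)
    have f_lim: "(\<lambda>m. f m x) \<longlonglongrightarrow> indicator A x" for x
    proof (cases "x \<in> A")
      case True
      then show ?thesis using infdist_zero[OF True] by (simp add: f_def)
    next
      case False
      then have pos: "0 < infdist x A"
        using A \<open>A \<noteq> {}\<close> in_closed_iff_infdist_zero[of A x] infdist_nonneg[of x A] by auto
      obtain N :: nat where N: "1 / infdist x A < real N" using reals_Archimedean2 by blast
      have "f m x = 0" if "N \<le> m" for m
      proof -
        have "1 < real N * infdist x A" using N pos by (simp add: field_simps)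
        also have "\<dots> \<le> real m * infdist x A" using that pos by (intro mult_right_mono) auto
        finally show ?thesis by (simp add: f_def)
      qed
      then show ?thesis
        using False by (intro tendsto_eventually) (auto simp: eventually_sequentially)
    qed
    have conv: "(\<lambda>m. \<integral>x. f m x \<partial>\<mu>) \<longlonglongrightarrow> measure \<mu> A" if "\<mu> \<in> invariant_measures M" for \<mu>
    proof -
      have sets: "sets \<mu> = sets borel" and prob: "prob_space \<mu>"
        using that by (auto simp: invariant_measures_def)
      interpret prob_space \<mu> by fact
      have "A \<in> sets \<mu>" using A sets by (simp add: borel_closed)
      then have "(\<integral>x. indicator A x \<partial>\<mu>) = measure \<mu> A" by simp
      moreover have "(\<lambda>m. \<integral>x. f m x \<partial>\<mu>) \<longlonglongrightarrow> (\<integral>x. indicator A x \<partial>\<mu>)"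
      proof (rule integral_dominated_convergence[where w = "\<lambda>_. 1"])
        show "(\<lambda>x. indicator A x :: real) \<in> borel_measurable \<mu>"
          using \<open>A \<in> sets \<mu>\<close> by (rule borel_measurable_indicator)
        show "f m \<in> borel_measurable \<mu>" for m
          using f_meas by (simp only: measurable_cong_sets[OF sets refl])
      qed (use f_lim f_bd in auto)
      ultimately show ?thesis by simp
    qed
    have "measure \<mu> A = measure \<nu> A"
      using conv[OF \<mu>(1)] conv[OF \<nu>(1)] eq[OF f_meas f_lip f_bd] LIMSEQ_unique by simp
    moreover have "finite_measure \<mu>" "finite_measure \<nu>"
      using \<mu> \<nu> by (auto simp: invariant_measures_def prob_space.axioms(1))
    ultimately show ?thesis by (simp add: finite_measure.emeasure_eq_measure)
  qed simp
  have gen: "sets (borel :: 'a measure) = sigma_sets UNIV (Collect closed)"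
    unfolding borel_eq_closed by (rule sets_measure_of) simp
  show ?thesis
  proof (rule measure_eqI_generator_eq[where E = "Collect closed" and \<Omega> = UNIV and A = "\<lambda>_. UNIV"])
    show "Int_stable (Collect closed :: 'a set set)" by (auto simp: Int_stable_def)
    interpret prob_space \<mu> using \<mu> by (auto simp: invariant_measures_def)
    show "emeasure \<mu> UNIV \<noteq> \<infinity>" by simp
    show "sets \<mu> = sigma_sets UNIV (Collect closed)" "sets \<nu> = sigma_sets UNIV (Collect closed)"
      using \<mu> \<nu> gen by (auto simp: invariant_measures_def)
  qed (use closed_eq in auto)
qed

text \<open>An invariant measure dominated by \<mu> is carried by the same class, where only \<mu>
  is available.\<close>

lemma ergodic_measure_class:
  assumes acc: "absolute_continuity_condition M" and con: "contractive M"
    and c: "c \<in> essential_classes M"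
    and \<mu>: "\<mu> \<in> invariant_measures M" "AE x in \<mu>. x \<in> class_union M c"
  shows "ergodic_measure M \<mu>"
  unfolding ergodic_measure_def
proof (intro conjI ballI impI)
  fix \<nu> assume \<nu>: "\<nu> \<in> invariant_measures M" and ac: "absolutely_continuous \<mu> \<nu>"
  have "sets \<nu> = sets \<mu>" using \<mu> \<nu> by (simp add: invariant_measures_def)
  then have "AE x in \<nu>. x \<in> class_union M c"
    using ac \<mu>(2) by (rule absolutely_continuous_AE)
  then show "\<nu> = \<mu>" using invariant_measure_unique[OF acc con c \<nu> _ \<mu>] by simp
qed (rule \<mu>(1))

end

section \<open>Entropy along a communication class\<close>

context markov
begin

lemma cyl_prob_snoc: "cyl_prob M (w @ [a]) x = cyl_prob M w x * prbbar M a (fold (wbar M) w x)"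
  by (induction w arbitrary: x) simp_all

lemma AE_cyl_prob_pos: "AE \<sigma> in P x. \<forall>n. 0 < cyl_prob M (map \<sigma> [0..<n]) x"
proof -
  have "AE \<sigma> in P x. \<forall>w. cyl_prob M w x = 0 \<longrightarrow> \<sigma> \<notin> cylinder w"
    unfolding AE_all_countable
  proof
    fix w
    show "AE \<sigma> in P x. cyl_prob M w x = 0 \<longrightarrow> \<sigma> \<notin> cylinder w"
    proof (cases "cyl_prob M w x = 0")
      case True
      then have "cylinder w \<in> null_sets (P x)"
        by (intro null_setsI) (simp_all add: emeasure_P_cylinder)
      then show ?thesis using AE_not_in by fastforce
    qed simp
  qed
  then show ?thesis
  proof eventually_elim
    case (elim \<sigma>)
    have "\<sigma> \<in> cylinder (map \<sigma> [0..<n])" for n by (simp add: cylinder_def)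
    then have "cyl_prob M (map \<sigma> [0..<n]) x \<noteq> 0" for n using elim by blast
    then show ?case using cyl_prob_nonneg by (metis less_le)
  qed
qed

text \<open>The ratio of the cylinder probabilities is a nonnegative martingale under \<open>P x\<close>; the bound is
  Doob's maximal inequality, obtained by decomposing the event into the shortest cylinders on which
  the ratio exceeds \<open>K\<close>.\<close>

lemma AE_cyl_prob_ratio_bounded:
  "AE \<sigma> in P x. \<exists>K::nat. \<forall>n. cyl_prob M (map \<sigma> [0..<n]) y \<le> real K * cyl_prob M (map \<sigma> [0..<n]) x"
proof -
  define bad where "bad K w \<longleftrightarrow> real K * cyl_prob M w x < cyl_prob M w y" for K :: nat and w
  define L where "L K = {w. bad K w \<and> (\<forall>k<length w. \<not> bad K (take k w))}" for K
  define H where "H K = (\<Union>w\<in>L K. cylinder w)" for K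
  have H_sets: "H K \<in> sets seqs" for K
    unfolding H_def by (intro sets.countable_UN') auto
  have disj: "disjoint_family_on cylinder (L K)" for K
  proof -
    have *: "v = w" if "v \<in> L K" "w \<in> L K" "\<sigma> \<in> cylinder v" "\<sigma> \<in> cylinder w" "length v \<le> length w" for v w \<sigma>
    proof -
      have v: "v = take (length v) w"
        using that(3-5) by (intro nth_equalityI) (auto simp: cylinder_def)
      have "\<not> length v < length w"
      proof
        assume "length v < length w"
        then have "\<not> bad K (take (length v) w)" using that(2) by (simp add: L_def)
        then show False using that(1) v by (simp add: L_def)
      qed
      then show ?thesis using v that(5) by simp
    qed
    show ?thesis
      unfolding disjoint_family_on_def using * by (metis disjoint_iff linear)
  qed
  have emeasure_H: "emeasure (P z) (H K) = (\<integral>\<^sup>+w. ennreal (cyl_prob M w z) \<partial>count_space (L K))" for z K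
    unfolding H_def using disj[of K]
    by (subst emeasure_UN_countable) (simp_all add: emeasure_P_cylinder)
  have H_le: "ennreal (real K) * emeasure (P x) (H K) \<le> 1" for K
  proof -
    have "ennreal (real K) * emeasure (P x) (H K) = (\<integral>\<^sup>+w. ennreal (real K * cyl_prob M w x) \<partial>count_space (L K))"
      unfolding emeasure_H by (simp add: nn_integral_cmult ennreal_mult)
    also have "\<dots> \<le> (\<integral>\<^sup>+w. ennreal (cyl_prob M w y) \<partial>count_space (L K))"
      by (intro nn_integral_mono ennreal_leI) (auto simp: L_def bad_def)
    also have "\<dots> = emeasure (P y) (H K)" by (simp only: emeasure_H)
    also have "\<dots> \<le> 1" by (rule P.measure_le_1)
    finally show ?thesis .
  qed
  have le: "real K * measure (P x) (\<Inter>K. H K) \<le> 1" for K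
  proof -
    have "real K * measure (P x) (\<Inter>K. H K) \<le> real K * measure (P x) (H K)"
      using H_sets by (intro mult_left_mono P.finite_measure_mono) auto
    also have "ennreal \<dots> \<le> 1"
      using H_le[of K] by (simp add: P.emeasure_eq_measure ennreal_mult)
    then have "real K * measure (P x) (H K) \<le> 1" by simp
    finally show ?thesis .
  qed
  have "measure (P x) (\<Inter>K. H K) = 0"
  proof (rule ccontr)
    assume "measure (P x) (\<Inter>K. H K) \<noteq> 0"
    then have "0 < measure (P x) (\<Inter>K. H K)" by (simp add: less_le)
    then obtain K :: nat where "1 < real K * measure (P x) (\<Inter>K. H K)"
      using reals_Archimedean3 by blast
    with le[of K] show False by simp
  qed
  moreover have H_Inter: "(\<Inter>K. H K) \<in> sets (P x)" using H_sets by auto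
  ultimately have "AE \<sigma> in P x. \<sigma> \<notin> (\<Inter>K. H K)"
    by (subst AE_iff_measurable[OF H_Inter]) (auto simp: P.emeasure_eq_measure)
  then show ?thesis
  proof eventually_elim
    case (elim \<sigma>)
    then obtain K where K: "\<sigma> \<notin> H K" by blast
    have "\<not> bad K (map \<sigma> [0..<n])" for n
    proof (induction n rule: less_induct)
      case (less n)
      show ?case
      proof
        assume "bad K (map \<sigma> [0..<n])"
        then have "map \<sigma> [0..<n] \<in> L K" using less by (auto simp: L_def take_map)
        moreover have "\<sigma> \<in> cylinder (map \<sigma> [0..<n])" by (simp add: cylinder_def)
        ultimately show False using K by (auto simp: H_def)
      qed
    qed
    then show ?case by (intro exI[of _ K]) (auto simp: bad_def not_less)
  qed
qed

text \<open>For a letter of weight 0 the value is \<open>ln 0 = 0\<close>; such letters occur only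
  on a null set of paths, and the function stays nonpositive.\<close>

definition log_prb :: "'a \<times> (nat \<Rightarrow> 'e option) \<Rightarrow> real" where
  "log_prb z = ln (prbbar M (snd z 0) (fst z))"

lemma measurable_log_prb: "log_prb \<in> borel_measurable (borel \<Otimes>\<^sub>M seqs)"
proof -
  have 1: "(\<lambda>z. snd z 0) \<in> measurable (borel \<Otimes>\<^sub>M seqs) (count_space (UNIV :: 'e option set))"
    using measurable_compose[OF measurable_snd measurable_seqs_component] .
  show ?thesis
    unfolding log_prb_def[abs_def]
    by (rule measurable_compose_countable[where f = "\<lambda>a z. ln (prbbar M a (fst z))", OF _ 1]) simp
qed

lemma birkhoff_log_prb:
  assumes "\<forall>n. 0 < cyl_prob M (map \<sigma> [0..<n]) x"
  shows "birkhoff log_prb n (x, \<sigma>) = ln (cyl_prob M (map \<sigma> [0..<n]) x)"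
proof (induction n)
  case (Suc n)
  have eq: "cyl_prob M (map \<sigma> [0..<Suc n]) x
      = cyl_prob M (map \<sigma> [0..<n]) x * prbbar M (\<sigma> n) (orb \<sigma> n x)"
    by (simp add: cyl_prob_snoc orb_def)
  have pos: "0 < cyl_prob M (map \<sigma> [0..<n]) x" "0 < cyl_prob M (map \<sigma> [0..<Suc n]) x"
    using assms by blast+
  then have "0 < prbbar M (\<sigma> n) (orb \<sigma> n x)"
    unfolding eq by (simp add: zero_less_mult_iff)
  moreover have "birkhoff log_prb (Suc n) (x, \<sigma>) = birkhoff log_prb n (x, \<sigma>) + ln (prbbar M (\<sigma> n) (orb \<sigma> n x))"
    by (simp add: birkhoff_def skew_funpow log_prb_def)
  ultimately show ?case using Suc pos(1) by (simp add: eq ln_mult del: upt_Suc)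
qed (simp add: birkhoff_def)

text \<open>The ratio of the cylinder probabilities from \<open>x\<close> and \<open>y\<close> is
  bounded in one direction under \<open>P x\<close>. The reverse bound holds under
  \<open>P y\<close> and is carried to \<open>P x\<close> by absolute continuity.\<close>

lemma birkhoff_log_prb_bounded:
  assumes acc: "absolute_continuity_condition M" and xy: "x \<in> vert M j" "y \<in> vert M j"
  shows "AE \<sigma> in P x. \<exists>K. \<forall>n. \<bar>birkhoff log_prb n (x, \<sigma>) - birkhoff log_prb n (y, \<sigma>)\<bar> \<le> K"
proof -
  let ?p = "\<lambda>n \<sigma> x. cyl_prob M (map \<sigma> [0..<n]) x"
  have "absolutely_continuous (P y) (P x)"
    using acc xy by (auto simp: absolute_continuity_condition_def)
  then have ac: "AE \<sigma> in P x. R \<sigma>" if "AE \<sigma> in P y. R \<sigma>" for R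
    using that by (rule absolutely_continuous_AE[rotated 1]) simp
  show ?thesis
    using AE_cyl_prob_pos[of x] ac[OF AE_cyl_prob_pos[of y]]
      AE_cyl_prob_ratio_bounded[where x = x and y = y]
      ac[OF AE_cyl_prob_ratio_bounded[where x = y and y = x]]
  proof eventually_elim
    case (elim \<sigma>)
    obtain K1 :: nat where K1: "\<forall>n. ?p n \<sigma> y \<le> real K1 * ?p n \<sigma> x" using elim by blast
    obtain K2 :: nat where K2: "\<forall>n. ?p n \<sigma> x \<le> real K2 * ?p n \<sigma> y" using elim by blast
    \<comment> \<open>\<open>Suc K\<close> replaces \<open>K\<close> to have a logarithm that is
      nonnegative, also when \<open>K = 0\<close>.\<close>
    have le: "ln b \<le> ln (real (Suc K)) + ln a" if "0 < a" "0 < b" "b \<le> real K * a" for a b :: real and K :: nat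
    proof -
      have "b \<le> real (Suc K) * a" using that by (simp add: algebra_simps)
      then have "ln b \<le> ln (real (Suc K) * a)" using that by (subst ln_le_cancel_iff) auto
      then show ?thesis using that by (simp add: ln_mult)
    qed
    let ?K = "ln (real (Suc K1)) + ln (real (Suc K2))"
    have nn: "0 \<le> ln (real (Suc K1))" "0 \<le> ln (real (Suc K2))" by simp_all
    have "\<bar>birkhoff log_prb n (x, \<sigma>) - birkhoff log_prb n (y, \<sigma>)\<bar> \<le> ?K" for n
    proof -
      have "ln (?p n \<sigma> y) \<le> ln (real (Suc K1)) + ln (?p n \<sigma> x)"
        using elim K1 by (intro le) auto
      moreover have "ln (?p n \<sigma> x) \<le> ln (real (Suc K2)) + ln (?p n \<sigma> y)"
        using elim K2 by (intro le) auto
      ultimately show ?thesis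
        unfolding birkhoff_log_prb[OF elim(1)] birkhoff_log_prb[OF elim(2)] using nn by linarith
    qed
    then show ?case by blast
  qed
qed

text \<open>Conditioned on the starting point, the mean of \<open>- log_prb\<close> is the entropy
  sum, which is bounded. Tonelli exchanges it with \<mu> in \<open>ennreal\<close>, and only the
  finite result is converted to real sums and integrals.\<close>

lemma log_prb_integral:
  assumes ent: "bounded_entropy M" and \<mu>: "\<mu> \<in> invariant_measures M"
  shows "integrable (path_law \<mu>) log_prb"
    and "(\<integral>z. log_prb z \<partial>path_law \<mu>) = (\<Sum>\<^sub>\<infinity>e. LINT y:vert M (src M e)|\<mu>. prb M e y * ln (prb M e y))"
proof -
  have sets: "sets \<mu> = sets borel" and prob: "prob_space \<mu>"
    using \<mu> by (auto simp: invariant_measures_def)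
  interpret \<mu>: prob_space \<mu> by fact
  obtain C where C: "\<And>x. (\<Sum>\<^sub>\<infinity>e. ennreal (- (prb M e x * ln (prb M e x)))) \<le> ennreal C"
    using ent unfolding bounded_entropy_def by blast
  define H where "H e y = - (prb M e y * ln (prb M e y))" for e y
  have ln_nonpos: "ln p \<le> 0" if "0 \<le> p" "p \<le> 1" for p :: real
    using that by (cases "p = 0") auto
  have H_nonneg: "0 \<le> H e y" for e y
    using ln_nonpos[OF prb_nonneg prb_le_1, of e y] prb_nonneg[of e y]
    by (simp add: H_def mult_nonneg_nonpos)
  have H_meas: "H e \<in> borel_measurable borel" for e
    unfolding H_def[abs_def] by measurable
  then have H_meas': "H e \<in> borel_measurable \<mu>" for e
    by (simp only: measurable_cong_sets[OF sets refl])
  have neg_le: "0 \<le> - log_prb z" for z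
    using ln_nonpos[OF prbbar_nonneg prbbar_le_1] by (simp add: log_prb_def)
  have meas: "(\<lambda>z. ennreal (- log_prb z)) \<in> borel_measurable (borel \<Otimes>\<^sub>M seqs)"
    using measurable_log_prb by measurable
  have inner: "(\<integral>\<^sup>+\<sigma>. ennreal (- log_prb (x, \<sigma>)) \<partial>P x) = (\<integral>\<^sup>+e. ennreal (H e x) \<partial>count_space UNIV)" for x
  proof -
    have "(\<integral>\<^sup>+\<sigma>. ennreal (- log_prb (x, \<sigma>)) \<partial>P x)
        = (\<integral>\<^sup>+a. ennreal (prbbar M a x) * (\<integral>\<^sup>+\<sigma>. ennreal (- ln (prbbar M a x)) \<partial>P (wbar M a x)) \<partial>count_space UNIV)"
      unfolding log_prb_def fst_conv snd_conv
      by (rule nn_integral_P_skew[where f = "\<lambda>a \<sigma>. ennreal (- ln (prbbar M a x))"]) simp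
    also have "\<dots> = (\<integral>\<^sup>+e. ennreal (prb M e x) * ennreal (- ln (prb M e x)) \<partial>count_space UNIV)"
      using P.emeasure_space_1 by (subst nn_integral_count_space_option) simp_all
    also have "\<dots> = (\<integral>\<^sup>+e. ennreal (H e x) \<partial>count_space UNIV)"
      unfolding H_def by (intro nn_integral_cong) (simp add: ennreal_mult'[symmetric])
    finally show ?thesis .
  qed
  have total: "(\<integral>\<^sup>+z. ennreal (- log_prb z) \<partial>path_law \<mu>) = (\<integral>\<^sup>+e. (\<integral>\<^sup>+x. ennreal (H e x) \<partial>\<mu>) \<partial>count_space UNIV)"
    unfolding nn_integral_path_law[OF sets meas] inner using H_meas'
    by (subst nn_integral_count_space_nn_integral) auto
  have fin: "(\<integral>\<^sup>+z. ennreal (- log_prb z) \<partial>path_law \<mu>) < \<infinity>"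
  proof -
    have "(\<integral>\<^sup>+z. ennreal (- log_prb z) \<partial>path_law \<mu>) \<le> (\<integral>\<^sup>+x. ennreal C \<partial>\<mu>)"
      unfolding nn_integral_path_law[OF sets meas] inner
      using C by (intro nn_integral_mono) (simp add: H_def infsum_ennreal_eq_nn_integral)
    also have "\<dots> < \<infinity>" by (simp add: \<mu>.emeasure_space_1)
    finally show ?thesis .
  qed
  have meas': "log_prb \<in> borel_measurable (path_law \<mu>)"
    using measurable_log_prb by (simp only: measurable_cong_sets[OF sets_path_law[OF sets] refl])
  show int: "integrable (path_law \<mu>) log_prb"
    using fin meas' neg_le by (intro integrableI_bounded) (simp_all add: abs_of_nonpos)
  have int_e: "(\<integral>\<^sup>+x. ennreal (H e x) \<partial>\<mu>) \<noteq> \<top>" for e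
  proof -
    have "(\<integral>\<^sup>+x. ennreal (H e x) \<partial>\<mu>) \<le> (\<integral>\<^sup>+e. (\<integral>\<^sup>+x. ennreal (H e x) \<partial>\<mu>) \<partial>count_space UNIV)"
      by (rule nn_integral_ge_point) simp
    then show ?thesis using fin unfolding total by (auto simp: top_unique)
  qed
  define h where "h e = enn2real (\<integral>\<^sup>+x. ennreal (H e x) \<partial>\<mu>)" for e
  have h: "ennreal (h e) = (\<integral>\<^sup>+x. ennreal (H e x) \<partial>\<mu>)" "0 \<le> h e" for e
    using int_e[of e] by (simp_all add: h_def less_top)
  \<comment> \<open>The probability of an edge vanishes off its source vertex set, so restricting
    the integral to that set changes nothing.\<close>
  have set_int: "(LINT y:vert M (src M e)|\<mu>. prb M e y * ln (prb M e y)) = - h e" for e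
  proof -
    have "indicator (vert M (src M e)) y *\<^sub>R (prb M e y * ln (prb M e y)) = - H e y" for y
      using prb_pos_vert[of e y] prb_nonneg[of e y]
      by (cases "prb M e y = 0") (auto simp: H_def indicator_def less_le)
    then have "(LINT y:vert M (src M e)|\<mu>. prb M e y * ln (prb M e y)) = (\<integral>y. - H e y \<partial>\<mu>)"
      by (simp add: set_lebesgue_integral_def)
    also have "\<dots> = - h e"
      using H_meas' H_nonneg by (simp add: h_def integral_eq_nn_integral)
    finally show ?thesis .
  qed
  have sum_h: "(\<integral>\<^sup>+e. ennreal (h e) \<partial>count_space UNIV) = (\<integral>\<^sup>+z. ennreal (- log_prb z) \<partial>path_law \<mu>)"
    unfolding total h(1) ..
  \<comment> \<open>A real \<open>infsum\<close> of a non-summable family would be 0 by default, so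
    the formula depends on this fact.\<close>
  have summable: "h summable_on UNIV"
  proof (rule nonneg_bdd_above_summable_on)
    show "bdd_above (sum h ` {F. F \<subseteq> UNIV \<and> finite F})"
    proof (rule bdd_aboveI2)
      fix F :: "'e set" assume F: "F \<in> {F. F \<subseteq> UNIV \<and> finite F}"
      have "ennreal (sum h F) = (\<Sum>e\<in>F. ennreal (h e))" using h(2) by (intro sum_ennreal[symmetric])
      also have "\<dots> \<le> (\<integral>\<^sup>+e. ennreal (h e) \<partial>count_space UNIV)"
        using F by (intro sum_le_nn_integral_count_space) simp
      finally have "ennreal (sum h F) \<le> ennreal (enn2real (\<integral>\<^sup>+z. ennreal (- log_prb z) \<partial>path_law \<mu>))"
        using fin by (simp add: sum_h less_top)
      then show "sum h F \<le> enn2real (\<integral>\<^sup>+z. ennreal (- log_prb z) \<partial>path_law \<mu>)"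
        by (subst (asm) ennreal_le_iff) simp_all
    qed
  qed (use h in auto)
  have "ennreal (infsum h UNIV) = (\<integral>\<^sup>+z. ennreal (- log_prb z) \<partial>path_law \<mu>)"
    using nn_integral_count_space_has_sum[OF has_sum_infsum[OF summable]] h sum_h by simp
  then have "enn2real (ennreal (infsum h UNIV)) = enn2real (\<integral>\<^sup>+z. ennreal (- log_prb z) \<partial>path_law \<mu>)"
    by simp
  then have "infsum h UNIV = (\<integral>z. - log_prb z \<partial>path_law \<mu>)"
    using meas' neg_le h(2) by (subst integral_eq_nn_integral) (auto simp: infsum_nonneg)
  then have "(\<integral>z. log_prb z \<partial>path_law \<mu>) = - infsum h UNIV" by simp
  then show "(\<integral>z. log_prb z \<partial>path_law \<mu>) = (\<Sum>\<^sub>\<infinity>e. LINT y:vert M (src M e)|\<mu>. prb M e y * ln (prb M e y))"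
    unfolding set_int by (simp add: infsum_uminus)
qed

lemma entropy_limit:
  assumes acc: "absolute_continuity_condition M" and ent: "bounded_entropy M"
    and c: "c \<in> essential_classes M"
    and \<mu>: "\<mu> \<in> invariant_measures M" "AE x in \<mu>. x \<in> class_union M c"
    and x: "x \<in> class_union M c"
  shows "AE \<sigma> in P x. (\<lambda>n. 1 / real n * ln (measure (P x) (cyl_plus (map \<sigma> [0..<n]))))
    \<longlonglongrightarrow> (\<Sum>\<^sub>\<infinity>e. LINT y:vert M (src M e)|\<mu>. prb M e y * ln (prb M e y))"
proof -
  have "AE \<sigma> in P x. (\<lambda>n. 1 / real n * birkhoff log_prb n (x, \<sigma>)) \<longlonglongrightarrow> (\<integral>z. log_prb z \<partial>path_law \<mu>)"
    by (rule birkhoff_class[OF acc \<mu>(1) c \<mu>(2) measurable_log_prb log_prb_integral(1)[OF ent \<mu>(1)] _ x])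
       (rule birkhoff_log_prb_bounded[OF acc])
  then show ?thesis
    using AE_cyl_prob_pos[of x]
  proof eventually_elim
    case (elim \<sigma>)
  then show ?case
    by (simp add: birkhoff_log_prb log_prb_integral(2)[OF ent \<mu>(1)] cyl_plus_eq_cylinder measure_P_cylinder)
  qed
qed

end

section \<open>Averaged occupation measures\<close>

context markov
begin

definition law :: "'a \<Rightarrow> nat \<Rightarrow> 'a measure" where
  "law x k = (markov_dual M ^^ k) (return borel x)"

lemma markov_op_const: "markov_op M (\<lambda>_. c) = (\<lambda>_. c)"
  by (simp add: fun_eq_iff markov_op_eq nn_integral_multc nn_integral_prbbar)

lemma sets_law [simp]: "sets (law x k) = sets borel"
  by (cases k) (simp_all add: law_def)

lemma space_law [simp]: "space (law x k) = UNIV"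
  using sets_eq_imp_space_eq[OF sets_law] by simp

lemma law_Suc: "law x (Suc k) = markov_dual M (law x k)"
  by (simp add: law_def)

lemma nn_integral_law_Suc:
  "f \<in> borel_measurable borel \<Longrightarrow> (\<integral>\<^sup>+y. f y \<partial>law x (Suc k)) = (\<integral>\<^sup>+y. markov_op M f y \<partial>law x k)"
  unfolding law_Suc by (rule nn_integral_markov_dual[OF M]) auto

lemma prob_space_law: "prob_space (law x k)"
proof (induction k)
  case 0
  then show ?case by (simp add: law_def prob_space_return)
next
  case (Suc k)
  interpret prob_space "law x k" by fact
  have "emeasure (law x (Suc k)) UNIV = (\<integral>\<^sup>+y. 1 \<partial>law x (Suc k))" by simp
  also have "\<dots> = (\<integral>\<^sup>+y. 1 \<partial>law x k)"
    by (subst nn_integral_law_Suc) (simp_all only: markov_op_const borel_measurable_const)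
  also have "\<dots> = 1" using emeasure_space_1 by simp
  finally show ?case by (intro prob_spaceI) simp
qed

text \<open>The Cesaro mean of the laws as the law at a uniformly chosen time, which makes it an
  instance of \<open>bind\<close>. Since \<open>pmf_of_set\<close> needs a nonempty set of times,
  integral formulas assume \<open>1 \<le> n\<close> or use \<open>Suc n\<close>.\<close>

definition avg :: "'a \<Rightarrow> nat \<Rightarrow> 'a measure" where
  "avg x n = Giry_Monad.bind (measure_pmf (pmf_of_set {1..n})) (law x)"

lemma law_kernel: "law x \<in> measurable (measure_pmf p) (subprob_algebra borel)"
  by (simp add: measurable_def space_subprob_algebra prob_space_imp_subprob_space prob_space_law)

lemma sets_avg [simp]: "sets (avg x n) = sets borel"
  unfolding avg_def by (rule sets_bind) auto

lemma prob_space_avg: "prob_space (avg x n)"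
  unfolding avg_def
  by (rule prob_space.prob_space_bind[OF _ _ law_kernel])
     (auto intro!: prob_space_law prob_space_measure_pmf)

lemma nn_integral_avg:
  assumes f: "f \<in> borel_measurable borel" and n: "1 \<le> n"
  shows "(\<integral>\<^sup>+y. f y \<partial>avg x n) = (\<Sum>k=1..n. \<integral>\<^sup>+y. f y \<partial>law x k) / of_nat n"
  unfolding avg_def nn_integral_bind[OF f law_kernel]
  using n by (subst nn_integral_pmf_of_set) auto

text \<open>The two averages contain the same terms except for the first and the last one, each at
  most 1, divided by \<open>n\<close>. Two inequalities avoid subtraction in
  \<open>ennreal\<close>.\<close>

lemma avg_almost_invariant:
  assumes f: "f \<in> borel_measurable borel" and le: "\<And>y. f y \<le> 1" and n: "1 \<le> n"
  shows "(\<integral>\<^sup>+y. markov_op M f y \<partial>avg x n) \<le> (\<integral>\<^sup>+y. f y \<partial>avg x n) + ennreal (1 / real n)"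
    and "(\<integral>\<^sup>+y. f y \<partial>avg x n) \<le> (\<integral>\<^sup>+y. markov_op M f y \<partial>avg x n) + ennreal (1 / real n)"
proof -
  define A where "A k = (\<integral>\<^sup>+y. f y \<partial>law x k)" for k
  have A_le: "A k \<le> 1" for k
  proof -
    have "A k \<le> (\<integral>\<^sup>+y. 1 \<partial>law x k)" unfolding A_def by (intro nn_integral_mono le)
    also have "\<dots> = 1" using prob_space.emeasure_space_1[OF prob_space_law, of x k] by simp
    finally show ?thesis .
  qed
  have div: "B / of_nat n \<le> ennreal (1 / real n)" if "B \<le> 1" for B :: ennreal
  proof -
    have "B / of_nat n \<le> 1 / of_nat n" using that by (rule divide_right_mono_ennreal)
    also have "\<dots> = ennreal (1 / real n)" using n by (simp add: divide_ennreal[symmetric] ennreal_of_nat_eq_real_of_nat)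
    finally show ?thesis .
  qed
  have I0: "(\<integral>\<^sup>+y. f y \<partial>avg x n) = (\<Sum>k=1..n. A k) / of_nat n"
    unfolding A_def by (rule nn_integral_avg[OF f n])
  have I1: "(\<integral>\<^sup>+y. markov_op M f y \<partial>avg x n) = (\<Sum>k=1..n. A (Suc k)) / of_nat n"
    unfolding A_def nn_integral_law_Suc[OF f] by (rule nn_integral_avg[OF measurable_markov_op[OF f] n])
  have tele: "(\<Sum>k=1..n. A (Suc k)) + A 1 = (\<Sum>k=1..n. A k) + A (Suc n)"
    by (induction n) (simp_all add: add_ac)
  have "(\<Sum>k=1..n. A (Suc k)) / of_nat n \<le> ((\<Sum>k=1..n. A (Suc k)) + A 1) / of_nat n"
    by (intro divide_right_mono_ennreal) simp
  also have "\<dots> \<le> (\<Sum>k=1..n. A k) / of_nat n + ennreal (1 / real n)"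
    unfolding tele add_divide_distrib_ennreal by (intro add_left_mono div A_le)
  finally show "(\<integral>\<^sup>+y. markov_op M f y \<partial>avg x n) \<le> (\<integral>\<^sup>+y. f y \<partial>avg x n) + ennreal (1 / real n)"
    unfolding I0 I1 .
  have "(\<Sum>k=1..n. A k) / of_nat n \<le> ((\<Sum>k=1..n. A k) + A (Suc n)) / of_nat n"
    by (intro divide_right_mono_ennreal) simp
  also have "\<dots> \<le> (\<Sum>k=1..n. A (Suc k)) / of_nat n + ennreal (1 / real n)"
    unfolding tele[symmetric] add_divide_distrib_ennreal by (intro add_left_mono div A_le)
  finally show "(\<integral>\<^sup>+y. f y \<partial>avg x n) \<le> (\<integral>\<^sup>+y. markov_op M f y \<partial>avg x n) + ennreal (1 / real n)"
    unfolding I0 I1 .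
qed

section \<open>Path laws with averaged starting points\<close>

definition mix :: "'a measure \<Rightarrow> (nat \<Rightarrow> 'e option) measure" where
  "mix \<nu> = Giry_Monad.bind \<nu> P"

lemma P_kernel: "sets \<nu> = sets borel \<Longrightarrow> P \<in> measurable \<nu> (subprob_algebra seqs)"
  using measurable_P_subprob by (simp only: measurable_cong_sets[of \<nu> borel])

lemma sets_mix: "sets \<nu> = sets borel \<Longrightarrow> sets (mix \<nu>) = sets seqs"
  unfolding mix_def using sets_eq_imp_space_eq[of \<nu> borel] by (intro sets_bind) auto

lemma prob_space_mix: "prob_space \<nu> \<Longrightarrow> sets \<nu> = sets borel \<Longrightarrow> prob_space (mix \<nu>)"
  unfolding mix_def
  by (rule prob_space.prob_space_bind[OF _ _ P_kernel]) (auto intro!: prob_space_P)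

lemma nn_integral_mix:
  "sets \<nu> = sets borel \<Longrightarrow> f \<in> borel_measurable seqs \<Longrightarrow>
    (\<integral>\<^sup>+\<sigma>. f \<sigma> \<partial>mix \<nu>) = (\<integral>\<^sup>+x. \<integral>\<^sup>+\<sigma>. f \<sigma> \<partial>P x \<partial>\<nu>)"
  unfolding mix_def by (rule nn_integral_bind[OF _ P_kernel])

lemma emeasure_mix:
  "sets \<nu> = sets borel \<Longrightarrow> A \<in> sets seqs \<Longrightarrow> emeasure (mix \<nu>) A = (\<integral>\<^sup>+x. emeasure (P x) A \<partial>\<nu>)"
  unfolding mix_def using sets_eq_imp_space_eq[of \<nu> borel] by (intro emeasure_bind[OF _ P_kernel]) auto

lemma measurable_emeasure_P: "A \<in> sets seqs \<Longrightarrow> (\<lambda>x. emeasure (P x) A) \<in> borel_measurable borel"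
  by (rule measurable_emeasure_kernel[OF measurable_P_subprob])

text \<open>Deleting the first letter amounts to starting after one step; this converts almost
  invariance of \<open>avg\<close> into almost stationarity of the code.\<close>

lemma markov_op_emeasure_P:
  assumes A: "A \<in> sets seqs"
  shows "markov_op M (\<lambda>y. emeasure (P y) A) x = emeasure (P x) (shift_seq -` A)"
proof -
  have "case_nat a -` shift_seq -` A = A" for a by auto
  then show ?thesis
    unfolding emeasure_P[OF shift_vimage_in_sets[OF A]] markov_op_eq by simp
qed

lemma mix_avg_almost_stationary:
  assumes A: "A \<in> sets seqs"
  shows "\<bar>measure (mix (avg x (Suc n))) (shift_seq -` A) - measure (mix (avg x (Suc n))) A\<bar> \<le> 1 / real (Suc n)"
proof -
  interpret prob_space "mix (avg x (Suc n))"
    by (intro prob_space_mix prob_space_avg sets_avg)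
  note f = measurable_emeasure_P[OF A]
  have le: "emeasure (P y) A \<le> 1" for y by (rule P.measure_le_1)
  have eq: "emeasure (mix (avg x (Suc n))) (shift_seq -` A) = (\<integral>\<^sup>+y. markov_op M (\<lambda>y. emeasure (P y) A) y \<partial>avg x (Suc n))"
    using shift_vimage_in_sets[OF A] by (simp add: emeasure_mix markov_op_emeasure_P[OF A])
  have "emeasure (mix (avg x (Suc n))) (shift_seq -` A) \<le> emeasure (mix (avg x (Suc n))) A + ennreal (1 / real (Suc n))"
    unfolding eq emeasure_mix[OF sets_avg A] by (rule avg_almost_invariant(1)[OF f le]) simp
  moreover have "emeasure (mix (avg x (Suc n))) A \<le> emeasure (mix (avg x (Suc n))) (shift_seq -` A) + ennreal (1 / real (Suc n))"
    unfolding eq emeasure_mix[OF sets_avg A] by (rule avg_almost_invariant(2)[OF f le]) simp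
  ultimately show ?thesis
    by (simp add: emeasure_eq_measure ennreal_plus[symmetric] del: ennreal_plus)
qed

lemma nn_integral_tail_small:
  fixes f :: "'b::countable \<Rightarrow> ennreal"
  assumes fin: "(\<integral>\<^sup>+b. f b \<partial>count_space UNIV) < \<infinity>" and \<epsilon>: "0 < (\<epsilon>::real)"
  shows "\<exists>F. finite F \<and> (\<integral>\<^sup>+b. f b * indicator (- F) b \<partial>count_space UNIV) \<le> ennreal \<epsilon>"
proof -
  let ?I = "\<integral>\<^sup>+b. f b \<partial>count_space UNIV"
  obtain F where F: "finite F" "?I \<le> (\<Sum>b\<in>F. f b) + ennreal \<epsilon>"
  proof (cases "?I \<le> ennreal \<epsilon>")
    case True
    then show ?thesis using that[of "{}"] by simp
  next
    case False
    obtain t where t: "?I = ennreal t" "0 \<le> t" using fin by (cases "?I") auto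
    then have "\<epsilon> < t" using False \<epsilon> by (simp add: not_le ennreal_less_iff)
    then have "ennreal (t - \<epsilon>) < ?I" using \<epsilon> t by (simp add: ennreal_less_iff)
    then obtain F where F: "finite F" "ennreal (t - \<epsilon>) < (\<Sum>b\<in>F. f b)"
      unfolding nn_integral_count_space_SUP[of f] less_SUP_iff by auto
    have "?I = ennreal (t - \<epsilon>) + ennreal \<epsilon>"
      using t(1) \<open>\<epsilon> < t\<close> \<epsilon> by (simp add: ennreal_plus[symmetric] del: ennreal_plus)
    also have "\<dots> \<le> (\<Sum>b\<in>F. f b) + ennreal \<epsilon>" using F(2) by (intro add_right_mono less_imp_le)
    finally show ?thesis using that[OF F(1)] by blast
  qed
  have "(\<integral>\<^sup>+b. f b * indicator (- F) b \<partial>count_space UNIV) + (\<Sum>b\<in>F. f b)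
      = (\<integral>\<^sup>+b. f b * indicator (- F) b \<partial>count_space UNIV) + (\<integral>\<^sup>+b. f b * indicator F b \<partial>count_space UNIV)"
    using F(1) by (simp add: nn_integral_count_space_indicator[symmetric] nn_integral_count_space_finite)
  also have "\<dots> = (\<integral>\<^sup>+b. f b * indicator (- F) b + f b * indicator F b \<partial>count_space UNIV)"
    by (rule nn_integral_add[symmetric]) auto
  also have "\<dots> = ?I"
    by (intro nn_integral_cong) (auto simp: indicator_def)
  finally have "(\<Sum>b\<in>F. f b) + (\<integral>\<^sup>+b. f b * indicator (- F) b \<partial>count_space UNIV) \<le> (\<Sum>b\<in>F. f b) + ennreal \<epsilon>"
    using F(2) by (simp add: add.commute)
  moreover have "(\<Sum>b\<in>F. f b) \<noteq> \<infinity>"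
    using sum_le_nn_integral_count_space[OF F(1), of f] fin by (auto simp: top_unique)
  ultimately show ?thesis
    using F(1) unfolding ennreal_add_left_cancel_le by blast
qed

text \<open>Translates the tightness in the definition of a generating point into a bound on the
  averaged law, by additivity over the countably many vertex sets.\<close>

lemma emeasure_avg_vertices:
  assumes n: "1 \<le> n"
  shows "emeasure (avg x n) (\<Union>j\<in>J. vert M j) = emeasure (occupation_measure M x n) J"
proof -
  have disj: "disjoint_family_on (vert M) J"
    using M by (auto simp: markov_system_def disjoint_family_on_def)
  have J: "countable J" using countable_vertices by (rule countable_subset[rotated]) simp
  have "emeasure (avg x n) (\<Union>j\<in>J. vert M j) = (\<integral>\<^sup>+j. emeasure (avg x n) (vert M j) \<partial>count_space J)"
    using J disj by (intro emeasure_UN_countable) auto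
  also have "\<dots> = (\<integral>\<^sup>+j. (\<Sum>k=1..n. emeasure (law x k) (vert M j)) / of_nat n \<partial>count_space J)"
    using nn_integral_avg[OF borel_measurable_indicator[OF vert_borel] n, of x]
    by (intro nn_integral_cong) simp
  also have "\<dots> = (\<integral>\<^sup>+j. (\<Sum>k=1..n. emeasure (law x k) (vert M j)) / of_nat n * indicator J j \<partial>count_space UNIV)"
    by (simp add: nn_integral_count_space_indicator)
  also have "\<dots> = emeasure (occupation_measure M x n) J"
    unfolding occupation_measure_def point_measure_def law_def[symmetric]
    by (subst emeasure_density) auto
  finally show ?thesis .
qed

text \<open>Half of \<epsilon> pays for starting outside the finite vertex set \<open>V\<close>. For
  each vertex of \<open>V\<close>, the summable suprema of the edge probabilities leave, outside a
  finite edge set, a tail of at most the other half, uniformly over the points of its vertex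
  set.\<close>

lemma mix_avg_tight:
  assumes dom: "dominating_markov_chain M" and gen: "generating_point M x" and \<epsilon>: "0 < (\<epsilon>::real)"
  shows "\<exists>F. finite F \<and> (\<forall>n. measure (mix (avg x (Suc n))) {\<sigma>. \<sigma> 0 \<notin> F} \<le> \<epsilon>)"
proof -
  obtain V where V: "finite V"
    "\<And>n. 1 \<le> n \<Longrightarrow> emeasure (occupation_measure M x n) (UNIV - V) < ennreal (\<epsilon> / 2)"
    using gen \<epsilon> unfolding generating_point_def by (meson half_gt_zero)
  define s where "s j e = (if src M e = j then SUP x\<in>vert M j. ennreal (prb M e x) else 0)" for j e
  have s_fin: "(\<integral>\<^sup>+e. s j e \<partial>count_space UNIV) < \<infinity>" for j
  proof -
    have "(\<integral>\<^sup>+e. s j e \<partial>count_space UNIV) = (\<Sum>\<^sub>\<infinity>e\<in>{e. src M e = j}. s j e)"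
      by (rule infsum_src_eq[symmetric]) (simp add: s_def)
    also have "\<dots> = (\<Sum>\<^sub>\<infinity>e\<in>{e. src M e = j}. SUP x\<in>vert M j. ennreal (prb M e x))"
      by (intro infsum_cong) (simp add: s_def)
    also have "\<dots> < \<infinity>" using dom by (simp add: dominating_markov_chain_def)
    finally show ?thesis .
  qed
  have "\<exists>F. finite F \<and> (\<integral>\<^sup>+e. s j e * indicator (- F) e \<partial>count_space UNIV) \<le> ennreal (\<epsilon> / 2)" for j
    using s_fin \<epsilon> by (intro nn_integral_tail_small) auto
  then obtain G where G: "\<And>j. finite (G j)"
    "\<And>j. (\<integral>\<^sup>+e. s j e * indicator (- G j) e \<partial>count_space UNIV) \<le> ennreal (\<epsilon> / 2)"
    by metis
  define F where "F = Some ` (\<Union>j\<in>V. G j)"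
  have F: "finite F" using V(1) G(1) by (simp add: F_def)
  have A: "{\<sigma>. \<sigma> 0 \<notin> F} \<in> sets (seqs :: (nat \<Rightarrow> 'e option) measure)"
    using coordinate_in_sets[of 0 "- F"] by simp
  define W where "W = (\<Union>j\<in>UNIV - V. vert M j)"
  have W: "W \<in> sets borel"
    unfolding W_def using countable_vertices by (intro sets.countable_UN') (auto intro: countable_subset)
  have P_le: "emeasure (P y) {\<sigma>. \<sigma> 0 \<notin> F} \<le> ennreal (\<epsilon> / 2) + indicator W y" for y
  proof (cases "y \<in> W")
    case True
    then show ?thesis using P.measure_le_1[of y "{\<sigma>. \<sigma> 0 \<notin> F}"] by (simp add: add_increasing)
  next
    case False
    obtain j where j: "y \<in> vert M j" using ex_vert by blast
    then have jV: "j \<in> V" using False by (auto simp: W_def)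
    have "emeasure (P y) {\<sigma>. \<sigma> 0 \<notin> F}
        = (\<integral>\<^sup>+a. ennreal (prbbar M a y) * emeasure (P (wbar M a y)) (case_nat a -` {\<sigma>. \<sigma> 0 \<notin> F}) \<partial>count_space UNIV)"
      by (rule emeasure_P[OF A])
    also have "\<dots> = (\<integral>\<^sup>+e. ennreal (prb M e y) * emeasure (P (wmap M e y)) (case_nat (Some e) -` {\<sigma>. \<sigma> 0 \<notin> F}) \<partial>count_space UNIV)"
      by (subst nn_integral_count_space_option) simp_all
    also have "\<dots> \<le> (\<integral>\<^sup>+e. s j e * indicator (- G j) e \<partial>count_space UNIV)"
    proof (rule nn_integral_mono)
      fix e
      show "ennreal (prb M e y) * emeasure (P (wmap M e y)) (case_nat (Some e) -` {\<sigma>. \<sigma> 0 \<notin> F}) \<le> s j e * indicator (- G j) e"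
      proof (cases "Some e \<in> F \<or> src M e \<noteq> j")
        case True
        then show ?thesis using prb_eq_0[OF j, of e] by auto
      next
        case False
        then have "e \<notin> G j" using jV by (auto simp: F_def)
        have "ennreal (prb M e y) * emeasure (P (wmap M e y)) (case_nat (Some e) -` {\<sigma>. \<sigma> 0 \<notin> F}) \<le> ennreal (prb M e y) * 1"
          by (intro mult_left_mono P.measure_le_1) simp
        also have "\<dots> \<le> s j e" using False j by (auto simp: s_def intro: SUP_upper)
        finally show ?thesis using \<open>e \<notin> G j\<close> by simp
      qed
    qed
    also have "\<dots> \<le> ennreal (\<epsilon> / 2)" by (rule G(2))
    finally show ?thesis using False by simp
  qed
  have "measure (mix (avg x (Suc n))) {\<sigma>. \<sigma> 0 \<notin> F} \<le> \<epsilon>" for n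
  proof -
    interpret A: prob_space "avg x (Suc n)" by (rule prob_space_avg)
    interpret mix: prob_space "mix (avg x (Suc n))"
      by (intro prob_space_mix prob_space_avg sets_avg)
    have ind: "indicator W \<in> borel_measurable (avg x (Suc n))"
      using W by (intro borel_measurable_indicator) simp
    have "emeasure (mix (avg x (Suc n))) {\<sigma>. \<sigma> 0 \<notin> F} \<le> (\<integral>\<^sup>+y. ennreal (\<epsilon> / 2) + indicator W y \<partial>avg x (Suc n))"
      unfolding emeasure_mix[OF sets_avg A] by (intro nn_integral_mono P_le)
    also have "\<dots> = (\<integral>\<^sup>+y. ennreal (\<epsilon> / 2) \<partial>avg x (Suc n)) + (\<integral>\<^sup>+y. indicator W y \<partial>avg x (Suc n))"
      by (rule nn_integral_add[OF borel_measurable_const ind])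
    also have "(\<integral>\<^sup>+y. ennreal (\<epsilon> / 2) \<partial>avg x (Suc n)) = ennreal (\<epsilon> / 2)"
      by (simp only: nn_integral_const A.emeasure_space_1 mult_1_right)
    also have "(\<integral>\<^sup>+y. indicator W y \<partial>avg x (Suc n)) = emeasure (avg x (Suc n)) W"
      by (rule nn_integral_indicator) (simp only: sets_avg W)
    also have "ennreal (\<epsilon> / 2) + emeasure (avg x (Suc n)) W \<le> ennreal (\<epsilon> / 2) + ennreal (\<epsilon> / 2)"
      unfolding W_def using V(2)[of "Suc n"]
      by (subst emeasure_avg_vertices) (auto intro!: add_left_mono less_imp_le)
    also have "\<dots> = ennreal \<epsilon>" using \<epsilon> by (simp add: ennreal_plus[symmetric] del: ennreal_plus)
    finally show ?thesis using \<epsilon> by (simp add: mix.emeasure_eq_measure)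
  qed
  then show ?thesis using F by blast
qed

text \<open>A step of positive weight follows an edge, and no edge leaves an essential
  class.\<close>

lemma AE_law_class:
  assumes c: "c \<in> essential_classes M" and x: "x \<in> class_union M c"
  shows "AE y in law x k. y \<in> class_union M c"
proof -
  define C where "C = class_union M c"
  have C: "C \<in> sets borel"
    unfolding C_def class_union_def using countable_vertices by (intro sets.countable_UN') (auto intro: countable_subset)
  have C': "- C \<in> sets borel" using C by simp
  have step: "wbar M a y \<in> C" if "y \<in> C" "0 < prbbar M a y" for a y
  proof (cases a)
    case (Some e)
    obtain j where j: "j \<in> c" "y \<in> vert M j" using \<open>y \<in> C\<close> by (auto simp: C_def class_union_def)
    have y: "y \<in> vert M (src M e)" using that Some by (intro prb_pos_vert) simp
    then have "src M e = j" using j vert_unique by blast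
    then have "tgt M e \<in> c" using essential_class_closed[OF c j(1)] accessible_edge by metis
    then show ?thesis using vert_tgt[OF y] Some by (auto simp: C_def class_union_def)
  qed (use that in simp)
  have AE_iff: "(AE y in law x k. y \<in> C) \<longleftrightarrow> emeasure (law x k) (- C) = 0" for k
    using C C' AE_iff_measurable[of "- C" "law x k" "\<lambda>y. y \<in> C"] by (auto simp: Compl_eq)
  have "emeasure (law x k) (- C) = 0"
  proof (induction k)
    case 0
    then show ?case using x C' by (simp add: law_def C_def)
  next
    case (Suc k)
    have "emeasure (law x (Suc k)) (- C) = (\<integral>\<^sup>+y. indicator (- C) y \<partial>law x (Suc k))"
      using C' by (intro nn_integral_indicator[symmetric]) simp
    also have "\<dots> = (\<integral>\<^sup>+y. markov_op M (indicator (- C)) y \<partial>law x k)"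
      using C' by (intro nn_integral_law_Suc borel_measurable_indicator)
    also have "\<dots> = (\<integral>\<^sup>+y. 0 \<partial>law x k)"
    proof (rule nn_integral_cong_AE)
      show "AE y in law x k. markov_op M (indicator (- C)) y = 0"
        using Suc[folded AE_iff]
      proof eventually_elim
        case (elim y)
        have "ennreal (prbbar M a y) * indicator (- C) (wbar M a y) = 0" for a
          using step[of y a] elim prbbar_nonneg[of a y] by (cases "prbbar M a y = 0") (auto simp: less_le)
        then show ?case unfolding markov_op_eq nn_integral_count_space_eq_0 by blast
      qed
    qed
    finally show ?case by simp
  qed
  then have "AE y in law x k. y \<in> C" by (simp only: AE_iff)
  then show ?thesis by (simp only: C_def)
qed

end

section \<open>Stationary limits for contractive systems\<close>

locale contractive_markov = markov M
  for M :: "('a::complete_space, 'v, 'e::countable) markov_sys" +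
  fixes pt :: "'v \<Rightarrow> 'a" and v :: 'v and a b :: real
  assumes pt: "pt j \<in> vert M j"
    and a: "0 < a" "a < 1" and b: "0 \<le> b"
    and con: "x \<in> vert M j \<Longrightarrow> y \<in> vert M j \<Longrightarrow>
      (\<Sum>\<^sub>\<infinity>e\<in>{e. src M e = j}. ennreal (prb M e x * dist (wmap M e x) (wmap M e y))) \<le> ennreal (a * dist x y)"
    and disp: "x \<in> vert M j \<Longrightarrow>
      (\<Sum>\<^sub>\<infinity>e\<in>{e. src M e = j}. ennreal (prb M e x * dist (wmap M e (pt (src M e))) (pt (tgt M e)))) \<le> ennreal b"
    and uc: "uniformly_continuous_system M"
begin

section \<open>Drift towards the reference points\<close>

definition vtx :: "'a \<Rightarrow> 'v" where
  "vtx x = (THE j. x \<in> vert M j)"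

lemma vtx_eq: "x \<in> vert M j \<Longrightarrow> vtx x = j"
  unfolding vtx_def using vert_unique by blast

lemma in_vtx: "x \<in> vert M (vtx x)"
  using ex_vert[of x] vtx_eq by blast

text \<open>The Lyapunov function of the process: the distance to the reference point of the vertex
  set containing \<open>x\<close>.\<close>

definition height :: "'a \<Rightarrow> real" where
  "height x = dist x (pt (vtx x))"

lemma measurable_height: "(\<lambda>x. ennreal (height x)) \<in> borel_measurable borel"
proof -
  have "vtx -` {j} \<inter> space borel = vert M j" for j
    using vtx_eq in_vtx by (auto simp: set_eq_iff)
  then have v: "vtx \<in> measurable borel (count_space UNIV)"
    using countable_vertices by (subst measurable_count_space_eq_countable) auto
  have d: "(\<lambda>x. ennreal (dist x (pt j))) \<in> borel_measurable borel" for j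
  proof -
    have "(\<lambda>x. dist x (pt j)) \<in> borel_measurable borel"
      by (intro borel_measurable_continuous_onI continuous_intros)
    then show ?thesis by (rule measurable_compose[OF _ measurable_ennreal])
  qed
  show ?thesis
    unfolding height_def by (rule measurable_compose_countable'[OF d v countable_vertices])
qed

text \<open>Triangle inequality through the image of the reference point: the first leg is
  contracted on average by \<open>a\<close>, the second is the displacement bounded by
  \<open>b\<close>.\<close>

lemma markov_op_height: "markov_op M (\<lambda>x. ennreal (height x)) x \<le> ennreal (a * height x + b)"
proof -
  let ?j = "vtx x" and ?y = "pt (vtx x)"
  have x: "x \<in> vert M ?j" by (rule in_vtx)
  let ?s = "\<lambda>e. ennreal (prb M e x * dist (wmap M e x) (wmap M e ?y))"
  let ?t = "\<lambda>e. ennreal (prb M e x * dist (wmap M e (pt (src M e))) (pt (tgt M e)))"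
  have "markov_op M (\<lambda>x. ennreal (height x)) x
      = (\<integral>\<^sup>+e. ennreal (prb M e x) * ennreal (height (wmap M e x)) \<partial>count_space UNIV)"
    by (simp add: markov_op_def infsum_ennreal_eq_nn_integral)
  also have "\<dots> \<le> (\<integral>\<^sup>+e. ?s e + ?t e \<partial>count_space UNIV)"
  proof (rule nn_integral_mono)
    fix e
    show "ennreal (prb M e x) * ennreal (height (wmap M e x)) \<le> ?s e + ?t e"
    proof (cases "prb M e x = 0")
      case False
      then have src: "src M e = ?j" using prb_eq_0[OF x] by blast
      then have "vtx (wmap M e x) = tgt M e" using x vert_tgt by (metis vtx_eq)
      then have "height (wmap M e x) \<le> dist (wmap M e x) (wmap M e ?y) + dist (wmap M e (pt (src M e))) (pt (tgt M e))"
        unfolding height_def src using dist_triangle by metis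
      then have "prb M e x * height (wmap M e x)
          \<le> prb M e x * dist (wmap M e x) (wmap M e ?y) + prb M e x * dist (wmap M e (pt (src M e))) (pt (tgt M e))"
        unfolding distrib_left[symmetric] by (rule mult_left_mono) simp
      then show ?thesis
        by (simp add: ennreal_mult[symmetric] height_def ennreal_plus[symmetric] del: ennreal_plus)
    qed simp
  qed
  also have "\<dots> = (\<integral>\<^sup>+e. ?s e \<partial>count_space UNIV) + (\<integral>\<^sup>+e. ?t e \<partial>count_space UNIV)"
    by (rule nn_integral_add) auto
  also have "(\<integral>\<^sup>+e. ?s e \<partial>count_space UNIV) \<le> ennreal (a * height x)"
    using con[OF x pt] prb_eq_0[OF x] by (simp add: infsum_src_eq height_def)
  also have "(\<integral>\<^sup>+e. ?t e \<partial>count_space UNIV) \<le> ennreal b"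
    using disp[OF x] prb_eq_0[OF x] by (simp add: infsum_src_eq)
  also have "ennreal (a * height x) + ennreal b = ennreal (a * height x + b)"
    using a b by (simp add: height_def)
  finally show ?thesis by (simp add: add_mono)
qed

text \<open>The drift inequality \<open>U height \<le> a * height + b\<close> bounds the expected height uniformly along the
  process by the following value.\<close>

definition height_bound :: "'a \<Rightarrow> real" where
  "height_bound x = height x + b / (1 - a)"

text \<open>The constant \<open>b / (1 - a)\<close> is the fixed point of
  \<open>t \<mapsto> a * t + b\<close>; adding the initial height keeps the bound stable under the
  drift.\<close>

lemma height_bound: "0 \<le> height_bound x" "height x \<le> height_bound x" "a * height_bound x + b \<le> height_bound x"
proof -
  have h: "0 \<le> height x" by (simp add: height_def)
  have q: "0 \<le> b / (1 - a)" using a b by simp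
  show "0 \<le> height_bound x" "height x \<le> height_bound x" using h q by (simp_all add: height_bound_def)
  define q where "q = b / (1 - a)"
  have "(1 - a) * q = b" using a by (simp add: q_def)
  then have "a * (b / (1 - a)) + b = b / (1 - a)" unfolding q_def[symmetric] by (simp add: algebra_simps)
  moreover have "a * height x \<le> height x" using a h by (intro mult_left_le_one_le) auto
  ultimately show "a * height_bound x + b \<le> height_bound x"
    unfolding height_bound_def by (simp add: distrib_left)
qed

lemma nn_integral_height_step:
  assumes sets: "sets \<nu> = sets borel" and prob: "prob_space \<nu>"
    and le: "(\<integral>\<^sup>+y. ennreal (height y) \<partial>\<nu>) \<le> ennreal (height_bound x)"
  shows "(\<integral>\<^sup>+y. markov_op M (\<lambda>x. ennreal (height x)) y \<partial>\<nu>) \<le> ennreal (height_bound x)"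
proof -
  interpret prob_space \<nu> by fact
  have h: "(\<lambda>x. ennreal (height x)) \<in> borel_measurable \<nu>"
    using measurable_height by (simp only: measurable_cong_sets[OF sets refl])
  have "(\<integral>\<^sup>+y. markov_op M (\<lambda>x. ennreal (height x)) y \<partial>\<nu>) \<le> (\<integral>\<^sup>+y. ennreal a * ennreal (height y) + ennreal b \<partial>\<nu>)"
    using markov_op_height a b
    by (intro nn_integral_mono) (simp add: ennreal_mult[symmetric] height_def ennreal_plus[symmetric] del: ennreal_plus)
  also have "\<dots> = ennreal a * (\<integral>\<^sup>+y. ennreal (height y) \<partial>\<nu>) + ennreal b"
    using h by (simp add: nn_integral_add nn_integral_cmult emeasure_space_1)
  also have "\<dots> \<le> ennreal a * ennreal (height_bound x) + ennreal b"
    using le by (intro add_right_mono mult_left_mono) auto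
  also have "\<dots> = ennreal (a * height_bound x + b)"
    using a b height_bound(1)[of x] by (simp add: ennreal_mult)
  also have "\<dots> \<le> ennreal (height_bound x)" by (intro ennreal_leI height_bound)
  finally show ?thesis .
qed

lemma nn_integral_height_law: "(\<integral>\<^sup>+y. ennreal (height y) \<partial>law x k) \<le> ennreal (height_bound x)"
proof (induction k)
  case 0
  have "(\<integral>\<^sup>+y. ennreal (height y) \<partial>law x 0) = ennreal (height x)"
    unfolding law_def using measurable_height by (simp add: nn_integral_return)
  then show ?case using height_bound(2)[of x] by (simp add: ennreal_leI)
next
  case (Suc k)
  show ?case
    unfolding nn_integral_law_Suc[OF measurable_height]
    by (rule nn_integral_height_step[OF sets_law prob_space_law Suc])
qed

lemma nn_integral_height_avg: "(\<integral>\<^sup>+y. ennreal (height y) \<partial>avg x (Suc n)) \<le> ennreal (height_bound x)"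
proof -
  have "(\<integral>\<^sup>+y. ennreal (height y) \<partial>avg x (Suc n)) = (\<Sum>k=1..Suc n. \<integral>\<^sup>+y. ennreal (height y) \<partial>law x k) / of_nat (Suc n)"
    by (rule nn_integral_avg[OF measurable_height]) simp
  also have "\<dots> \<le> (\<Sum>k=1..Suc n. ennreal (height_bound x)) / of_nat (Suc n)"
    by (intro divide_right_mono_ennreal sum_mono nn_integral_height_law)
  also have "\<dots> = ennreal (height_bound x) * (of_nat (Suc n) / of_nat (Suc n))"
    by (simp add: ennreal_times_divide mult.commute)
  also have "of_nat (Suc n) / of_nat (Suc n) = (1::ennreal)"
    by (intro ennreal_divide_self) (simp_all add: ennreal_of_nat_eq_real_of_nat)
  finally show ?thesis by simp
qed

text \<open>A substitute for the starting point that can be read off the code: almost surely it is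
  the reference point of the vertex set of the true one.\<close>

abbreviation start :: "(nat \<Rightarrow> 'e option) \<Rightarrow> 'a" where
  "start \<tau> \<equiv> pt (srcbar M v (\<tau> 0))"

lemma orb_Suc_shift: "orb \<tau> (Suc n) x = orb (shift_seq \<tau>) n (wbar M (\<tau> 0) x)"
  by (induction n) (simp_all add: orb_Suc)

lemma AE_start: "AE \<tau> in P x. start \<tau> = pt (vtx x)"
  using AE_cyl_prob_pos[of x]
proof eventually_elim
  case (elim \<tau>)
  from elim[rule_format, of 1] have "0 < prbbar M (\<tau> 0) x" by simp
  then show ?case using prb_pos_vert vtx_eq by (cases "\<tau> 0") force+
qed

lemma measurable_dist_start:
  "(\<lambda>\<tau>. ennreal (dist (orb \<tau> L x) (orb \<tau> L (start \<tau>)))) \<in> borel_measurable seqs"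
  by (rule measurable_compose_countable[where g = "\<lambda>\<tau>. \<tau> 0" and
        f = "\<lambda>s \<tau>. ennreal (dist (orb \<tau> L x) (orb \<tau> L (pt (srcbar M v s))))"])
     (rule measurable_compose[OF borel_measurable_dist_orb measurable_ennreal] measurable_seqs_component)+

text \<open>The price of forgetting the starting point: both orbits use the same letters and begin
  in one vertex set, so the contraction estimate applies.\<close>

lemma nn_integral_dist_start:
  "(\<integral>\<^sup>+\<tau>. ennreal (dist (orb \<tau> L x) (orb \<tau> L (start \<tau>))) \<partial>P x) \<le> ennreal (a ^ L * height x)"
proof -
  have "(\<integral>\<^sup>+\<tau>. ennreal (dist (orb \<tau> L x) (orb \<tau> L (start \<tau>))) \<partial>P x)
      = (\<integral>\<^sup>+\<tau>. ennreal (dist (orb \<tau> L x) (orb \<tau> L (pt (vtx x)))) \<partial>P x)"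
    using AE_start[of x] by (intro nn_integral_cong_AE) (auto elim: eventually_mono)
  also have "\<dots> \<le> ennreal (a ^ L * height x)"
    unfolding height_def by (rule nn_integral_dist_orb[where j = "vtx x"]) (use con a in_vtx pt in auto)
  finally show ?thesis .
qed

text \<open>Read in the window from \<open>-L\<close>, \<open>gap L\<close> is the distance between the approximations of the coding
  point from the \<open>L\<close> and the \<open>L + 1\<close> most recent letters.\<close>

definition gap :: "nat \<Rightarrow> (nat \<Rightarrow> 'e option) \<Rightarrow> real" where
  "gap L \<tau> = dist (orb (shift_seq \<tau>) L (start (shift_seq \<tau>))) (orb \<tau> (Suc L) (start \<tau>))"

text \<open>Both approximations are compared with the true orbit of \<open>x\<close>. The shorter
  one starts from the point after one step, whose mean height is \<open>U height\<close>; the longer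
  one gains a factor \<open>a\<close>, which is dropped. The two terms later produce the constant
  \<open>2 * height_bound x\<close>.\<close>

lemma nn_integral_gap_P:
  "(\<integral>\<^sup>+\<tau>. ennreal (gap L \<tau>) \<partial>P x)
    \<le> ennreal (a ^ L) * markov_op M (\<lambda>x. ennreal (height x)) x + ennreal (a ^ L) * ennreal (height x)"
proof -
  let ?f = "\<lambda>s \<tau>. ennreal (dist (orb \<tau> L (wbar M s x)) (orb \<tau> L (start \<tau>)))"
  let ?g = "\<lambda>\<tau>. ennreal (dist (orb \<tau> (Suc L) x) (orb \<tau> (Suc L) (start \<tau>)))"
  have f: "(\<lambda>\<tau>. ?f (\<tau> 0) (shift_seq \<tau>)) \<in> borel_measurable seqs"
    by (rule measurable_compose_countable[where g = "\<lambda>\<tau>. \<tau> 0" and f = "\<lambda>s \<tau>. ?f s (shift_seq \<tau>)"])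
       (rule measurable_compose[OF measurable_shift_seqs measurable_dist_start] measurable_seqs_component)+
  have "(\<integral>\<^sup>+\<tau>. ennreal (gap L \<tau>) \<partial>P x) \<le> (\<integral>\<^sup>+\<tau>. ?f (\<tau> 0) (shift_seq \<tau>) + ?g \<tau> \<partial>P x)"
  proof (rule nn_integral_mono)
    fix \<tau>
    have "gap L \<tau> \<le> dist (orb (shift_seq \<tau>) L (wbar M (\<tau> 0) x)) (orb (shift_seq \<tau>) L (start (shift_seq \<tau>)))
        + dist (orb \<tau> (Suc L) x) (orb \<tau> (Suc L) (start \<tau>))"
      unfolding gap_def orb_Suc_shift[of \<tau> L x] by (metis dist_commute dist_triangle)
    then have "ennreal (gap L \<tau>) \<le> ennreal (dist (orb (shift_seq \<tau>) L (wbar M (\<tau> 0) x)) (orb (shift_seq \<tau>) L (start (shift_seq \<tau>)))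
        + dist (orb \<tau> (Suc L) x) (orb \<tau> (Suc L) (start \<tau>)))" by (rule ennreal_leI)
    then show "ennreal (gap L \<tau>) \<le> ?f (\<tau> 0) (shift_seq \<tau>) + ?g \<tau>" by simp
  qed
  also have "\<dots> = (\<integral>\<^sup>+\<tau>. ?f (\<tau> 0) (shift_seq \<tau>) \<partial>P x) + (\<integral>\<^sup>+\<tau>. ?g \<tau> \<partial>P x)"
    by (rule nn_integral_add) (simp_all only: measurable_cong_sets[OF sets_P refl] f measurable_dist_start)
  also have "(\<integral>\<^sup>+\<tau>. ?f (\<tau> 0) (shift_seq \<tau>) \<partial>P x)
      = (\<integral>\<^sup>+s. ennreal (prbbar M s x) * (\<integral>\<^sup>+\<tau>. ?f s \<tau> \<partial>P (wbar M s x)) \<partial>count_space UNIV)"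
    by (rule nn_integral_P_skew[OF measurable_dist_start])
  also have "\<dots> \<le> (\<integral>\<^sup>+s. ennreal (a ^ L) * (ennreal (prbbar M s x) * ennreal (height (wbar M s x))) \<partial>count_space UNIV)"
  proof (rule nn_integral_mono)
    fix s
    have "ennreal (prbbar M s x) * (\<integral>\<^sup>+\<tau>. ?f s \<tau> \<partial>P (wbar M s x))
        \<le> ennreal (prbbar M s x) * ennreal (a ^ L * height (wbar M s x))"
      by (intro mult_left_mono nn_integral_dist_start) simp
    also have "\<dots> = ennreal (a ^ L) * (ennreal (prbbar M s x) * ennreal (height (wbar M s x)))"
      using a by (simp add: ennreal_mult height_def mult.left_commute)
    finally show "ennreal (prbbar M s x) * (\<integral>\<^sup>+\<tau>. ?f s \<tau> \<partial>P (wbar M s x))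
        \<le> ennreal (a ^ L) * (ennreal (prbbar M s x) * ennreal (height (wbar M s x)))" .
  qed
  also have "\<dots> = ennreal (a ^ L) * markov_op M (\<lambda>x. ennreal (height x)) x"
    by (simp add: nn_integral_cmult markov_op_eq)
  also have "(\<integral>\<^sup>+\<tau>. ?g \<tau> \<partial>P x) \<le> ennreal (a ^ Suc L * height x)"
    by (rule nn_integral_dist_start)
  also have "\<dots> \<le> ennreal (a ^ L * height x)"
    using a by (intro ennreal_leI mult_right_mono) (simp_all add: height_def mult_left_le_one_le)
  also have "\<dots> = ennreal (a ^ L) * ennreal (height x)"
    using a by (simp add: ennreal_mult height_def)
  finally show ?thesis by (simp add: add_mono)
qed

text \<open>Displays \<open>gap\<close> as a function of a word, for measurability and for the
  passage to limits. The word has length \<open>L + 2\<close> because for \<open>L = 0\<close> the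
  shifted sequence still reads its start from the second letter.\<close>

lemma gap_prefix: "gap L \<tau> = dist (fold (wbar M) (take L (tl (map \<tau> [0..<Suc (Suc L)]))) (pt (srcbar M v (map \<tau> [0..<Suc (Suc L)] ! 1))))
    (fold (wbar M) (take (Suc L) (map \<tau> [0..<Suc (Suc L)])) (pt (srcbar M v (map \<tau> [0..<Suc (Suc L)] ! 0))))"
proof -
  have "tl (map \<tau> [0..<Suc (Suc L)]) = map (shift_seq \<tau>) [0..<Suc L]"
    by (intro nth_equalityI) (simp_all add: nth_tl del: upt_Suc)
  then have 1: "take L (tl (map \<tau> [0..<Suc (Suc L)])) = map (shift_seq \<tau>) [0..<L]"
    by (simp add: take_map)
  have 2: "take (Suc L) (map \<tau> [0..<Suc (Suc L)]) = map \<tau> [0..<Suc L]"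
    by (simp add: take_map del: upt_Suc)
  have 3: "map \<tau> [0..<Suc (Suc L)] ! 1 = \<tau> 1" "map \<tau> [0..<Suc (Suc L)] ! 0 = \<tau> 0"
    by (subst nth_map; simp del: upt_Suc)+
  show ?thesis unfolding gap_def orb_def 1 2 3 by simp
qed

lemma measurable_gap: "gap L \<in> borel_measurable seqs"
  unfolding gap_prefix[abs_def] by (rule measurable_prefix)

lemma nn_integral_gap_mix:
  "(\<integral>\<^sup>+\<tau>. ennreal (gap L \<tau>) \<partial>mix (avg x (Suc n))) \<le> ennreal (2 * height_bound x * a ^ L)"
proof -
  let ?\<nu> = "avg x (Suc n)"
  have h: "(\<lambda>x. ennreal (height x)) \<in> borel_measurable ?\<nu>"
    and Uh: "markov_op M (\<lambda>x. ennreal (height x)) \<in> borel_measurable ?\<nu>"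
    using measurable_height measurable_markov_op[OF measurable_height]
    by (simp_all only: measurable_cong_sets[OF sets_avg refl])
  have "(\<integral>\<^sup>+\<tau>. ennreal (gap L \<tau>) \<partial>mix ?\<nu>) = (\<integral>\<^sup>+x. \<integral>\<^sup>+\<tau>. ennreal (gap L \<tau>) \<partial>P x \<partial>?\<nu>)"
    by (rule nn_integral_mix[OF sets_avg measurable_compose[OF measurable_gap measurable_ennreal]])
  also have "\<dots> \<le> (\<integral>\<^sup>+x. ennreal (a ^ L) * markov_op M (\<lambda>x. ennreal (height x)) x + ennreal (a ^ L) * ennreal (height x) \<partial>?\<nu>)"
    by (intro nn_integral_mono nn_integral_gap_P)
  also have "\<dots> = ennreal (a ^ L) * (\<integral>\<^sup>+x. markov_op M (\<lambda>x. ennreal (height x)) x \<partial>?\<nu>)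
      + ennreal (a ^ L) * (\<integral>\<^sup>+x. ennreal (height x) \<partial>?\<nu>)"
    using h Uh by (simp add: nn_integral_add nn_integral_cmult)
  also have "\<dots> \<le> ennreal (a ^ L) * ennreal (height_bound x) + ennreal (a ^ L) * ennreal (height_bound x)"
    by (intro add_mono mult_left_mono nn_integral_height_avg nn_integral_height_step sets_avg prob_space_avg) auto
  also have "\<dots> = ennreal (2 * height_bound x * a ^ L)"
    using a height_bound(1)[of x]
    by (simp add: ennreal_mult[symmetric] ennreal_plus[symmetric] mult_ac del: ennreal_plus)
  finally show ?thesis .
qed

section \<open>The Markov property at a fixed time and its approximation by the code\<close>

lemma emeasure_P_transition:
  "emeasure (P x) {\<tau>. map \<tau> [0..<L] \<in> X \<and> \<tau> L = s}
    = (\<integral>\<^sup>+\<tau>. indicator X (map \<tau> [0..<L]) * ennreal (prbbar M s (orb \<tau> L x)) \<partial>P x)"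
proof -
  let ?X = "{w. length w = L \<and> w \<in> X}"
  have un: "{\<tau>. map \<tau> [0..<L] \<in> X \<and> \<tau> L = s} = (\<Union>w\<in>?X. cylinder (w @ [s]))"
    by (auto simp: cylinder_snoc mem_cylinder_iff)
  have disj: "disjoint_family_on (\<lambda>w. cylinder (w @ [s])) ?X"
    by (auto simp: disjoint_family_on_def cylinder_snoc mem_cylinder_iff)
  have "emeasure (P x) {\<tau>. map \<tau> [0..<L] \<in> X \<and> \<tau> L = s}
      = (\<integral>\<^sup>+w. emeasure (P x) (cylinder (w @ [s])) \<partial>count_space ?X)"
    unfolding un using disj by (intro emeasure_UN_countable) auto
  also have "\<dots> = (\<integral>\<^sup>+w. ennreal (cyl_prob M w x * prbbar M s (fold (wbar M) w x)) * indicator ?X w \<partial>count_space UNIV)"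
    by (simp add: emeasure_P_cylinder cyl_prob_snoc nn_integral_count_space_indicator)
  also have "\<dots> = (\<integral>\<^sup>+w. (indicator X w * ennreal (prbbar M s (fold (wbar M) w x)) * emeasure (P x) (cylinder w)) * indicator {w. length w = L} w \<partial>count_space UNIV)"
    by (intro nn_integral_cong) (auto simp: indicator_def emeasure_P_cylinder ennreal_mult mult_ac)
  also have "\<dots> = (\<integral>\<^sup>+w. indicator X w * ennreal (prbbar M s (fold (wbar M) w x)) * emeasure (P x) (cylinder w) \<partial>count_space {w. length w = L})"
    by (simp add: nn_integral_count_space_indicator)
  also have "\<dots> = (\<integral>\<^sup>+\<tau>. indicator X (map \<tau> [0..<L]) * ennreal (prbbar M s (orb \<tau> L x)) \<partial>P x)"
    unfolding orb_def
    by (rule nn_integral_prefix[OF sets_P, symmetric, where h = "\<lambda>w. indicator X w * ennreal (prbbar M s (fold (wbar M) w x))"])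
  finally show ?thesis .
qed

lemma AE_same_vertex:
  assumes "x \<in> vert M j" "y \<in> vert M j"
  shows "AE \<tau> in P x. \<forall>L. \<exists>k. orb \<tau> L x \<in> vert M k \<and> orb \<tau> L y \<in> vert M k"
  using AE_cyl_prob_pos[of x]
proof eventually_elim
  case (elim \<tau>)
  show ?case
  proof
    fix L
    show "\<exists>k. orb \<tau> L x \<in> vert M k \<and> orb \<tau> L y \<in> vert M k"
    proof (induction L)
      case (Suc L)
      then obtain k where k: "orb \<tau> L x \<in> vert M k" "orb \<tau> L y \<in> vert M k" by blast
      have "0 < cyl_prob M (map \<tau> [0..<L] @ [\<tau> L]) x" using elim[rule_format, of "Suc L"] by simp
      then have "0 < prbbar M (\<tau> L) (orb \<tau> L x)"
        using cyl_prob_nonneg[of "map \<tau> [0..<L]" x] by (simp add: cyl_prob_snoc orb_def zero_less_mult_iff)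
      then obtain k' where "wbar M (\<tau> L) (orb \<tau> L x) \<in> vert M k'" "wbar M (\<tau> L) (orb \<tau> L y) \<in> vert M k'"
        using k by (rule same_vertex_step)
      then show ?case by (auto simp: orb_Suc)
    qed (use assms in auto)
  qed
qed

text \<open>Uniform continuity in a form affine in the distance, so that it can be integrated: for
  points at distance at least \<delta> the last term exceeds 1 and the bound is trivial. Both points
  lie in one vertex set; off the source of the edge the probability is 0.\<close>

lemma prb_modulus:
  assumes \<epsilon>: "0 < \<epsilon>"
  shows "\<exists>\<delta>>0. \<forall>k. \<forall>u\<in>vert M k. \<forall>w\<in>vert M k. prb M e u \<le> prb M e w + \<epsilon> + dist u w / \<delta>"
proof -
  have "uniformly_continuous_on (vert M (src M e)) (prb M e)"
    using uc by (simp add: uniformly_continuous_system_def)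
  then obtain \<delta> where \<delta>: "0 < \<delta>" "\<And>u w. u \<in> vert M (src M e) \<Longrightarrow> w \<in> vert M (src M e) \<Longrightarrow> dist w u < \<delta> \<Longrightarrow> dist (prb M e w) (prb M e u) < \<epsilon>"
    using \<epsilon> unfolding uniformly_continuous_on_def by metis
  have "prb M e u \<le> prb M e w + \<epsilon> + dist u w / \<delta>" if uw: "u \<in> vert M k" "w \<in> vert M k" for k u w
  proof (cases "k = src M e")
    case False
    then have "prb M e u = 0" using prb_eq_0[OF uw(1)] by metis
    then show ?thesis using \<epsilon> \<delta>(1) by simp
  next
    case True
    show ?thesis
    proof (cases "dist u w < \<delta>")
      case True
      then have "dist (prb M e u) (prb M e w) < \<epsilon>" using \<delta>(2)[of w u] uw \<open>k = src M e\<close> by simp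
      then have "prb M e u \<le> prb M e w + \<epsilon>" by (simp add: dist_real_def)
      also have "\<dots> \<le> prb M e w + \<epsilon> + dist u w / \<delta>" using \<delta>(1) by simp
      finally show ?thesis .
    next
      case False
      then have "1 \<le> dist u w / \<delta>" using \<delta>(1) by simp
      then show ?thesis using prb_le_1[of e u] prb_nonneg[of e w] \<epsilon> by linarith
    qed
  qed
  then show ?thesis using \<delta>(1) by blast
qed

text \<open>The probability of the next letter \<open>e\<close> as predicted from the code alone,
  restricted to an event about the letters so far; the orbit starts from the substitute point
  \<open>start \<tau>\<close>.\<close>

definition transition :: "'e \<Rightarrow> 'e option list set \<Rightarrow> nat \<Rightarrow> (nat \<Rightarrow> 'e option) \<Rightarrow> real" where
  "transition e X L \<tau> = indicator X (map \<tau> [0..<L]) * prb M e (orb \<tau> L (start \<tau>))"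

lemma transition_prefix: "transition e X L \<tau> = indicator X (take L (map \<tau> [0..<Suc L]))
    * prb M e (fold (wbar M) (take L (map \<tau> [0..<Suc L])) (pt (srcbar M v (map \<tau> [0..<Suc L] ! 0))))"
proof -
  have 1: "take L (map \<tau> [0..<Suc L]) = map \<tau> [0..<L]" by (simp add: take_map)
  have 2: "map \<tau> [0..<Suc L] ! 0 = \<tau> 0" by (subst nth_map) (simp_all del: upt_Suc)
  show ?thesis unfolding transition_def orb_def 1 2 ..
qed

lemma measurable_transition: "transition e X L \<in> borel_measurable seqs"
  unfolding transition_prefix[abs_def] by (rule measurable_prefix)

lemma transition_bounds: "0 \<le> transition e X L \<tau>" "transition e X L \<tau> \<le> 1"
  by (auto simp: transition_def indicator_def)

lemma transition_event_in_sets: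
  fixes X :: "'e option list set"
  shows "{\<tau>. map \<tau> [0..<L] \<in> X \<and> \<tau> L = s} \<in> sets seqs"
proof -
  have "{\<tau>. map \<tau> [0..<L] \<in> X} \<in> sets seqs"
    using measurable_sets[OF measurable_map_seqs, of X L] by (simp add: vimage_def)
  moreover have "{\<tau>. \<tau> L = s} \<in> sets seqs" using coordinate_in_sets[of L "{s}"] by simp
  ultimately have "{\<tau>. map \<tau> [0..<L] \<in> X} \<inter> {\<tau>. \<tau> L = s} \<in> sets seqs" by (rule sets.Int)
  then show ?thesis by (simp add: Int_def)
qed

text \<open>By the Markov property the true probability uses the orbit of the hidden starting point.
  Replacing it by \<open>start \<tau>\<close> costs \<epsilon> plus \<open>1 / \<delta>\<close>
  times the mean distance, which is at most \<open>height_bound x * a ^ L\<close>. The error depends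
  neither on \<open>n\<close> nor on \<open>X\<close>.\<close>

lemma transition_mix:
  assumes \<epsilon>: "0 < \<epsilon>" and \<delta>: "0 < \<delta>"
    and mod: "\<And>k u w. u \<in> vert M k \<Longrightarrow> w \<in> vert M k \<Longrightarrow> prb M e u \<le> prb M e w + \<epsilon> + dist u w / \<delta>"
  shows "\<bar>measure (mix (avg x (Suc n))) {\<tau>. map \<tau> [0..<L] \<in> X \<and> \<tau> L = Some e}
    - (\<integral>\<tau>. transition e X L \<tau> \<partial>mix (avg x (Suc n)))\<bar> \<le> \<epsilon> + height_bound x * a ^ L / \<delta>"
proof -
  let ?\<nu> = "avg x (Suc n)" and ?A = "{\<tau>. map \<tau> [0..<L] \<in> X \<and> \<tau> L = Some e}"
  interpret A: prob_space ?\<nu> by (rule prob_space_avg)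
  interpret mix: prob_space "mix ?\<nu>" by (intro prob_space_mix prob_space_avg sets_avg)
  let ?f = "\<lambda>x \<tau>. ennreal (indicator X (map \<tau> [0..<L]) * prb M e (orb \<tau> L x))"
  let ?g = "\<lambda>\<tau>. ennreal (transition e X L \<tau>)"
  let ?d = "\<lambda>x \<tau>. ennreal \<epsilon> + ennreal (1 / \<delta>) * ennreal (dist (orb \<tau> L x) (orb \<tau> L (start \<tau>)))"
  have f: "?f x \<in> borel_measurable seqs" for x
    unfolding orb_def by (rule measurable_prefix)
  have g: "?g \<in> borel_measurable seqs"
    by (rule measurable_compose[OF measurable_transition measurable_ennreal])
  have fg: "AE \<tau> in P x. ?f x \<tau> \<le> ?g \<tau> + ?d x \<tau> \<and> ?g \<tau> \<le> ?f x \<tau> + ?d x \<tau>" for x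
    using AE_start[of x] AE_same_vertex[OF in_vtx pt, of x]
  proof eventually_elim
    case (elim \<tau>)
    obtain k where k: "orb \<tau> L x \<in> vert M k" "orb \<tau> L (start \<tau>) \<in> vert M k" using elim by metis
    let ?u = "orb \<tau> L x" and ?w = "orb \<tau> L (start \<tau>)"
    let ?e = "\<epsilon> + dist ?u ?w / \<delta>"
    have e: "ennreal ?e = ?d x \<tau>" "0 \<le> ?e"
      using \<epsilon> \<delta> by (simp_all add: ennreal_mult[symmetric])
    have "indicator X (map \<tau> [0..<L]) * prb M e ?u \<le> indicator X (map \<tau> [0..<L]) * prb M e ?w + ?e"
      "indicator X (map \<tau> [0..<L]) * prb M e ?w \<le> indicator X (map \<tau> [0..<L]) * prb M e ?u + ?e"
      using mod[OF k] mod[OF k(2,1)] e(2) by (auto simp: indicator_def dist_commute)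
    then have "ennreal (indicator X (map \<tau> [0..<L]) * prb M e ?u) \<le> ennreal (indicator X (map \<tau> [0..<L]) * prb M e ?w) + ennreal ?e"
      "ennreal (indicator X (map \<tau> [0..<L]) * prb M e ?w) \<le> ennreal (indicator X (map \<tau> [0..<L]) * prb M e ?u) + ennreal ?e"
      using e(2) by (simp_all add: ennreal_plus[symmetric] ennreal_leI del: ennreal_plus)
    then show ?case unfolding e(1) transition_def by blast
  qed
  have d_int: "(\<integral>\<^sup>+\<tau>. ?d x \<tau> \<partial>P x) \<le> ennreal \<epsilon> + ennreal (a ^ L / \<delta>) * ennreal (height x)" for x
  proof -
    have "(\<integral>\<^sup>+\<tau>. ?d x \<tau> \<partial>P x) = ennreal \<epsilon> + ennreal (1 / \<delta>) * (\<integral>\<^sup>+\<tau>. ennreal (dist (orb \<tau> L x) (orb \<tau> L (start \<tau>))) \<partial>P x)"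
    proof -
      let ?D = "\<lambda>\<tau>. ennreal (dist (orb \<tau> L x) (orb \<tau> L (start \<tau>)))"
      have D: "?D \<in> borel_measurable (P x)"
        unfolding measurable_cong_sets[OF sets_P refl] by (rule measurable_dist_start)
      have "(\<integral>\<^sup>+\<tau>. ?d x \<tau> \<partial>P x) = (\<integral>\<^sup>+\<tau>. ennreal \<epsilon> \<partial>P x) + (\<integral>\<^sup>+\<tau>. ennreal (1 / \<delta>) * ?D \<tau> \<partial>P x)"
        by (rule nn_integral_add[OF borel_measurable_const borel_measurable_times_ennreal[OF borel_measurable_const D]])
      then show ?thesis
        by (simp only: nn_integral_cmult[OF D] nn_integral_const P.emeasure_space_1 mult_1_right)
    qed
    also have "\<dots> \<le> ennreal \<epsilon> + ennreal (1 / \<delta>) * ennreal (a ^ L * height x)"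
      by (intro add_left_mono mult_left_mono nn_integral_dist_start) simp
    also have "ennreal (1 / \<delta>) * ennreal (a ^ L * height x) = ennreal (a ^ L / \<delta>) * ennreal (height x)"
      using a \<delta> by (simp add: ennreal_mult[symmetric] height_def)
    finally show ?thesis .
  qed
  have d_meas: "?d x \<in> borel_measurable (P x)" for x
    unfolding measurable_cong_sets[OF sets_P refl]
    by (intro borel_measurable_add borel_measurable_times_ennreal borel_measurable_const measurable_dist_start)
  have f': "?f x \<in> borel_measurable (P x)" and g': "?g \<in> borel_measurable (P x)" for x
    unfolding measurable_cong_sets[OF sets_P refl] by (rule f, rule g)
  have fg_int: "(\<integral>\<^sup>+\<tau>. ?f x \<tau> \<partial>P x) \<le> (\<integral>\<^sup>+\<tau>. ?g \<tau> \<partial>P x) + (ennreal \<epsilon> + ennreal (a ^ L / \<delta>) * ennreal (height x))"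
    "(\<integral>\<^sup>+\<tau>. ?g \<tau> \<partial>P x) \<le> (\<integral>\<^sup>+\<tau>. ?f x \<tau> \<partial>P x) + (ennreal \<epsilon> + ennreal (a ^ L / \<delta>) * ennreal (height x))" for x
  proof -
    have "(\<integral>\<^sup>+\<tau>. ?f x \<tau> \<partial>P x) \<le> (\<integral>\<^sup>+\<tau>. ?g \<tau> + ?d x \<tau> \<partial>P x)"
      using fg[of x] by (intro nn_integral_mono_AE) (auto elim: eventually_mono)
    also have "\<dots> = (\<integral>\<^sup>+\<tau>. ?g \<tau> \<partial>P x) + (\<integral>\<^sup>+\<tau>. ?d x \<tau> \<partial>P x)" by (rule nn_integral_add[OF g' d_meas])
    finally show "(\<integral>\<^sup>+\<tau>. ?f x \<tau> \<partial>P x) \<le> (\<integral>\<^sup>+\<tau>. ?g \<tau> \<partial>P x) + (ennreal \<epsilon> + ennreal (a ^ L / \<delta>) * ennreal (height x))"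
      using d_int[of x] by (meson add_left_mono order_trans)
    have "(\<integral>\<^sup>+\<tau>. ?g \<tau> \<partial>P x) \<le> (\<integral>\<^sup>+\<tau>. ?f x \<tau> + ?d x \<tau> \<partial>P x)"
      using fg[of x] by (intro nn_integral_mono_AE) (auto elim: eventually_mono)
    also have "\<dots> = (\<integral>\<^sup>+\<tau>. ?f x \<tau> \<partial>P x) + (\<integral>\<^sup>+\<tau>. ?d x \<tau> \<partial>P x)" by (rule nn_integral_add[OF f' d_meas])
    finally show "(\<integral>\<^sup>+\<tau>. ?g \<tau> \<partial>P x) \<le> (\<integral>\<^sup>+\<tau>. ?f x \<tau> \<partial>P x) + (ennreal \<epsilon> + ennreal (a ^ L / \<delta>) * ennreal (height x))"
      using d_int[of x] by (meson add_left_mono order_trans)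
  qed
  have Pf: "emeasure (P x) ?A = (\<integral>\<^sup>+\<tau>. ?f x \<tau> \<partial>P x)" for x
    unfolding emeasure_P_transition by (intro nn_integral_cong) (auto simp: indicator_def)
  have F_meas: "(\<lambda>x. emeasure (P x) ?A) \<in> borel_measurable ?\<nu>"
    unfolding measurable_cong_sets[OF sets_avg refl] by (rule measurable_emeasure_P[OF transition_event_in_sets])
  have G_meas: "(\<lambda>x. \<integral>\<^sup>+\<tau>. ?g \<tau> \<partial>P x) \<in> borel_measurable ?\<nu>"
    unfolding measurable_cong_sets[OF sets_avg refl]
    by (rule measurable_compose[OF measurable_P_subprob nn_integral_measurable_subprob_algebra[OF g]])
  have h_meas: "(\<lambda>x. ennreal \<epsilon> + ennreal (a ^ L / \<delta>) * ennreal (height x)) \<in> borel_measurable ?\<nu>"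
    unfolding measurable_cong_sets[OF sets_avg refl]
    by (intro borel_measurable_add borel_measurable_times_ennreal borel_measurable_const measurable_height)
  have h_int: "(\<integral>\<^sup>+x. ennreal \<epsilon> + ennreal (a ^ L / \<delta>) * ennreal (height x) \<partial>?\<nu>) \<le> ennreal (\<epsilon> + height_bound x * a ^ L / \<delta>)"
  proof -
    have h: "(\<lambda>x. ennreal (height x)) \<in> borel_measurable ?\<nu>"
      unfolding measurable_cong_sets[OF sets_avg refl] by (rule measurable_height)
    have "(\<integral>\<^sup>+x. ennreal \<epsilon> + ennreal (a ^ L / \<delta>) * ennreal (height x) \<partial>?\<nu>)
        = ennreal \<epsilon> + ennreal (a ^ L / \<delta>) * (\<integral>\<^sup>+x. ennreal (height x) \<partial>?\<nu>)"
      using h by (simp add: nn_integral_add nn_integral_cmult A.emeasure_space_1)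
    also have "\<dots> \<le> ennreal \<epsilon> + ennreal (a ^ L / \<delta>) * ennreal (height_bound x)"
      by (intro add_left_mono mult_left_mono nn_integral_height_avg) simp
    also have "\<dots> = ennreal (\<epsilon> + height_bound x * a ^ L / \<delta>)"
      using a \<delta> \<epsilon> height_bound(1)[of x] by (simp add: ennreal_mult[symmetric] mult.commute)
    finally show ?thesis .
  qed
  have g_int: "(\<integral>\<^sup>+\<tau>. ?g \<tau> \<partial>mix ?\<nu>) = ennreal (\<integral>\<tau>. transition e X L \<tau> \<partial>mix ?\<nu>)"
  proof (rule nn_integral_eq_integral)
    have "transition e X L \<in> borel_measurable (mix ?\<nu>)"
      unfolding measurable_cong_sets[OF sets_mix[OF sets_avg] refl] by (rule measurable_transition)
    then show "integrable (mix ?\<nu>) (transition e X L)"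
      using transition_bounds by (intro mix.integrable_const_bound[where B = 1]) auto
  qed (simp add: transition_bounds)
  have "emeasure (mix ?\<nu>) ?A = (\<integral>\<^sup>+x. emeasure (P x) ?A \<partial>?\<nu>)"
    by (rule emeasure_mix[OF sets_avg transition_event_in_sets])
  also have "\<dots> \<le> (\<integral>\<^sup>+x. (\<integral>\<^sup>+\<tau>. ?g \<tau> \<partial>P x) + (ennreal \<epsilon> + ennreal (a ^ L / \<delta>) * ennreal (height x)) \<partial>?\<nu>)"
    unfolding Pf by (intro nn_integral_mono fg_int)
  also have "\<dots> = (\<integral>\<^sup>+\<tau>. ?g \<tau> \<partial>mix ?\<nu>) + (\<integral>\<^sup>+x. ennreal \<epsilon> + ennreal (a ^ L / \<delta>) * ennreal (height x) \<partial>?\<nu>)"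
    unfolding nn_integral_mix[OF sets_avg g] by (rule nn_integral_add[OF G_meas h_meas])
  also have "\<dots> \<le> ennreal (\<integral>\<tau>. transition e X L \<tau> \<partial>mix ?\<nu>) + ennreal (\<epsilon> + height_bound x * a ^ L / \<delta>)"
    unfolding g_int by (intro add_left_mono h_int)
  finally have 1: "emeasure (mix ?\<nu>) ?A \<le> ennreal (\<integral>\<tau>. transition e X L \<tau> \<partial>mix ?\<nu>) + ennreal (\<epsilon> + height_bound x * a ^ L / \<delta>)" .
  have "ennreal (\<integral>\<tau>. transition e X L \<tau> \<partial>mix ?\<nu>) = (\<integral>\<^sup>+x. \<integral>\<^sup>+\<tau>. ?g \<tau> \<partial>P x \<partial>?\<nu>)"
    unfolding g_int[symmetric] by (rule nn_integral_mix[OF sets_avg g])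
  also have "\<dots> \<le> (\<integral>\<^sup>+x. emeasure (P x) ?A + (ennreal \<epsilon> + ennreal (a ^ L / \<delta>) * ennreal (height x)) \<partial>?\<nu>)"
    unfolding Pf by (intro nn_integral_mono fg_int)
  also have "\<dots> = emeasure (mix ?\<nu>) ?A + (\<integral>\<^sup>+x. ennreal \<epsilon> + ennreal (a ^ L / \<delta>) * ennreal (height x) \<partial>?\<nu>)"
    unfolding emeasure_mix[OF sets_avg transition_event_in_sets] by (rule nn_integral_add[OF F_meas h_meas])
  also have "\<dots> \<le> emeasure (mix ?\<nu>) ?A + ennreal (\<epsilon> + height_bound x * a ^ L / \<delta>)"
    by (intro add_left_mono h_int)
  finally have 2: "ennreal (\<integral>\<tau>. transition e X L \<tau> \<partial>mix ?\<nu>) \<le> emeasure (mix ?\<nu>) ?A + ennreal (\<epsilon> + height_bound x * a ^ L / \<delta>)" .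
  have nn: "0 \<le> \<epsilon> + height_bound x * a ^ L / \<delta>" "0 \<le> (\<integral>\<tau>. transition e X L \<tau> \<partial>mix ?\<nu>)"
    using \<epsilon> \<delta> a height_bound(1)[of x] by (simp_all add: integral_nonneg_AE transition_bounds)
  show ?thesis
    using 1 2 nn unfolding mix.emeasure_eq_measure
    by (simp add: ennreal_plus[symmetric] del: ennreal_plus)
qed

text \<open>All estimates for the averaged path laws are uniform in the averaging time and involve
  finite words only. Gaps pass to the limit by Fatou, transition errors by convergence of bounded
  prefix integrals, and null words remain null because the process never leaves the class.\<close>

lemma stationary_code_measure:
  assumes dom: "dominating_markov_chain M" and gen: "generating_point M x"
    and c: "c \<in> essential_classes M" and x: "x \<in> class_union M c"
  obtains Q where "prob_space Q" "sets Q = sets seqs" "distr Q seqs shift_seq = Q"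
    "\<And>L. (\<integral>\<^sup>+\<tau>. ennreal (gap L \<tau>) \<partial>Q) \<le> ennreal (2 * height_bound x * a ^ L)"
    "\<And>e \<epsilon>. 0 < \<epsilon> \<Longrightarrow> \<exists>L0. \<forall>L\<ge>L0. \<forall>X.
      \<bar>measure Q {\<tau>. map \<tau> [0..<L] \<in> X \<and> \<tau> L = Some e} - (\<integral>\<tau>. transition e X L \<tau> \<partial>Q)\<bar> \<le> \<epsilon>"
    "\<And>w. (\<And>y. y \<in> class_union M c \<Longrightarrow> cyl_prob M w y = 0) \<Longrightarrow> measure Q (cylinder w) = 0"
proof -
  let ?Q = "\<lambda>n. mix (avg x (Suc n))"
  have prob: "prob_space (?Q n)" for n by (intro prob_space_mix prob_space_avg sets_avg)
  have sets: "sets (?Q n) = sets seqs" for n by (intro sets_mix sets_avg)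
  have "(\<lambda>n. 1 / real (Suc n)) \<longlonglongrightarrow> 0" by (rule lim_1_over_n[THEN LIMSEQ_Suc])
  from stationary_limit_exists[OF prob sets mix_avg_tight[OF dom gen] this mix_avg_almost_stationary]
  obtain r Q where r: "strict_mono (r :: nat \<Rightarrow> nat)" and Q: "prob_space Q" "sets Q = sets seqs"
    and lim: "\<And>w. (\<lambda>n. measure (?Q (r n)) (cylinder w)) \<longlonglongrightarrow> measure Q (cylinder w)"
    and stat: "distr Q seqs shift_seq = Q" by blast
  interpret Q: prob_space Q by fact
  have gap: "(\<integral>\<^sup>+\<tau>. ennreal (gap L \<tau>) \<partial>Q) \<le> ennreal (2 * height_bound x * a ^ L)" for L
  proof -
    have "(\<integral>\<^sup>+\<tau>. ennreal (gap L \<tau>) \<partial>Q) \<le> liminf (\<lambda>n. \<integral>\<^sup>+\<tau>. ennreal (gap L \<tau>) \<partial>?Q (r n))"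
      unfolding gap_prefix
      by (rule nn_integral_prefix_liminf[OF prob sets Q lim, where L = "Suc (Suc L)" and
          h = "\<lambda>w. ennreal (dist (fold (wbar M) (take L (tl w)) (pt (srcbar M v (w ! 1)))) (fold (wbar M) (take (Suc L) w) (pt (srcbar M v (w ! 0)))))"])
    also have "\<dots> \<le> liminf (\<lambda>n. ennreal (2 * height_bound x * a ^ L))"
      by (intro Liminf_mono always_eventually allI nn_integral_gap_mix)
    also have "\<dots> = ennreal (2 * height_bound x * a ^ L)" by (simp add: Liminf_const)
    finally show ?thesis .
  qed
  have trans: "\<exists>L0. \<forall>L\<ge>L0. \<forall>X.
      \<bar>measure Q {\<tau>. map \<tau> [0..<L] \<in> X \<and> \<tau> L = Some e} - (\<integral>\<tau>. transition e X L \<tau> \<partial>Q)\<bar> \<le> \<epsilon>"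
    if \<epsilon>: "0 < \<epsilon>" for e \<epsilon>
  proof -
    obtain \<delta> where \<delta>: "0 < \<delta>"
      "\<And>k u w. u \<in> vert M k \<Longrightarrow> w \<in> vert M k \<Longrightarrow> prb M e u \<le> prb M e w + \<epsilon> / 2 + dist u w / \<delta>"
      using prb_modulus[of "\<epsilon> / 2" e] \<epsilon> by auto
    have "(\<lambda>L. height_bound x / \<delta> * a ^ L) \<longlonglongrightarrow> height_bound x / \<delta> * 0"
      using a by (intro tendsto_mult tendsto_const LIMSEQ_realpow_zero) auto
    then have "eventually (\<lambda>L. height_bound x / \<delta> * a ^ L < \<epsilon> / 2) sequentially"
      using \<epsilon> by (intro order_tendstoD) auto
    then obtain L0 where L0: "\<And>L. L0 \<le> L \<Longrightarrow> height_bound x / \<delta> * a ^ L < \<epsilon> / 2"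
      by (auto simp: eventually_sequentially)
    have "\<bar>measure Q {\<tau>. map \<tau> [0..<L] \<in> X \<and> \<tau> L = Some e} - (\<integral>\<tau>. transition e X L \<tau> \<partial>Q)\<bar> \<le> \<epsilon>"
      if L: "L0 \<le> L" for L X
    proof -
      let ?A = "{\<tau>. map \<tau> [0..<L] \<in> X \<and> \<tau> L = Some e}"
      define h1 where "h1 w = (indicator {w. take L w \<in> X \<and> w ! L = Some e} w :: real)" for w
      define h2 where "h2 w = indicator X (take L w) * prb M e (fold (wbar M) (take L w) (pt (srcbar M v (w ! 0))))" for w
      have h1_eq: "(\<integral>\<tau>. h1 (map \<tau> [0..<Suc L]) \<partial>N) = measure N ?A" if "prob_space N" "sets N = sets seqs" for N
      proof -
        interpret N: prob_space N by fact
        have "h1 (map \<tau> [0..<Suc L]) = indicator ?A \<tau>" for \<tau>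
        proof -
          have "take L (map \<tau> [0..<Suc L]) = map \<tau> [0..<L]" by (simp add: take_map)
          moreover have "map \<tau> [0..<Suc L] ! L = \<tau> L" by (subst nth_map) (simp_all del: upt_Suc)
          ultimately show ?thesis by (simp add: h1_def indicator_def del: upt_Suc)
        qed
        moreover have "?A \<in> sets N" using transition_event_in_sets that by simp
        ultimately show ?thesis by simp
      qed
      have h2_eq: "(\<integral>\<tau>. h2 (map \<tau> [0..<Suc L]) \<partial>N) = (\<integral>\<tau>. transition e X L \<tau> \<partial>N)" for N
        unfolding transition_prefix h2_def ..
      have "(\<lambda>n. \<integral>\<tau>. h1 (map \<tau> [0..<Suc L]) \<partial>?Q (r n)) \<longlonglongrightarrow> (\<integral>\<tau>. h1 (map \<tau> [0..<Suc L]) \<partial>Q)"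
        by (rule integral_prefix_tendsto[OF prob sets Q lim]) (auto simp: h1_def indicator_def)
      then have 1: "(\<lambda>n. measure (?Q (r n)) ?A) \<longlonglongrightarrow> measure Q ?A"
        unfolding h1_eq[OF prob sets] h1_eq[OF Q] .
      have "(\<lambda>n. \<integral>\<tau>. h2 (map \<tau> [0..<Suc L]) \<partial>?Q (r n)) \<longlonglongrightarrow> (\<integral>\<tau>. h2 (map \<tau> [0..<Suc L]) \<partial>Q)"
        by (rule integral_prefix_tendsto[OF prob sets Q lim]) (auto simp: h2_def indicator_def)
      then have 2: "(\<lambda>n. \<integral>\<tau>. transition e X L \<tau> \<partial>?Q (r n)) \<longlonglongrightarrow> (\<integral>\<tau>. transition e X L \<tau> \<partial>Q)"
        unfolding h2_eq .
      have "\<bar>measure Q ?A - (\<integral>\<tau>. transition e X L \<tau> \<partial>Q)\<bar> \<le> \<epsilon> / 2 + height_bound x * a ^ L / \<delta>"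
      proof (rule LIMSEQ_le_const2[OF tendsto_rabs[OF tendsto_diff[OF 1 2]]])
        have "0 < \<epsilon> / 2" using \<epsilon> by simp
        then have "\<bar>measure (?Q (r n)) ?A - (\<integral>\<tau>. transition e X L \<tau> \<partial>?Q (r n))\<bar> \<le> \<epsilon> / 2 + height_bound x * a ^ L / \<delta>" for n
          using \<delta>(1) by (rule transition_mix) (rule \<delta>(2))
        then show "\<exists>N. \<forall>n\<ge>N. \<bar>measure (?Q (r n)) ?A - (\<integral>\<tau>. transition e X L \<tau> \<partial>?Q (r n))\<bar> \<le> \<epsilon> / 2 + height_bound x * a ^ L / \<delta>"
          by blast
      qed
      also have "\<epsilon> / 2 + height_bound x * a ^ L / \<delta> \<le> \<epsilon>"
      proof -
        have "height_bound x * a ^ L / \<delta> = height_bound x / \<delta> * a ^ L" by simp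
        then show ?thesis using L0[OF L] by linarith
      qed
      finally show ?thesis .
    qed
    then show ?thesis by blast
  qed
  have null: "measure Q (cylinder w) = 0" if w: "\<And>y. y \<in> class_union M c \<Longrightarrow> cyl_prob M w y = 0" for w
  proof -
    have "measure (?Q n) (cylinder w) = 0" for n
    proof -
      have zero: "(\<integral>\<^sup>+y. ennreal (cyl_prob M w y) \<partial>law x k) = 0" for k
      proof -
        have "(\<integral>\<^sup>+y. ennreal (cyl_prob M w y) \<partial>law x k) = (\<integral>\<^sup>+y. 0 \<partial>law x k)"
          using AE_law_class[OF c x, of k] w by (intro nn_integral_cong_AE) (auto elim!: eventually_mono)
        then show ?thesis by simp
      qed
      have "emeasure (?Q n) (cylinder w) = (\<integral>\<^sup>+y. ennreal (cyl_prob M w y) \<partial>avg x (Suc n))"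
        by (simp add: emeasure_mix emeasure_P_cylinder)
      also have "\<dots> = (\<Sum>k=1..Suc n. \<integral>\<^sup>+y. ennreal (cyl_prob M w y) \<partial>law x k) / of_nat (Suc n)"
        by (rule nn_integral_avg) simp_all
      also have "\<dots> = 0" by (simp only: zero sum.neutral_const) simp
      finally show ?thesis by (simp add: measure_def)
    qed
    then show ?thesis using lim[of w] by (simp add: LIMSEQ_const_iff)
  qed
  show ?thesis by (rule that[OF Q stat gap trans null])
qed

end

section \<open>The two-sided stationary code\<close>

text \<open>An event seen in the window from \<open>m'\<close> is also seen from any earlier
  \<open>m\<close>, so events visible in some window are closed under intersection.\<close>

lemma biseqs_measure_eqI:
  fixes N1 N2 :: "(int \<Rightarrow> 'b) measure"
  assumes fin: "finite_measure N1" and N1: "sets N1 = sets biseqs" and N2: "sets N2 = sets biseqs"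
    and eq: "\<And>m A. A \<in> sets seqs \<Longrightarrow> emeasure N1 (window m -` A) = emeasure N2 (window m -` A)"
  shows "N1 = N2"
proof -
  let ?E = "{window m -` A | m A. A \<in> sets seqs} :: (int \<Rightarrow> 'b) set set"
  have E_sets: "?E \<subseteq> sets biseqs"
    using measurable_sets[OF measurable_window] by auto
  have shift_k: "(\<lambda>\<tau> j. \<tau> (k + j)) \<in> measurable seqs (seqs :: (nat \<Rightarrow> 'b) measure)" for k
    by (rule measurable_PiM_single') auto
  have stable: "Int_stable ?E"
  proof -
    have le: "window m -` A \<inter> window m' -` A' \<in> ?E"
      if A: "A \<in> sets seqs" "A' \<in> sets seqs" and m: "m \<le> m'" for m m' and A A' :: "(nat \<Rightarrow> 'b) set"
    proof -
      define k where "k = nat (m' - m)"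
      have "window m' \<sigma> = (\<lambda>j. window m \<sigma> (k + j))" for \<sigma> :: "int \<Rightarrow> 'b"
        using m by (auto simp: window_def k_def fun_eq_iff algebra_simps)
      then have "window m -` A \<inter> window m' -` A' = window m -` (A \<inter> (\<lambda>\<tau> j. \<tau> (k + j)) -` A')"
        by auto
      moreover have "A \<inter> (\<lambda>\<tau> j. \<tau> (k + j)) -` A' \<in> sets seqs"
        using measurable_sets[OF shift_k A(2)] A(1) by (intro sets.Int) auto
      ultimately show ?thesis by blast
    qed
    show ?thesis
    proof (rule Int_stableI)
      fix X Y assume "X \<in> ?E" "Y \<in> ?E"
      then obtain m m' A A' where "X = window m -` A" "Y = window m' -` A'" "A \<in> sets seqs" "A' \<in> sets seqs"
        by auto
      then show "X \<inter> Y \<in> ?E"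
        using le[of A A' m m'] le[of A' A m' m] by (cases "m \<le> m'") (simp_all add: Int_commute)
    qed
  qed
  have gen: "sets (biseqs :: (int \<Rightarrow> 'b) measure) = sigma_sets UNIV ?E"
  proof
    have "{f. f i \<in> A} \<in> sigma_sets UNIV ?E" for i and A :: "'b set"
    proof -
      have "{f. f i \<in> A} = window i -` {\<tau>. \<tau> 0 \<in> A}" by (auto simp: window_def)
      then show ?thesis using coordinate_in_sets[of 0 A] by (intro sigma_sets.Basic) blast
    qed
    then have "sigma_sets UNIV {{f. f i \<in> A} | i A. True} \<subseteq> sigma_sets UNIV ?E"
      by (intro sigma_sets_mono) auto
    moreover have "sets (biseqs :: (int \<Rightarrow> 'b) measure) = sigma_sets UNIV {{f. f i \<in> A} | i A. True}"
      unfolding sets_PiM_single by (simp add: PiE_def)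
    ultimately show "sets biseqs \<subseteq> sigma_sets UNIV ?E" by simp
    show "sigma_sets UNIV ?E \<subseteq> sets biseqs"
      using sets.sigma_sets_subset[OF E_sets] by simp
  qed
  show ?thesis
  proof (rule measure_eqI_generator_eq[OF stable, where \<Omega> = UNIV and A = "\<lambda>_. UNIV"])
    interpret finite_measure N1 by fact
    show "emeasure N1 UNIV \<noteq> \<infinity>" by simp
    show "range (\<lambda>_. UNIV) \<subseteq> ?E"
    proof -
      have "(UNIV :: (int \<Rightarrow> 'b) set) = window 0 -` UNIV" by simp
      moreover have "UNIV \<in> sets (seqs :: (nat \<Rightarrow> 'b) measure)" using sets.top[of seqs] by simp
      ultimately show ?thesis by blast
    qed
    show "sets N1 = sigma_sets UNIV ?E" "sets N2 = sigma_sets UNIV ?E"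
      using N1 N2 gen by simp_all
  qed (use eq in auto)
qed

lemma Cauchy_of_summable_dist:
  fixes f :: "nat \<Rightarrow> 'c::metric_space"
  assumes "(\<Sum>n. ennreal (dist (f n) (f (Suc n)))) \<noteq> \<infinity>"
  shows "Cauchy f"
proof -
  have sum: "summable (\<lambda>n. dist (f n) (f (Suc n)))"
    using assms by (intro summable_suminf_not_top) auto
  have le: "dist (f m) (f n) \<le> (\<Sum>k=m..<n. dist (f k) (f (Suc k)))" if "m \<le> n" for m n
    using that
  proof (induction n rule: dec_induct)
    case (step n)
    then show ?case using dist_triangle[of "f m" "f (Suc n)" "f n"] by simp
  qed simp
  show ?thesis
  proof (rule metric_CauchyI)
    fix \<epsilon> :: real assume "0 < \<epsilon>"
    then obtain N where N: "\<And>m n. N \<le> m \<Longrightarrow> norm (\<Sum>k=m..<n. dist (f k) (f (Suc k))) < \<epsilon>"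
      using sum unfolding summable_Cauchy by blast
    have *: "dist (f m) (f n) < \<epsilon>" if "N \<le> m" "m \<le> n" for m n
      using le[OF that(2)] N[OF that(1), of n] by (simp add: sum_nonneg)
    show "\<exists>N. \<forall>m\<ge>N. \<forall>n\<ge>N. dist (f m) (f n) < \<epsilon>"
      using * by (metis dist_commute linear)
  qed
qed

lemma uniformly_continuous_convergent:
  fixes f :: "'c::metric_space \<Rightarrow> real"
  assumes "uniformly_continuous_on S f" "Cauchy X" "\<And>n. X n \<in> S"
  shows "convergent (\<lambda>n. f (X n))"
proof -
  have "Cauchy (\<lambda>n. f (X n))"
    using uniformly_continuous_on_Cauchy[OF assms] by (simp add: o_def)
  then show ?thesis by (simp add: Cauchy_convergent_iff)
qed

text \<open>Legitimates the definite description: uniform continuity gives a continuous extension to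
  the closure, density of the vertex set makes it unique there, and the value off the closure is
  prescribed.\<close>

lemma (in markov) prb_extension_properties:
  assumes uc: "uniformly_continuous_on (vert M (src M e)) (prb M e)"
  shows "continuous_on (closure (vert M (src M e))) (prb_extension M e)"
    and "\<And>x. x \<in> vert M (src M e) \<Longrightarrow> prb_extension M e x = prb M e x"
proof -
  let ?X = "vert M (src M e)"
  obtain g where g: "uniformly_continuous_on (closure ?X) g" "\<And>x. x \<in> ?X \<Longrightarrow> prb M e x = g x"
    by (rule uniformly_continuous_on_extension_on_closure[OF uc]) blast
  have g_cont: "continuous_on (closure ?X) g"
    by (rule uniformly_continuous_imp_continuous[OF g(1)])
  have "\<exists>!h. continuous_on (closure ?X) h \<and> (\<forall>x\<in>?X. h x = prb M e x) \<and> (\<forall>x. x \<notin> closure ?X \<longrightarrow> h x = 0)"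
  proof (rule ex1I[of _ "\<lambda>x. if x \<in> closure ?X then g x else 0"], intro conjI ballI allI impI)
    show "continuous_on (closure ?X) (\<lambda>x. if x \<in> closure ?X then g x else 0)"
      using g_cont by (rule continuous_on_eq) simp
    show "(if x \<in> closure ?X then g x else 0) = prb M e x" if "x \<in> ?X" for x
      using that g(2) closure_subset by auto
    fix h assume h: "continuous_on (closure ?X) h \<and> (\<forall>x\<in>?X. h x = prb M e x) \<and> (\<forall>x. x \<notin> closure ?X \<longrightarrow> h x = 0)"
    show "h = (\<lambda>x. if x \<in> closure ?X then g x else 0)"
    proof
      fix x
      show "h x = (if x \<in> closure ?X then g x else 0)"
      proof (cases "x \<in> closure ?X")
        case True
        have "continuous_on (closure ?X) (\<lambda>x. h x - g x)" using h g_cont by (intro continuous_on_diff) auto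
        then have "h x - g x = 0" by (rule continuous_constant_on_closure[OF _ _ True]) (use h g(2) in auto)
        then show ?thesis using True by simp
      qed (use h in simp)
    qed
  qed simp
  from theI'[OF this, folded prb_extension_def]
  show "continuous_on (closure ?X) (prb_extension M e)" "\<And>x. x \<in> ?X \<Longrightarrow> prb_extension M e x = prb M e x"
    by blast+
qed

text \<open>Collects what the limit construction supplies: \<open>Q\<close> is the one-sided
  stationary code measure, \<Lambda> its two-sided extension, and \<open>C\<close> is instantiated
  with \<open>2 * height_bound x\<close>.\<close>

locale code_measure = contractive_markov M pt v a b
  for M :: "('a::complete_space, 'v, 'e::countable) markov_sys"
    and pt :: "'v \<Rightarrow> 'a" and v :: 'v and a b :: real +
  fixes c :: "'v set" and C :: real
    and Q :: "(nat \<Rightarrow> 'e option) measure" and \<Lambda> :: "(int \<Rightarrow> 'e option) measure"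
  assumes c: "c \<in> essential_classes M" and C: "0 \<le> C"
    and Q: "prob_space Q" "sets Q = sets seqs"
    and \<Lambda>: "prob_space \<Lambda>" "sets \<Lambda> = sets biseqs"
    and window: "distr \<Lambda> seqs (window m) = Q"
    and gap: "(\<integral>\<^sup>+\<tau>. ennreal (gap L \<tau>) \<partial>Q) \<le> ennreal (C * a ^ L)"
    and trans: "0 < \<epsilon> \<Longrightarrow> \<exists>L0. \<forall>L\<ge>L0. \<forall>X.
      \<bar>measure Q {\<tau>. map \<tau> [0..<L] \<in> X \<and> \<tau> L = Some e} - (\<integral>\<tau>. transition e X L \<tau> \<partial>Q)\<bar> \<le> \<epsilon>"
    and null: "(\<And>y. y \<in> class_union M c \<Longrightarrow> cyl_prob M w y = 0) \<Longrightarrow> measure Q (cylinder w) = 0"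
begin

sublocale Q: prob_space Q by (rule Q)
sublocale \<Lambda>: prob_space \<Lambda> by (rule \<Lambda>)

lemma space_\<Lambda> [simp]: "space \<Lambda> = UNIV"
  using sets_eq_imp_space_eq[OF \<Lambda>(2)] by simp

lemma measurable_window_\<Lambda>: "window m \<in> measurable \<Lambda> seqs"
  by (simp only: measurable_cong_sets[OF \<Lambda>(2) refl] measurable_window)

lemma emeasure_window: "A \<in> sets seqs \<Longrightarrow> emeasure \<Lambda> (window m -` A) = emeasure Q A"
  using emeasure_distr[OF measurable_window_\<Lambda>, of A m] by (simp add: window)

lemma AE_window:
  assumes "AE \<tau> in Q. R \<tau>"
  shows "AE \<sigma> in \<Lambda>. R (window m \<sigma>)"
  by (rule AE_distrD[OF measurable_window_\<Lambda>]) (simp only: window assms)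

lemma shift_window: "window m (shift \<sigma>) = window (m + 1) \<sigma>"
  by (simp add: window_def shift_def fun_eq_iff algebra_simps)

lemma shift_seq_window: "shift_seq (window m \<sigma>) = window (m + 1) \<sigma>"
  by (simp add: window_def fun_eq_iff algebra_simps)

lemma measurable_shift: "shift \<in> measurable biseqs biseqs"
  unfolding shift_def by (rule measurable_PiM_single') (auto intro: measurable_biseqs_component)

text \<open>The shift maps one window to the next, and all windows have the law
  \<open>Q\<close>.\<close>

lemma distr_shift: "distr \<Lambda> biseqs shift = \<Lambda>"
proof (rule biseqs_measure_eqI)
  have shift: "shift \<in> measurable \<Lambda> biseqs"
    by (simp only: measurable_cong_sets[OF \<Lambda>(2) refl] measurable_shift)
  interpret D: prob_space "distr \<Lambda> biseqs shift" by (rule \<Lambda>.prob_space_distr[OF shift])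
  show "finite_measure (distr \<Lambda> biseqs shift)" by (rule D.finite_measure_axioms)
  fix m and A :: "(nat \<Rightarrow> 'e option) set" assume A: "A \<in> sets seqs"
  have "window m -` A \<in> sets biseqs"
    using measurable_sets[OF measurable_window A, of m] by simp
  then have "emeasure (distr \<Lambda> biseqs shift) (window m -` A) = emeasure \<Lambda> (shift -` window m -` A)"
    using emeasure_distr[OF shift] by simp
  also have "shift -` window m -` A = window (m + 1) -` A"
    by (auto simp: shift_window)
  also have "emeasure \<Lambda> \<dots> = emeasure \<Lambda> (window m -` A)"
    using A by (simp add: emeasure_window)
  finally show "emeasure (distr \<Lambda> biseqs shift) (window m -` A) = emeasure \<Lambda> (window m -` A)" .
qed (simp_all add: \<Lambda>)

lemma AE_not_cylinder:
  assumes "\<And>y. y \<in> class_union M c \<Longrightarrow> cyl_prob M w y = 0"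
  shows "AE \<tau> in Q. \<tau> \<notin> cylinder w"
  using null[OF assms] Q(2)
  by (intro AE_not_in null_setsI) (simp_all add: Q.emeasure_eq_measure)

text \<open>Words containing \<open>None\<close> or two edges that do not fit together have weight 0
  from every starting point, and \<open>null\<close> transfers this to \<open>Q\<close>.\<close>

lemma AE_path_space: "AE \<sigma> in \<Lambda>. \<sigma> \<in> path_space M v"
proof -
  have 1: "AE \<tau> in Q. \<tau> 0 \<noteq> None"
  proof -
    have "AE \<tau> in Q. \<tau> \<notin> cylinder [None]" by (rule AE_not_cylinder) simp
    then show ?thesis by eventually_elim (simp add: cylinder_def)
  qed
  have 2: "AE \<tau> in Q. \<forall>e e'. src M e' \<noteq> tgt M e \<longrightarrow> \<tau> \<notin> cylinder [Some e, Some e']"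
    unfolding AE_all_countable
  proof safe
    fix e e'
    show "AE \<tau> in Q. src M e' \<noteq> tgt M e \<longrightarrow> \<tau> \<notin> cylinder [Some e, Some e']"
    proof (cases "src M e' = tgt M e")
      case False
      have "cyl_prob M [Some e, Some e'] y = 0" for y
      proof (cases "prb M e y = 0")
        case nz: False
        then have "0 < prb M e y" by (simp add: less_le)
        then have "wmap M e y \<in> vert M (tgt M e)" by (intro vert_tgt prb_pos_vert)
        then show ?thesis using prb_eq_0[OF _ False] by simp
      qed simp
      then have "AE \<tau> in Q. \<tau> \<notin> cylinder [Some e, Some e']" by (intro AE_not_cylinder)
      then show ?thesis by eventually_elim simp
    qed simp
  qed
  have "AE \<tau> in Q. \<tau> 0 \<noteq> None \<and> \<tau> 1 \<noteq> None \<longrightarrow> srcbar M v (\<tau> 1) = tgtbar M v (\<tau> 0)"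
    using 2
  proof eventually_elim
    case (elim \<tau>)
    show ?case
    proof
      assume "\<tau> 0 \<noteq> None \<and> \<tau> 1 \<noteq> None"
      then obtain e e' where e: "\<tau> 0 = Some e" "\<tau> 1 = Some e'" by auto
      then have "\<tau> \<in> cylinder [Some e, Some e']" by (auto simp: cylinder_def less_Suc_eq)
      then show "srcbar M v (\<tau> 1) = tgtbar M v (\<tau> 0)" using elim e by auto
    qed
  qed
  from AE_window[OF this] AE_window[OF 1]
  have "AE \<sigma> in \<Lambda>. \<sigma> m \<noteq> None" "AE \<sigma> in \<Lambda>. \<sigma> m \<noteq> None \<and> \<sigma> (m + 1) \<noteq> None \<longrightarrow> srcbar M v (\<sigma> (m + 1)) = tgtbar M v (\<sigma> m)" for m
    by (simp_all add: window_def)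
  then have "AE \<sigma> in \<Lambda>. \<forall>m. \<sigma> m \<noteq> None"
    "AE \<sigma> in \<Lambda>. \<forall>m. \<sigma> m \<noteq> None \<and> \<sigma> (m + 1) \<noteq> None \<longrightarrow> srcbar M v (\<sigma> (m + 1)) = tgtbar M v (\<sigma> m)"
    unfolding AE_all_countable by blast+
  then show ?thesis by eventually_elim (simp add: path_space_def)
qed

lemma AE_tgt_class: "AE \<sigma> in \<Lambda>. tgtbar M v (\<sigma> 0) \<in> c"
proof -
  have "AE \<tau> in Q. \<forall>e. src M e \<notin> c \<longrightarrow> \<tau> \<notin> cylinder [Some e]"
    unfolding AE_all_countable
  proof
    fix e
    show "AE \<tau> in Q. src M e \<notin> c \<longrightarrow> \<tau> \<notin> cylinder [Some e]"
    proof (cases "src M e \<in> c")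
      case False
      have "prb M e y = 0" if y: "y \<in> class_union M c" for y
      proof -
        obtain j where "j \<in> c" "y \<in> vert M j" using y by (auto simp: class_union_def)
        then show ?thesis using False by (intro prb_eq_0[of y j]) auto
      qed
      then have "AE \<tau> in Q. \<tau> \<notin> cylinder [Some e]" by (intro AE_not_cylinder) simp
      then show ?thesis by eventually_elim simp
    qed simp
  qed
  from AE_window[OF this, of 0] AE_path_space show ?thesis
  proof eventually_elim
    case (elim \<sigma>)
    obtain e where e: "\<sigma> 0 = Some e" using elim(2) by (auto simp: path_space_def)
    then have "window 0 \<sigma> \<in> cylinder [Some e]" by (simp add: window_def cylinder_def)
    then have "src M e \<in> c" using elim(1) by blast
    then show ?case using e essential_class_closed[OF c _ accessible_edge] by simp
  qed
qed

text \<open>The value of \<open>coding_approx\<close> as a forward orbit in the window from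
  \<open>-n\<close>; the \<open>n + 1\<close> letters at positions \<open>-n, ..., 0\<close> are
  consumed, hence \<open>Suc n\<close>.\<close>

definition ap :: "(int \<Rightarrow> 'e option) \<Rightarrow> nat \<Rightarrow> 'a" where
  "ap \<sigma> n = orb (window (- int n) \<sigma>) (Suc n) (start (window (- int n) \<sigma>))"

lemma window_Suc: "window (- int n) \<sigma> = shift_seq (window (- int (Suc n)) \<sigma>)"
  by (simp add: shift_seq_window)

lemma backward_comp_eq: "backward_comp M \<sigma> n x = orb (window (- int n) \<sigma>) (Suc n) x"
proof (induction n arbitrary: x)
  case 0
  then show ?case by (simp add: orb_Suc window_def)
next
  case (Suc n)
  have "window (- int (Suc n)) \<sigma> 0 = \<sigma> (- int (Suc n))" by (simp add: window_def)
  then show ?case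
    unfolding orb_Suc_shift[of "window (- int (Suc n)) \<sigma>" "Suc n"] window_Suc[symmetric]
    by (simp add: Suc)
qed

lemma coding_approx_eq: "coding_approx M pt v \<sigma> = ap \<sigma>"
  by (simp add: fun_eq_iff coding_approx_def ap_def backward_comp_eq window_def)

lemma ap_gap: "dist (ap \<sigma> n) (ap \<sigma> (Suc n)) = gap (Suc n) (window (- int (Suc n)) \<sigma>)"
  by (simp add: gap_def ap_def window_Suc)

text \<open>Consecutive approximations differ by a \<open>gap\<close> in a window of law
  \<open>Q\<close>, so the expected total length of the sequence is a geometric series.\<close>

lemma AE_Cauchy_ap: "AE \<sigma> in \<Lambda>. Cauchy (ap \<sigma>)"
proof -
  let ?d = "\<lambda>\<sigma> n. ennreal (dist (ap \<sigma> n) (ap \<sigma> (Suc n)))"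
  have g: "(\<lambda>\<tau>. ennreal (gap L \<tau>)) \<in> borel_measurable seqs" for L
    by (rule measurable_compose[OF measurable_gap measurable_ennreal])
  have meas: "(\<lambda>\<sigma>. ?d \<sigma> n) \<in> borel_measurable \<Lambda>" for n
    unfolding ap_gap by (rule measurable_compose[OF measurable_window_\<Lambda> g])
  have int: "(\<integral>\<^sup>+\<sigma>. ?d \<sigma> n \<partial>\<Lambda>) \<le> ennreal (C * a ^ Suc n)" for n
  proof -
    have "(\<integral>\<^sup>+\<sigma>. ?d \<sigma> n \<partial>\<Lambda>) = (\<integral>\<^sup>+\<tau>. ennreal (gap (Suc n) \<tau>) \<partial>distr \<Lambda> seqs (window (- int (Suc n))))"
      unfolding ap_gap by (rule nn_integral_distr[symmetric, OF measurable_window_\<Lambda>]) (simp only: measurable_distr_eq1 g)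
    then show ?thesis unfolding window using gap[of "Suc n"] by simp
  qed
  have "(\<integral>\<^sup>+\<sigma>. (\<Sum>n. ?d \<sigma> n) \<partial>\<Lambda>) = (\<Sum>n. \<integral>\<^sup>+\<sigma>. ?d \<sigma> n \<partial>\<Lambda>)"
    by (rule nn_integral_suminf[OF meas])
  also have "\<dots> \<le> (\<Sum>n. ennreal (C * a ^ Suc n))"
    by (intro suminf_le int) auto
  also have "\<dots> = ennreal (\<Sum>n. C * a ^ Suc n)"
  proof (rule suminf_ennreal2)
    have "summable (\<lambda>n. (C * a) * a ^ n)" using a by (intro summable_mult summable_geometric) simp
    then show "summable (\<lambda>n. C * a ^ Suc n)" by (simp add: mult.assoc)
  qed (use a C in simp)
  finally have "(\<integral>\<^sup>+\<sigma>. (\<Sum>n. ?d \<sigma> n) \<partial>\<Lambda>) \<noteq> \<infinity>"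
    by (auto simp: top_unique)
  then have "AE \<sigma> in \<Lambda>. (\<Sum>n. ?d \<sigma> n) \<noteq> \<infinity>"
    by (rule nn_integral_PInf_AE[rotated]) (intro borel_measurable_suminf_order meas)
  then show ?thesis by eventually_elim (rule Cauchy_of_summable_dist)
qed

lemma ap_in_vert:
  assumes \<sigma>: "\<sigma> \<in> path_space M v"
  shows "ap \<sigma> n \<in> vert M (tgtbar M v (\<sigma> 0))"
proof -
  let ?\<tau> = "window (- int n) \<sigma>"
  have "?\<tau> (Suc k) = \<sigma> ((- int n + int k) + 1)" for k by (simp add: window_def algebra_simps)
  then have path: "?\<tau> k \<noteq> None" "srcbar M v (?\<tau> (Suc k)) = tgtbar M v (?\<tau> k)" for k
    using \<sigma> by (auto simp: path_space_def window_def)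
  have "orb ?\<tau> k (start ?\<tau>) \<in> vert M (srcbar M v (?\<tau> k))" for k
  proof (induction k)
    case (Suc k)
    obtain e where e: "?\<tau> k = Some e" using path(1)[of k] by blast
    then have "wmap M e (orb ?\<tau> k (start ?\<tau>)) \<in> vert M (tgt M e)"
      using Suc by (intro vert_tgt) simp
    then show ?case using e path(2)[of k] by (simp add: orb_Suc)
  qed (simp add: pt)
  from this[of "Suc n"] have "ap \<sigma> n \<in> vert M (srcbar M v (?\<tau> (Suc n)))" by (simp add: ap_def)
  also have "srcbar M v (?\<tau> (Suc n)) = tgtbar M v (?\<tau> n)" by (rule path)
  also have "?\<tau> n = \<sigma> 0" by (simp add: window_def)
  finally show ?thesis .
qed


section \<open>Measurability with respect to the past\<close>

lemma cyl_eq_window: "cyl m w = window m -` cylinder w"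
  by (auto simp: cyl_def cylinder_def window_def)

lemma space_past [simp]: "space past_algebra = UNIV"
  by (simp add: past_algebra_def)

lemma sets_past: "sets (past_algebra :: (int \<Rightarrow> 'e option) measure)
    = sigma_sets UNIV {cyl m w | m w. m \<le> 0 \<and> m + int (length w) = 1}"
  unfolding past_algebra_def by (rule sets_measure_of) simp

lemma cyl_in_past: "m \<le> 0 \<Longrightarrow> m + int (length w) = 1 \<Longrightarrow> (cyl m w :: (int \<Rightarrow> 'e option) set) \<in> sets past_algebra"
  unfolding sets_past by (intro sigma_sets.Basic) blast

lemma past_subalgebra: "subalgebra \<Lambda> past_algebra"
proof -
  have "cyl m w \<in> sets \<Lambda>" for m and w :: "'e option list"
    using measurable_sets[OF measurable_window_\<Lambda> cylinder_in_sets, of m w] by (simp add: cyl_eq_window)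
  then have "sigma_sets (space \<Lambda>) {cyl m w | m w. m \<le> 0 \<and> m + int (length w) = 1} \<subseteq> sets \<Lambda>"
    by (intro sets.sigma_sets_subset) auto
  then show ?thesis by (simp add: subalgebra_def sets_past)
qed

lemma past_in_sets: "A \<in> sets past_algebra \<Longrightarrow> A \<in> sets \<Lambda>"
  using past_subalgebra by (auto simp: subalgebra_def)

lemma measurable_past_\<Lambda>: "f \<in> measurable past_algebra N \<Longrightarrow> f \<in> measurable \<Lambda> N"
  by (rule measurable_from_subalg[OF past_subalgebra])

definition past_word :: "nat \<Rightarrow> (int \<Rightarrow> 'e option) \<Rightarrow> 'e option list" where
  "past_word n \<sigma> = map (window (- int n) \<sigma>) [0..<Suc n]"

lemma measurable_past_word: "past_word n \<in> measurable past_algebra (count_space UNIV)"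
proof (subst measurable_count_space_eq2_countable, safe)
  fix w :: "'e option list"
  have "past_word n -` {w} = (if length w = Suc n then cyl (- int n) w else {})"
    by (auto simp: past_word_def cyl_eq_window mem_cylinder_iff simp del: upt_Suc)
  then show "past_word n -` {w} \<inter> space past_algebra \<in> sets past_algebra"
    using cyl_in_past[of "- int n" w] by simp
qed auto

lemma measurable_past_function:
  fixes h :: "'e option list \<Rightarrow> 'd::topological_space"
  shows "(\<lambda>\<sigma>. h (past_word n \<sigma>)) \<in> borel_measurable past_algebra"
  by (rule measurable_compose[OF measurable_past_word]) (simp only: measurable_count_space_eq1 space_borel, simp)

lemma ap_past_word: "ap \<sigma> n = fold (wbar M) (past_word n \<sigma>) (pt (srcbar M v (past_word n \<sigma> ! 0)))"
proof -
  have "past_word n \<sigma> ! 0 = window (- int n) \<sigma> 0"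
    unfolding past_word_def by (subst nth_map) (simp_all del: upt_Suc)
  then show ?thesis by (simp add: ap_def orb_def past_word_def del: upt_Suc)
qed

lemma past_word_0: "past_word 0 \<sigma> = [\<sigma> 0]"
  by (simp add: past_word_def window_def)

lemma measurable_ap: "(\<lambda>\<sigma>. ap \<sigma> n) \<in> borel_measurable past_algebra"
  unfolding ap_past_word by (rule measurable_past_function)

text \<open>Goes through the countable set of past words, because \<open>K\<close> need not be
  separable and measurability of both points alone would not give that of their distance.\<close>

lemma measurable_dist_ap: "(\<lambda>\<sigma>. dist (ap \<sigma> m) (ap \<sigma> n)) \<in> borel_measurable past_algebra"
proof -
  let ?h = "\<lambda>w. fold (wbar M) w (pt (srcbar M v (w ! 0)))"
  have "(\<lambda>\<sigma>. dist (?h (past_word m \<sigma>)) (?h (past_word n \<sigma>))) \<in> borel_measurable past_algebra"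
    by (rule measurable_compose_countable[where f = "\<lambda>w \<sigma>. dist (?h w) (?h (past_word n \<sigma>))", OF _ measurable_past_word])
       (rule measurable_past_function)
  then show ?thesis by (simp only: ap_past_word)
qed

lemma Cauchy_in_past: "{\<sigma>. Cauchy (ap \<sigma>)} \<in> sets past_algebra"
proof -
  have "{\<sigma> \<in> space past_algebra. dist (ap \<sigma> m) (ap \<sigma> n) < inverse (real (Suc j))} \<in> sets past_algebra" for m n j
    by (rule borel_measurable_less[OF measurable_dist_ap borel_measurable_const])
  then have "{\<sigma> \<in> space past_algebra. \<forall>j. \<exists>N. \<forall>m. N \<le> m \<longrightarrow> (\<forall>n. N \<le> n \<longrightarrow> dist (ap \<sigma> m) (ap \<sigma> n) < inverse (real (Suc j)))} \<in> sets past_algebra"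
    by (intro sets.sets_Collect_countable_All sets.sets_Collect_countable_Ex sets.sets_Collect_imp sets.sets_Collect_const)
  then show ?thesis by (simp add: metric_Cauchy_iff2)
qed

text \<open>Agrees with \<open>coding_map\<close> on \<open>coding_domain\<close>, but decides by
  the Cauchy property alone. The domain also restricts the future letters through
  \<open>path_space\<close>, whereas \<open>code_pt\<close> is measurable with respect to the
  past.\<close>

definition code_pt :: "(int \<Rightarrow> 'e option) \<Rightarrow> 'a" where
  "code_pt \<sigma> = (if Cauchy (ap \<sigma>) then lim (ap \<sigma>) else pt (tgtbar M v (\<sigma> 0)))"

lemma code_pt_lim: "Cauchy (ap \<sigma>) \<Longrightarrow> ap \<sigma> \<longlonglongrightarrow> code_pt \<sigma>"
  by (simp add: code_pt_def Cauchy_convergent_iff convergent_LIMSEQ_iff)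

lemma measurable_code_pt: "code_pt \<in> borel_measurable past_algebra"
proof (rule borel_measurable_LIMSEQ_metric)
  have "(\<lambda>\<sigma>. pt (tgtbar M v (past_word 0 \<sigma> ! 0))) \<in> borel_measurable past_algebra"
    by (rule measurable_past_function)
  moreover have "past_word 0 \<sigma> ! 0 = \<sigma> 0" for \<sigma> by (simp add: past_word_0)
  ultimately have pt0: "(\<lambda>\<sigma>. pt (tgtbar M v (\<sigma> 0))) \<in> borel_measurable past_algebra"
    by (simp only:)
  have "{\<sigma>. Cauchy (ap \<sigma>)} \<inter> space past_algebra \<in> sets past_algebra"
    using Cauchy_in_past by (simp only: space_past Int_UNIV_right)
  then show "(\<lambda>\<sigma>. if \<sigma> \<in> {\<sigma>. Cauchy (ap \<sigma>)} then ap \<sigma> n else pt (tgtbar M v (\<sigma> 0))) \<in> borel_measurable past_algebra" for n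
    by (rule measurable_If_set[OF measurable_ap pt0])
  fix \<sigma>
  show "(\<lambda>n. if \<sigma> \<in> {\<sigma>. Cauchy (ap \<sigma>)} then ap \<sigma> n else pt (tgtbar M v (\<sigma> 0))) \<longlonglongrightarrow> code_pt \<sigma>"
    using code_pt_lim by (cases "Cauchy (ap \<sigma>)") (simp_all add: code_pt_def)
qed

text \<open>The value of the extended edge probability at the coding point, expressed through the
  approximations. On almost every code the limit exists by uniform continuity, even if the coding
  point lies outside the vertex set.\<close>

definition next_prob :: "'e \<Rightarrow> (int \<Rightarrow> 'e option) \<Rightarrow> real" where
  "next_prob e \<sigma> = lim (\<lambda>n. prb M e (ap \<sigma> n))"

lemma measurable_prb_ap: "(\<lambda>\<sigma>. prb M e (ap \<sigma> n)) \<in> borel_measurable past_algebra"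
  by (rule measurable_compose[OF measurable_ap measurable_prb])

lemma measurable_next_prob: "next_prob e \<in> borel_measurable past_algebra"
  unfolding next_prob_def[abs_def] by (rule borel_measurable_lim_metric[OF measurable_prb_ap])

lemma uniformly_continuous_prb: "uniformly_continuous_on (vert M (src M e)) (prb M e)"
  and uniformly_continuous_wmap: "uniformly_continuous_on (vert M (src M e)) (wmap M e)"
  using uc by (auto simp: uniformly_continuous_system_def)

lemma prb_ap_tendsto:
  assumes "Cauchy (ap \<sigma>)" "\<sigma> \<in> path_space M v"
  shows "(\<lambda>n. prb M e (ap \<sigma> n)) \<longlonglongrightarrow> next_prob e \<sigma>"
proof -
  have "convergent (\<lambda>n. prb M e (ap \<sigma> n))"
  proof (cases "tgtbar M v (\<sigma> 0) = src M e")
    case True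
    have "ap \<sigma> n \<in> vert M (src M e)" for n using ap_in_vert[OF assms(2)] True by simp
    with assms(1) show ?thesis by (rule uniformly_continuous_convergent[OF uniformly_continuous_prb])
  next
    case False
    then have "prb M e (ap \<sigma> n) = 0" for n
      using ap_in_vert[OF assms(2)] prb_eq_0 by metis
    then show ?thesis by (simp add: convergent_const)
  qed
  then show ?thesis by (simp add: next_prob_def convergent_LIMSEQ_iff)
qed

lemma next_prob_bounds:
  assumes "Cauchy (ap \<sigma>)" "\<sigma> \<in> path_space M v"
  shows "0 \<le> next_prob e \<sigma>" "next_prob e \<sigma> \<le> 1"
proof -
  note lim = prb_ap_tendsto[OF assms, of e]
  show "0 \<le> next_prob e \<sigma>" by (rule LIMSEQ_le_const[OF lim]) simp
  show "next_prob e \<sigma> \<le> 1" by (rule LIMSEQ_le_const2[OF lim]) simp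
qed

lemma AE_good: "AE \<sigma> in \<Lambda>. Cauchy (ap \<sigma>) \<and> \<sigma> \<in> path_space M v"
  using AE_Cauchy_ap AE_path_space by eventually_elim simp

lemma coding_domain_iff: "\<sigma> \<in> coding_domain M pt v \<longleftrightarrow> Cauchy (ap \<sigma>) \<and> \<sigma> \<in> path_space M v"
  by (auto simp: coding_domain_def coding_approx_eq Cauchy_convergent_iff)

lemma coding_map_eq: "\<sigma> \<in> coding_domain M pt v \<Longrightarrow> coding_map M pt v \<sigma> = code_pt \<sigma>"
  by (simp add: coding_map_def coding_approx_eq code_pt_def coding_domain_iff)

text \<open>If the code ends in the source of \<open>e\<close>, all approximations lie in that
  vertex set and continuity on its closure applies. Otherwise they lie in another vertex set and
  both sides are 0.\<close>

lemma next_prob_eq_extension: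
  assumes \<sigma>: "Cauchy (ap \<sigma>)" "\<sigma> \<in> path_space M v"
  shows "next_prob e \<sigma> = prb_extension M e (coding_map M pt v \<sigma>) * indicator (ending_in M v (src M e)) \<sigma>"
proof (cases "tgtbar M v (\<sigma> 0) = src M e")
  case True
  let ?X = "vert M (src M e)"
  have dom: "\<sigma> \<in> coding_domain M pt v" using \<sigma> by (simp add: coding_domain_iff)
  have in_X: "ap \<sigma> n \<in> ?X" for n using ap_in_vert[OF \<sigma>(2)] True by simp
  have lim: "ap \<sigma> \<longlonglongrightarrow> code_pt \<sigma>" by (rule code_pt_lim[OF \<sigma>(1)])
  have cl: "code_pt \<sigma> \<in> closure ?X"
    unfolding closure_sequential using in_X lim by blast
  have "continuous_on (closure ?X) (prb_extension M e)"
    by (rule prb_extension_properties(1)[OF uniformly_continuous_prb])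
  then have "(prb_extension M e \<circ> ap \<sigma>) \<longlonglongrightarrow> prb_extension M e (code_pt \<sigma>)"
    unfolding continuous_on_sequentially using cl lim in_X closure_subset[of ?X] by blast
  then have "(\<lambda>n. prb_extension M e (ap \<sigma> n)) \<longlonglongrightarrow> prb_extension M e (code_pt \<sigma>)"
    by (simp only: o_def)
  then have "(\<lambda>n. prb M e (ap \<sigma> n)) \<longlonglongrightarrow> prb_extension M e (code_pt \<sigma>)"
    using prb_extension_properties(2)[OF uniformly_continuous_prb in_X] by simp
  then have "next_prob e \<sigma> = prb_extension M e (code_pt \<sigma>)"
    using prb_ap_tendsto[OF \<sigma>] LIMSEQ_unique by blast
  then show ?thesis using True \<sigma> coding_map_eq[OF dom] by (simp add: ending_in_def)
next
  case False
  then have "prb M e (ap \<sigma> n) = 0" for n using ap_in_vert[OF \<sigma>(2)] prb_eq_0 by metis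
  then have "next_prob e \<sigma> = 0" by (simp add: next_prob_def)
  then show ?thesis using False by (simp add: ending_in_def)
qed


section \<open>Conditional probabilities of the two-sided code\<close>

lemma next_in_sets: "{\<sigma>. \<sigma> k = s} \<in> sets \<Lambda>"
  using measurable_sets[OF measurable_biseqs_component, of "{s}" k] \<Lambda>(2) by (simp add: vimage_def)

lemma integrable_next_prob: "integrable \<Lambda> (next_prob e)"
proof (rule \<Lambda>.integrable_const_bound[where B = 1])
  show "AE \<sigma> in \<Lambda>. norm (next_prob e \<sigma>) \<le> 1"
    using AE_good by eventually_elim (use next_prob_bounds in auto)
qed (rule measurable_past_\<Lambda>[OF measurable_next_prob])

text \<open>The integrals with \<open>ap \<sigma> n\<close> in place of the limit converge in two
  ways: to the right side by dominated convergence, to the left side by the transition estimate in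
  the window from \<open>-n\<close>.\<close>

lemma cyl_next_prob:
  assumes m: "m \<le> 0" "m + int (length w) = 1"
  shows "measure \<Lambda> (cyl m w \<inter> {\<sigma>. \<sigma> 1 = Some e}) = (\<integral>\<sigma>. indicator (cyl m w) \<sigma> * next_prob e \<sigma> \<partial>\<Lambda>)"
proof -
  let ?T = "\<lambda>n. \<integral>\<sigma>. indicator (cyl m w) \<sigma> * prb M e (ap \<sigma> n) \<partial>\<Lambda>"
  have ind: "(indicator (cyl m w) :: _ \<Rightarrow> real) \<in> borel_measurable \<Lambda>"
    by (rule borel_measurable_indicator[OF past_in_sets[OF cyl_in_past[OF m]]])
  have lim1: "?T \<longlonglongrightarrow> (\<integral>\<sigma>. indicator (cyl m w) \<sigma> * next_prob e \<sigma> \<partial>\<Lambda>)"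
  proof (rule integral_dominated_convergence[where w = "\<lambda>_. 1"])
    show "(\<lambda>\<sigma>. indicator (cyl m w) \<sigma> * next_prob e \<sigma>) \<in> borel_measurable \<Lambda>"
      by (rule borel_measurable_times[OF ind measurable_past_\<Lambda>[OF measurable_next_prob]])
    show "(\<lambda>\<sigma>. indicator (cyl m w) \<sigma> * prb M e (ap \<sigma> n)) \<in> borel_measurable \<Lambda>" for n
      by (rule borel_measurable_times[OF ind measurable_past_\<Lambda>[OF measurable_prb_ap]])
    show "AE \<sigma> in \<Lambda>. (\<lambda>n. indicator (cyl m w) \<sigma> * prb M e (ap \<sigma> n)) \<longlonglongrightarrow> indicator (cyl m w) \<sigma> * next_prob e \<sigma>"
      using AE_good by eventually_elim (intro tendsto_mult tendsto_const prb_ap_tendsto, auto)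
    show "AE \<sigma> in \<Lambda>. norm (indicator (cyl m w) \<sigma> * prb M e (ap \<sigma> n)) \<le> 1" for n
      by (auto simp: indicator_def)
  qed simp
  have lim2: "?T \<longlonglongrightarrow> measure \<Lambda> (cyl m w \<inter> {\<sigma>. \<sigma> 1 = Some e})"
  proof (rule LIMSEQ_I)
    fix \<epsilon> :: real assume \<epsilon>: "0 < \<epsilon>"
    obtain L0 where L0: "\<And>L X. L0 \<le> L \<Longrightarrow>
        \<bar>measure Q {\<tau>. map \<tau> [0..<L] \<in> X \<and> \<tau> L = Some e} - (\<integral>\<tau>. transition e X L \<tau> \<partial>Q)\<bar> \<le> \<epsilon> / 2"
      using trans[of "\<epsilon> / 2" e] \<epsilon> by auto
    have "norm (?T n - measure \<Lambda> (cyl m w \<inter> {\<sigma>. \<sigma> 1 = Some e})) < \<epsilon>" if n: "max L0 (length w) \<le> n" for n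
    proof -
      let ?L = "Suc n"
      \<comment> \<open>The past cylinder as seen from \<open>-n\<close>: the window up to position
        0 has \<open>n + 1\<close> letters, of which the last \<open>length w\<close> are
        prescribed. Position 1 has index \<open>Suc n\<close> in this window.\<close>
      define X where "X = {u. drop (?L - length w) u = w}"
      have X: "map (window (- int n) \<sigma>) [0..<?L] \<in> X \<longleftrightarrow> \<sigma> \<in> cyl m w" for \<sigma>
      proof -
        have "drop (?L - length w) (map (window (- int n) \<sigma>) [0..<?L]) = map (window m \<sigma>) [0..<length w]"
        proof (rule nth_equalityI)
          fix i assume i: "i < length (drop (?L - length w) (map (window (- int n) \<sigma>) [0..<?L]))"
          have m_eq: "m = 1 - int (length w)" using m by simp
          have "- int n + int (?L - length w + i) = m + int i"
            using n m_eq by (simp add: of_nat_diff)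
          show "drop (?L - length w) (map (window (- int n) \<sigma>) [0..<?L]) ! i = map (window m \<sigma>) [0..<length w] ! i"
          proof -
            have i': "i < length w" "?L - length w + i < ?L" using i n by auto
            have "drop (?L - length w) (map (window (- int n) \<sigma>) [0..<?L]) ! i
                = map (window (- int n) \<sigma>) [0..<?L] ! (?L - length w + i)"
              using n by (intro nth_drop) (simp del: upt_Suc)
            also have "\<dots> = window (- int n) \<sigma> (?L - length w + i)"
              using i'(2) by (subst nth_map) (simp_all del: upt_Suc)
            also have "\<dots> = window m \<sigma> i"
              unfolding window_def using \<open>- int n + int (?L - length w + i) = m + int i\<close> by (simp only:)
            finally show ?thesis using i'(1) by simp
          qed
        qed (use n in simp)
        then show ?thesis by (simp add: X_def cyl_eq_window mem_cylinder_iff)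
      qed
      have ev: "window (- int n) -` {\<tau>. map \<tau> [0..<?L] \<in> X \<and> \<tau> ?L = Some e} = cyl m w \<inter> {\<sigma>. \<sigma> 1 = Some e}"
        using X by (auto simp: window_def simp del: upt_Suc)
      have 1: "measure \<Lambda> (cyl m w \<inter> {\<sigma>. \<sigma> 1 = Some e}) = measure Q {\<tau>. map \<tau> [0..<?L] \<in> X \<and> \<tau> ?L = Some e}"
        using emeasure_window[OF transition_event_in_sets, of "- int n" ?L X "Some e"]
        unfolding ev by (simp only: measure_def)
      have "(\<integral>\<tau>. transition e X ?L \<tau> \<partial>Q) = (\<integral>\<tau>. transition e X ?L \<tau> \<partial>distr \<Lambda> seqs (window (- int n)))"
        by (simp only: window)
      also have "\<dots> = (\<integral>\<sigma>. transition e X ?L (window (- int n) \<sigma>) \<partial>\<Lambda>)"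
        by (rule integral_distr[OF measurable_window_\<Lambda> measurable_transition])
      also have "\<dots> = ?T n"
        by (intro Bochner_Integration.integral_cong) (auto simp: transition_def X ap_def indicator_def simp del: upt_Suc)
      finally have 2: "(\<integral>\<tau>. transition e X ?L \<tau> \<partial>Q) = ?T n" .
      have "L0 \<le> ?L" using n by simp
      from L0[OF this, of X] show ?thesis using \<epsilon> unfolding 1 2[symmetric] real_norm_def by linarith
    qed
    then show "\<exists>N. \<forall>n\<ge>N. norm (?T n - measure \<Lambda> (cyl m w \<inter> {\<sigma>. \<sigma> 1 = Some e})) < \<epsilon>" by blast
  qed
  show ?thesis by (rule LIMSEQ_unique[OF lim2 lim1])
qed

text \<open>Both sides are finite measures in \<open>A\<close>, restricted to the past
  \<sigma>-algebra, and they agree on its generating cylinders. These all end at position 0, so any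
  two are nested or disjoint.\<close>

lemma past_next_prob:
  assumes A: "A \<in> sets past_algebra"
  shows "emeasure \<Lambda> (A \<inter> {\<sigma>. \<sigma> 1 = Some e}) = (\<integral>\<^sup>+\<sigma>. ennreal (next_prob e \<sigma>) * indicator A \<sigma> \<partial>\<Lambda>)"
proof -
  let ?E = "{\<sigma>. \<sigma> 1 = Some e} :: (int \<Rightarrow> 'e option) set"
  let ?G = "{cyl m w | m w. m \<le> 0 \<and> m + int (length w) = 1} :: (int \<Rightarrow> 'e option) set set"
  define N1 where "N1 = restr_to_subalg (density \<Lambda> (indicator ?E)) past_algebra"
  define N2 where "N2 = restr_to_subalg (density \<Lambda> (\<lambda>\<sigma>. ennreal (next_prob e \<sigma>))) past_algebra"
  have sub: "subalgebra (density \<Lambda> f) past_algebra" for f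
    using past_subalgebra by (simp add: subalgebra_def)
  have np: "(\<lambda>\<sigma>. ennreal (next_prob e \<sigma>)) \<in> borel_measurable \<Lambda>"
    by (rule measurable_compose[OF measurable_past_\<Lambda>[OF measurable_next_prob] measurable_ennreal])
  have N1: "emeasure N1 B = emeasure \<Lambda> (B \<inter> ?E)" if "B \<in> sets past_algebra" for B
    unfolding N1_def emeasure_restr_to_subalg[OF sub that] emeasure_restricted[OF next_in_sets past_in_sets[OF that]]
    by (simp add: Int_commute)
  have N2: "emeasure N2 B = (\<integral>\<^sup>+\<sigma>. ennreal (next_prob e \<sigma>) * indicator B \<sigma> \<partial>\<Lambda>)" if "B \<in> sets past_algebra" for B
    unfolding N2_def emeasure_restr_to_subalg[OF sub that] by (rule emeasure_density[OF np past_in_sets[OF that]])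
  have eq: "emeasure N1 B = emeasure N2 B" if B: "B \<in> ?G" for B
  proof -
    obtain m w where B_eq: "B = cyl m w" and m: "m \<le> 0" "m + int (length w) = 1" using B by blast
    have B': "B \<in> sets past_algebra" using cyl_in_past[OF m] B_eq by simp
    have int: "integrable \<Lambda> (\<lambda>\<sigma>. indicator B \<sigma> * next_prob e \<sigma>)"
      using integrable_mult_indicator[OF past_in_sets[OF B'] integrable_next_prob] by simp
    have "emeasure N1 B = emeasure \<Lambda> (B \<inter> ?E)" by (rule N1[OF B'])
    also have "\<dots> = ennreal (\<integral>\<sigma>. indicator B \<sigma> * next_prob e \<sigma> \<partial>\<Lambda>)"
      unfolding B_eq \<Lambda>.emeasure_eq_measure cyl_next_prob[OF m] ..
    also have "\<dots> = (\<integral>\<^sup>+\<sigma>. ennreal (indicator B \<sigma> * next_prob e \<sigma>) \<partial>\<Lambda>)"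
    proof (rule nn_integral_eq_integral[symmetric, OF int])
      show "AE \<sigma> in \<Lambda>. 0 \<le> indicator B \<sigma> * next_prob e \<sigma>"
        using AE_good by eventually_elim (use next_prob_bounds in auto)
    qed
    also have "\<dots> = emeasure N2 B"
      unfolding N2[OF B'] by (intro nn_integral_cong) (auto simp: indicator_def)
    finally show ?thesis .
  qed
  have stable: "Int_stable (insert {} ?G)"
  proof -
    have le: "cyl m w \<inter> cyl m' w' \<in> insert {} ?G"
      if m: "m \<le> 0" "m + int (length w) = 1" "m' \<le> 0" "m' + int (length w') = 1" "m \<le> m'" for m m' and w w' :: "'e option list"
    proof (cases "cyl m w \<inter> cyl m' w' = {}")
      case False
      then obtain \<sigma> where \<sigma>: "\<sigma> \<in> cyl m w" "\<sigma> \<in> cyl m' w'" by blast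
      have "cyl m w \<subseteq> cyl m' w'"
      proof
        fix \<rho> assume \<rho>: "\<rho> \<in> cyl m w"
        have "\<rho> (m' + int k) = w' ! k" if "k < length w'" for k
        proof -
          define i where "i = nat (m' - m) + k"
          have i: "m' + int k = m + int i" "i < length w" using m that by (auto simp: i_def)
          then have "\<rho> (m' + int k) = \<sigma> (m' + int k)" using \<rho> \<sigma>(1) by (simp add: cyl_def)
          then show ?thesis using \<sigma>(2) that by (simp add: cyl_def)
        qed
        then show "\<rho> \<in> cyl m' w'" by (simp add: cyl_def)
      qed
      then have "cyl m w \<inter> cyl m' w' = cyl m w" by blast
      then show ?thesis using m by blast
    qed simp
    show ?thesis
    proof (rule Int_stableI)
      fix X Y assume XY: "X \<in> insert {} ?G" "Y \<in> insert {} ?G"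
      show "X \<inter> Y \<in> insert {} ?G"
      proof (cases "X = {} \<or> Y = {}")
        case False
        then obtain m w m' w' where X: "X = cyl m w" "m \<le> 0" "m + int (length w) = 1"
          and Y: "Y = cyl m' w'" "m' \<le> 0" "m' + int (length w') = 1" using XY by blast
        show ?thesis
        proof (cases "m \<le> m'")
          case True
          show ?thesis unfolding X(1) Y(1) by (rule le[OF X(2,3) Y(2,3) True])
        next
          case False
          then have "m' \<le> m" by simp
          then show ?thesis unfolding X(1) Y(1) Int_commute[of "cyl m w"] by (rule le[OF Y(2,3) X(2,3)])
        qed
      qed auto
    qed
  qed
  have gen: "sets past_algebra = sigma_sets UNIV (insert {} ?G)"
  proof
    show "sets past_algebra \<subseteq> sigma_sets UNIV (insert {} ?G)"
      unfolding sets_past by (rule sigma_sets_subseteq) blast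
    have "insert {} ?G \<subseteq> sets past_algebra" using cyl_in_past by auto
    then show "sigma_sets UNIV (insert {} ?G) \<subseteq> sets past_algebra"
      using sets.sigma_sets_subset[of "insert {} ?G" past_algebra] by simp
  qed
  have "N1 = N2"
  \<comment> \<open>A generating cylinder prescribes at least the letter at 0, so the whole space is
    not one of them and is covered by the one-letter cylinders.\<close>
  proof (rule measure_eqI_generator_eq_countable[OF stable, where \<Omega> = UNIV and A = "range (\<lambda>s. cyl 0 [s])"])
    show "sets N1 = sigma_sets UNIV (insert {} ?G)" "sets N2 = sigma_sets UNIV (insert {} ?G)"
      unfolding gen[symmetric] N1_def N2_def by (simp_all add: sets_restr_to_subalg sub)
    show "countable (range (\<lambda>s. cyl 0 [s :: 'e option]))" by simp
    show "\<Union> (range (\<lambda>s. cyl 0 [s])) = (UNIV :: (int \<Rightarrow> 'e option) set)" by (auto simp: cyl_def)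
    show "range (\<lambda>s. cyl 0 [s]) \<subseteq> insert {} ?G" by fastforce
    show "emeasure N1 X = emeasure N2 X" if "X \<in> insert {} ?G" for X using that eq by auto
    show "emeasure N1 X \<noteq> \<infinity>" if "X \<in> range (\<lambda>s. cyl 0 [s])" for X
    proof -
      have "X \<in> sets past_algebra" using that cyl_in_past[of 0] by auto
      then show ?thesis unfolding N1[OF \<open>X \<in> sets past_algebra\<close>] by simp
    qed
  qed simp
  then show ?thesis using N1[OF A] N2[OF A] by simp
qed

text \<open>\<open>past_next_prob\<close> identifies \<open>next_prob\<close> as the conditional
  expectation given the past, and on almost every code it equals the extended probability at the
  coding point.\<close>

lemma equilibrium_candidate: "\<Lambda> \<in> equilibrium_candidates M pt v"
proof -
  have "distr \<Lambda> code_space shift = distr \<Lambda> biseqs shift"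
    by (rule distr_cong) (simp_all add: sets_code_space)
  then have inv: "\<Lambda> \<in> shift_invariant_measures"
    using \<Lambda> by (simp add: shift_invariant_measures_def sets_code_space distr_shift)
  have ps: "path_space M v \<in> sets \<Lambda>"
  proof -
    have "{\<sigma> \<in> space \<Lambda>. \<forall>n. \<sigma> n \<noteq> None \<and> srcbar M v (\<sigma> (n + 1)) = tgtbar M v (\<sigma> n)} \<in> sets \<Lambda>"
    proof (intro sets.sets_Collect_countable_All)
      fix n :: int
      have "{\<sigma> \<in> space \<Lambda>. \<sigma> n \<noteq> None \<and> srcbar M v (\<sigma> (n + 1)) = tgtbar M v (\<sigma> n)}
          = (\<Union>s\<in>- {None}. \<Union>t\<in>{t. srcbar M v t = tgtbar M v s}. {\<sigma>. \<sigma> n = s} \<inter> {\<sigma>. \<sigma> (n + 1) = t})"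
        by auto
      also have "\<dots> \<in> sets \<Lambda>"
        by (intro sets.countable_UN' image_subsetI sets.Int next_in_sets countableI_type)
      finally show "{\<sigma> \<in> space \<Lambda>. \<sigma> n \<noteq> None \<and> srcbar M v (\<sigma> (n + 1)) = tgtbar M v (\<sigma> n)} \<in> sets \<Lambda>" .
    qed
    then show ?thesis by (simp add: path_space_def)
  qed
  have cd_eq: "coding_domain M pt v = {\<sigma>. Cauchy (ap \<sigma>)} \<inter> path_space M v"
    using coding_domain_iff by blast
  have cd: "coding_domain M pt v \<in> sets \<Lambda>"
    unfolding cd_eq by (intro sets.Int ps past_in_sets Cauchy_in_past)
  have dom: "emeasure \<Lambda> (coding_domain M pt v) = 1"
    using AE_good cd unfolding coding_domain_iff[symmetric]
    by (intro \<Lambda>.emeasure_eq_1_AE) auto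
  interpret sub: finite_measure_subalgebra \<Lambda> past_algebra
    by unfold_locales (rule past_subalgebra)
  have cond: "AE \<sigma> in \<Lambda>. real_cond_exp \<Lambda> past_algebra (indicator (cyl 1 [Some e])) \<sigma> = next_prob e \<sigma>" for e
  proof (rule sub.real_cond_exp_charact)
    have E: "cyl 1 [Some e] = {\<sigma>. \<sigma> 1 = Some e}" by (auto simp: cyl_def)
    have E_sets: "cyl 1 [Some e] \<in> sets \<Lambda>" unfolding E by (rule next_in_sets)
    show "integrable \<Lambda> (indicator (cyl 1 [Some e]) :: _ \<Rightarrow> real)"
      using E_sets by (simp add: \<Lambda>.emeasure_eq_measure)
    show "integrable \<Lambda> (next_prob e)" by (rule integrable_next_prob)
    show "next_prob e \<in> borel_measurable past_algebra" by (rule measurable_next_prob)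
    fix A :: "(int \<Rightarrow> 'e option) set" assume A: "A \<in> sets past_algebra"
    have A': "A \<in> sets \<Lambda>" by (rule past_in_sets[OF A])
    have "(\<integral>\<sigma>\<in>A. indicator (cyl 1 [Some e]) \<sigma> \<partial>\<Lambda>) = (\<integral>\<sigma>. indicator (A \<inter> {\<sigma>. \<sigma> 1 = Some e}) \<sigma> \<partial>\<Lambda>)"
      unfolding set_lebesgue_integral_def E by (intro Bochner_Integration.integral_cong) (auto simp: indicator_def)
    also have "\<dots> = measure \<Lambda> (A \<inter> {\<sigma>. \<sigma> 1 = Some e})"
      by (simp only: Bochner_Integration.integral_indicator space_\<Lambda> Int_UNIV_right)
    also have "\<dots> = (\<integral>\<sigma>. indicator A \<sigma> * next_prob e \<sigma> \<partial>\<Lambda>)"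
    proof -
      have int: "integrable \<Lambda> (\<lambda>\<sigma>. indicator A \<sigma> * next_prob e \<sigma>)"
        using integrable_mult_indicator[OF A' integrable_next_prob] by simp
      have nn: "AE \<sigma> in \<Lambda>. 0 \<le> indicator A \<sigma> * next_prob e \<sigma>"
        using AE_good by eventually_elim (use next_prob_bounds in auto)
      have "ennreal (measure \<Lambda> (A \<inter> {\<sigma>. \<sigma> 1 = Some e})) = (\<integral>\<^sup>+\<sigma>. ennreal (indicator A \<sigma> * next_prob e \<sigma>) \<partial>\<Lambda>)"
        unfolding \<Lambda>.emeasure_eq_measure[symmetric] past_next_prob[OF A]
        by (intro nn_integral_cong) (auto simp: indicator_def)
      also have "\<dots> = ennreal (\<integral>\<sigma>. indicator A \<sigma> * next_prob e \<sigma> \<partial>\<Lambda>)"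
        by (rule nn_integral_eq_integral[OF int nn])
      finally show ?thesis
        by (subst (asm) ennreal_inj) (auto intro: integral_nonneg_AE nn)
    qed
    finally show "(\<integral>\<sigma>\<in>A. indicator (cyl 1 [Some e]) \<sigma> \<partial>\<Lambda>) = (\<integral>\<sigma>\<in>A. next_prob e \<sigma> \<partial>\<Lambda>)"
      by (simp add: set_lebesgue_integral_def)
  qed
  have "AE \<sigma> in \<Lambda>. real_cond_exp \<Lambda> past_algebra (indicator (cyl 1 [Some e])) \<sigma>
      = prb_extension M e (coding_map M pt v \<sigma>) * indicator (ending_in M v (src M e)) \<sigma>" for e
    using cond[of e] AE_good by eventually_elim (simp add: next_prob_eq_extension)
  then show ?thesis using inv dom by (simp add: equilibrium_candidates_def)
qed

end

section \<open>The invariant measure of a generating class\<close>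

context code_measure
begin

text \<open>The codes for which the system itself, without extension to closures, acts on the coding
  point: the maps and probabilities are known to be continuous only relative to a vertex
  set.\<close>

definition regular :: "(int \<Rightarrow> 'e option) set" where
  "regular = {\<sigma>. Cauchy (ap \<sigma>) \<and> code_pt \<sigma> \<in> vert M (tgtbar M v (\<sigma> 0))}"

lemma regular_in_past: "regular \<in> sets past_algebra"
proof -
  have eq: "regular = {\<sigma>. Cauchy (ap \<sigma>)} \<inter> (\<Union>s. cyl 0 [s] \<inter> (code_pt -` vert M (tgtbar M v s) \<inter> space past_algebra))"
    by (auto simp: regular_def cyl_def)
  show ?thesis
    unfolding eq
    by (intro sets.Int Cauchy_in_past sets.countable_UN' image_subsetI countableI_type
        cyl_in_past measurable_sets[OF measurable_code_pt vert_borel]) auto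
qed

text \<open>The approximations and their limit lie in the source vertex set of the next edge, so
  continuity of its map commutes with the limit; the image lies in the target vertex set, which
  keeps the shifted code regular.\<close>

lemma regular_step:
  assumes "\<sigma> \<in> regular" "\<sigma> \<in> path_space M v"
  shows "shift \<sigma> \<in> regular" "code_pt (shift \<sigma>) = wbar M (\<sigma> 1) (code_pt \<sigma>)"
proof -
  have cau: "Cauchy (ap \<sigma>)" and pos: "code_pt \<sigma> \<in> vert M (tgtbar M v (\<sigma> 0))"
    using assms by (auto simp: regular_def)
  have "\<sigma> (0 + 1) \<noteq> None" "srcbar M v (\<sigma> (0 + 1)) = tgtbar M v (\<sigma> 0)"
    using assms(2) unfolding path_space_def by blast+
  then obtain e where e: "\<sigma> 1 = Some e" "src M e = tgtbar M v (\<sigma> 0)" by auto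
  have ap_shift: "ap (shift \<sigma>) (Suc n) = wmap M e (ap \<sigma> n)" for n
  proof -
    have "window (- int (Suc n)) (shift \<sigma>) = window (- int n) \<sigma>" by (simp add: shift_window)
    moreover have "window (- int n) \<sigma> (Suc n) = \<sigma> 1" by (simp add: window_def)
    ultimately show ?thesis using e by (simp only: ap_def orb_Suc[of _ "Suc n"] wbar.simps)
  qed
  have in_X: "ap \<sigma> n \<in> vert M (src M e)" for n using ap_in_vert[OF assms(2)] e by simp
  have "continuous_on (vert M (src M e)) (wmap M e)"
    by (rule uniformly_continuous_imp_continuous[OF uniformly_continuous_wmap])
  then have "(wmap M e \<circ> ap \<sigma>) \<longlonglongrightarrow> wmap M e (code_pt \<sigma>)"
    unfolding continuous_on_sequentially using in_X pos e(2) code_pt_lim[OF cau] by auto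
  then have "(\<lambda>n. ap (shift \<sigma>) (Suc n)) \<longlonglongrightarrow> wmap M e (code_pt \<sigma>)"
    by (simp only: ap_shift o_def)
  then have lim: "ap (shift \<sigma>) \<longlonglongrightarrow> wmap M e (code_pt \<sigma>)"
    by (simp only: filterlim_sequentially_Suc)
  then have cau': "Cauchy (ap (shift \<sigma>))" by (rule LIMSEQ_imp_Cauchy)
  have pt_eq: "code_pt (shift \<sigma>) = wmap M e (code_pt \<sigma>)"
    by (rule LIMSEQ_unique[OF code_pt_lim[OF cau'] lim])
  show "code_pt (shift \<sigma>) = wbar M (\<sigma> 1) (code_pt \<sigma>)" using pt_eq e by simp
  have "wmap M e (code_pt \<sigma>) \<in> vert M (tgt M e)" using pos e by (intro vert_tgt) simp
  then show "shift \<sigma> \<in> regular"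
    using cau' pt_eq e by (simp add: regular_def shift_def)
qed

lemma next_prob_regular:
  assumes "\<sigma> \<in> regular" "\<sigma> \<in> path_space M v"
  shows "next_prob e \<sigma> = prb M e (code_pt \<sigma>)"
proof -
  have cau: "Cauchy (ap \<sigma>)" and pos: "code_pt \<sigma> \<in> vert M (tgtbar M v (\<sigma> 0))"
    using assms by (auto simp: regular_def)
  show ?thesis
  proof (cases "tgtbar M v (\<sigma> 0) = src M e")
    case True
    have in_X: "ap \<sigma> n \<in> vert M (src M e)" for n using ap_in_vert[OF assms(2)] True by simp
    have "continuous_on (vert M (src M e)) (prb M e)"
      by (rule uniformly_continuous_imp_continuous[OF uniformly_continuous_prb])
    then have "(prb M e \<circ> ap \<sigma>) \<longlonglongrightarrow> prb M e (code_pt \<sigma>)"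
      unfolding continuous_on_sequentially using in_X pos True code_pt_lim[OF cau] by auto
    then have "(\<lambda>n. prb M e (ap \<sigma> n)) \<longlonglongrightarrow> prb M e (code_pt \<sigma>)" by (simp only: o_def)
    then show ?thesis using prb_ap_tendsto[OF cau assms(2)] LIMSEQ_unique by blast
  next
    case False
    then have "prb M e (ap \<sigma> n) = 0" for n using ap_in_vert[OF assms(2)] prb_eq_0 by metis
    moreover have "prb M e (code_pt \<sigma>) = 0" by (rule prb_eq_0[OF pos]) (use False in simp)
    ultimately show ?thesis by (simp add: next_prob_def)
  qed
qed

text \<open>If almost no code were regular, every set in the non-degeneracy condition would be null,
  since \<open>code_pt\<close> and \<open>coding_map\<close> agree on almost every code.\<close>

lemma regular_positive:
  assumes "non_degenerate M pt v"
  shows "emeasure \<Lambda> regular \<noteq> 0"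
proof
  assume zero: "emeasure \<Lambda> regular = 0"
  obtain j where j: "emeasure \<Lambda> (ending_in M v j \<inter> coding_map M pt v -` vert M j) > 0"
    using assms equilibrium_candidate unfolding non_degenerate_def by blast
  have "AE \<sigma> in \<Lambda>. \<sigma> \<notin> regular"
    using zero past_in_sets[OF regular_in_past] by (intro AE_not_in null_setsI)
  then have "AE \<sigma> in \<Lambda>. \<sigma> \<notin> ending_in M v j \<inter> coding_map M pt v -` vert M j"
    using AE_good
  proof eventually_elim
    case (elim \<sigma>)
    then have "\<sigma> \<in> coding_domain M pt v" by (simp add: coding_domain_iff)
    then show ?case using elim coding_map_eq by (auto simp: regular_def ending_in_def)
  qed
  then have "emeasure \<Lambda> (ending_in M v j \<inter> coding_map M pt v -` vert M j) = 0"
  \<comment> \<open>A nonmeasurable set has \<open>emeasure\<close> 0 by convention, which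
    contradicts the positivity in \<open>j\<close> just as well.\<close>
  proof (cases "ending_in M v j \<inter> coding_map M pt v -` vert M j \<in> sets \<Lambda>")
    case True
    have "AE \<sigma> in \<Lambda>. (\<sigma> \<in> ending_in M v j \<inter> coding_map M pt v -` vert M j) = (\<sigma> \<in> {})"
      using \<open>AE \<sigma> in \<Lambda>. \<sigma> \<notin> ending_in M v j \<inter> coding_map M pt v -` vert M j\<close> by eventually_elim simp
    then have "emeasure \<Lambda> (ending_in M v j \<inter> coding_map M pt v -` vert M j) = emeasure \<Lambda> {}"
      by (rule emeasure_eq_AE[OF _ True sets.empty_sets])
    then show ?thesis by simp
  qed (rule emeasure_notin_sets)
  then show False using less_irrefl[of "0 :: ennreal"] j by (simp only:)
qed

lemma measurable_shift_\<Lambda>: "shift \<in> measurable \<Lambda> \<Lambda>"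
  by (subst measurable_cong_sets[OF \<Lambda>(2) \<Lambda>(2)]) (rule measurable_shift)

lemma emeasure_shift: "A \<in> sets \<Lambda> \<Longrightarrow> emeasure \<Lambda> (shift -` A) = emeasure \<Lambda> A"
proof -
  assume A: "A \<in> sets \<Lambda>"
  have "emeasure \<Lambda> A = emeasure (distr \<Lambda> biseqs shift) A" by (simp only: distr_shift)
  also have "\<dots> = emeasure \<Lambda> (shift -` A \<inter> space \<Lambda>)"
    using A measurable_shift by (intro emeasure_distr) (simp_all only: measurable_cong_sets[OF \<Lambda>(2) refl] \<Lambda>(2))
  finally show ?thesis by simp
qed

text \<open>The set of regular codes is forward invariant under the measure preserving shift, hence invariant
  up to a null set.\<close>

lemma AE_regular_shift: "AE \<sigma> in \<Lambda>. shift \<sigma> \<in> regular \<longleftrightarrow> \<sigma> \<in> regular"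
proof -
  have R: "regular \<in> sets \<Lambda>" by (rule past_in_sets[OF regular_in_past])
  have R': "shift -` regular \<in> sets \<Lambda>" using measurable_sets[OF measurable_shift_\<Lambda> R] by simp
  have "emeasure \<Lambda> (regular \<inter> shift -` regular) = emeasure \<Lambda> regular"
  proof (rule emeasure_eq_AE)
    show "AE \<sigma> in \<Lambda>. (\<sigma> \<in> regular \<inter> shift -` regular) = (\<sigma> \<in> regular)"
      using AE_path_space by eventually_elim (auto dest: regular_step(1))
  qed (use R R' in auto)
  then have "measure \<Lambda> (shift -` regular - regular) = 0"
  proof -
    have "measure \<Lambda> (shift -` regular - regular) = measure \<Lambda> (shift -` regular) - measure \<Lambda> (shift -` regular \<inter> regular)"
      by (rule \<Lambda>.finite_measure_Diff'[OF R' R])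
    also have "measure \<Lambda> (shift -` regular) = measure \<Lambda> regular"
      unfolding measure_def emeasure_shift[OF R] ..
    also have "measure \<Lambda> (shift -` regular \<inter> regular) = measure \<Lambda> regular"
      unfolding measure_def Int_commute[of "shift -` regular"] \<open>emeasure \<Lambda> (regular \<inter> shift -` regular) = emeasure \<Lambda> regular\<close> ..
    finally show ?thesis by simp
  qed
  then have "AE \<sigma> in \<Lambda>. \<sigma> \<notin> shift -` regular - regular"
    using R R' by (intro AE_not_in null_setsI) (auto simp: \<Lambda>.emeasure_eq_measure)
  with AE_path_space show ?thesis
    by eventually_elim (auto dest: regular_step(1))
qed

definition limit_measure :: "'a measure" where
  "limit_measure = distr (uniform_measure \<Lambda> regular) borel code_pt"

text \<open>Applying \<open>U\<close> to the coding point amounts to appending the next letter: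
  \<open>next_prob\<close> is its conditional law given the past, and on regular codes the coding
  point moves by the map of that letter. Invariance is thus the shift invariance of \<Lambda> on the
  regular set.\<close>

lemma limit_measure_invariant:
  assumes nd: "non_degenerate M pt v"
  shows "limit_measure \<in> invariant_measures M"
    and "AE x in limit_measure. x \<in> class_union M c"
proof -
  have R: "regular \<in> sets \<Lambda>" by (rule past_in_sets[OF regular_in_past])
  have pos: "emeasure \<Lambda> regular \<noteq> 0" by (rule regular_positive[OF nd])
  have U: "prob_space (uniform_measure \<Lambda> regular)"
    by (rule prob_space_uniform_measure[OF pos]) (simp add: \<Lambda>.emeasure_eq_measure)
  have sets_U: "sets (uniform_measure \<Lambda> regular) = sets \<Lambda>" by simp
  have pt_\<Lambda>: "code_pt \<in> borel_measurable \<Lambda>" by (rule measurable_past_\<Lambda>[OF measurable_code_pt])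
  then have pt_U: "code_pt \<in> borel_measurable (uniform_measure \<Lambda> regular)"
    by (simp only: measurable_cong_sets[OF sets_U refl])
  have prob: "prob_space limit_measure"
    unfolding limit_measure_def by (rule prob_space.prob_space_distr[OF U pt_U])
  have sets: "sets limit_measure = sets borel" by (simp add: limit_measure_def)
  have nn: "(\<integral>\<^sup>+x. f x \<partial>limit_measure) = (\<integral>\<^sup>+\<sigma>. f (code_pt \<sigma>) * indicator regular \<sigma> \<partial>\<Lambda>) / emeasure \<Lambda> regular"
    if f: "f \<in> borel_measurable borel" for f
  proof -
    have "(\<integral>\<^sup>+x. f x \<partial>limit_measure) = (\<integral>\<^sup>+\<sigma>. f (code_pt \<sigma>) \<partial>uniform_measure \<Lambda> regular)"
      unfolding limit_measure_def using f by (intro nn_integral_distr[OF pt_U]) simp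
    then show ?thesis
      using nn_integral_uniform_measure[OF measurable_compose[OF pt_\<Lambda> f] R] by simp
  qed
  have "markov_dual M limit_measure = limit_measure"
  proof (rule measure_eqI)
    fix B assume "B \<in> sets (markov_dual M limit_measure)"
    then have B: "B \<in> sets borel" by simp
    let ?B = "code_pt -` B"
    have B': "?B \<in> sets past_algebra" using measurable_sets[OF measurable_code_pt B] by simp
    have wB: "(\<lambda>\<sigma>. wmap M e (code_pt \<sigma>)) -` B \<in> sets past_algebra" for e
      using measurable_sets[OF measurable_compose[OF measurable_code_pt measurable_wmap] B] by simp
    let ?W = "\<lambda>e. regular \<inter> (\<lambda>\<sigma>. wmap M e (code_pt \<sigma>)) -` B"
    have W: "?W e \<in> sets past_algebra" for e by (intro sets.Int regular_in_past wB)
    let ?V = "\<lambda>e. ?W e \<inter> {\<sigma>. \<sigma> 1 = Some e}"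
    have V: "?V e \<in> sets \<Lambda>" for e by (intro sets.Int past_in_sets[OF W] next_in_sets)
    have ind: "indicator B \<in> borel_measurable borel" using B by (rule borel_measurable_indicator)
    have f: "(\<lambda>\<sigma>. ennreal (prb M e (code_pt \<sigma>)) * indicator (?W e) \<sigma>) \<in> borel_measurable \<Lambda>" for e
      by (intro borel_measurable_times_ennreal borel_measurable_indicator past_in_sets[OF W]
          measurable_compose[OF measurable_compose[OF pt_\<Lambda> measurable_prb] measurable_ennreal])
    have "(\<integral>\<^sup>+\<sigma>. markov_op M (indicator B) (code_pt \<sigma>) * indicator regular \<sigma> \<partial>\<Lambda>)
        = (\<integral>\<^sup>+\<sigma>. \<integral>\<^sup>+e. ennreal (prb M e (code_pt \<sigma>)) * indicator (?W e) \<sigma> \<partial>count_space UNIV \<partial>\<Lambda>)"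
    proof (rule nn_integral_cong)
      fix \<sigma>
      have "markov_op M (indicator B) (code_pt \<sigma>) * indicator regular \<sigma>
          = (\<integral>\<^sup>+e. ennreal (prb M e (code_pt \<sigma>)) * indicator B (wmap M e (code_pt \<sigma>)) * indicator regular \<sigma> \<partial>count_space UNIV)"
        by (simp add: markov_op_def infsum_ennreal_eq_nn_integral nn_integral_multc)
      also have "\<dots> = (\<integral>\<^sup>+e. ennreal (prb M e (code_pt \<sigma>)) * indicator (?W e) \<sigma> \<partial>count_space UNIV)"
        by (intro nn_integral_cong) (auto simp: indicator_def)
      finally show "markov_op M (indicator B) (code_pt \<sigma>) * indicator regular \<sigma>
          = (\<integral>\<^sup>+e. ennreal (prb M e (code_pt \<sigma>)) * indicator (?W e) \<sigma> \<partial>count_space UNIV)" .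
    qed
    also have "\<dots> = (\<integral>\<^sup>+e. \<integral>\<^sup>+\<sigma>. ennreal (prb M e (code_pt \<sigma>)) * indicator (?W e) \<sigma> \<partial>\<Lambda> \<partial>count_space UNIV)"
      using f by (intro nn_integral_count_space_nn_integral) auto
    \<comment> \<open>On regular codes the edge probability at the coding point is
      \<open>next_prob\<close>, and \<open>?W e\<close> is a past event, so its integral is the
      measure of the event followed by the letter \<open>e\<close>.\<close>
    also have "\<dots> = (\<integral>\<^sup>+e. emeasure \<Lambda> (?V e) \<partial>count_space UNIV)"
    proof (rule nn_integral_cong)
      fix e
      have "(\<integral>\<^sup>+\<sigma>. ennreal (prb M e (code_pt \<sigma>)) * indicator (?W e) \<sigma> \<partial>\<Lambda>)
          = (\<integral>\<^sup>+\<sigma>. ennreal (next_prob e \<sigma>) * indicator (?W e) \<sigma> \<partial>\<Lambda>)"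
        using AE_path_space
        by (intro nn_integral_cong_AE, eventually_elim) (auto simp: indicator_def next_prob_regular)
      then show "(\<integral>\<^sup>+\<sigma>. ennreal (prb M e (code_pt \<sigma>)) * indicator (?W e) \<sigma> \<partial>\<Lambda>) = emeasure \<Lambda> (?V e)"
        by (simp only: past_next_prob[OF W])
    qed
    also have "\<dots> = emeasure \<Lambda> (\<Union>e. ?V e)"
    proof (rule emeasure_UN_countable[symmetric])
      show "disjoint_family_on ?V UNIV" unfolding disjoint_family_on_def by force
    qed (simp_all only: V countableI_type)
    \<comment> \<open>For a regular code the letter at 1 moves the coding point into
      \<open>B\<close>; almost no irregular code becomes regular under the shift, so nothing is
      added on the right.\<close>
    also have "\<dots> = emeasure \<Lambda> (shift -` (regular \<inter> ?B))"
    proof (rule emeasure_eq_AE)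
      show "AE \<sigma> in \<Lambda>. (\<sigma> \<in> (\<Union>e. ?V e)) = (\<sigma> \<in> shift -` (regular \<inter> ?B))"
        using AE_path_space AE_regular_shift
      proof eventually_elim
        case (elim \<sigma>)
        have "\<sigma> (0 + 1) \<noteq> None" using elim(1) unfolding path_space_def by blast
        then obtain e where e: "\<sigma> 1 = Some e" by auto
        show ?case
        proof (cases "\<sigma> \<in> regular")
          case True
          then have "shift \<sigma> \<in> regular" "code_pt (shift \<sigma>) = wmap M e (code_pt \<sigma>)"
            using regular_step[OF True elim(1)] e by simp_all
          then show ?thesis using True e by simp
        next
          case False
          then have "shift \<sigma> \<notin> regular" using elim(2) by simp
          then show ?thesis using False by simp
        qed
      qed
      show "(\<Union>e. ?V e) \<in> sets \<Lambda>" using V by (intro sets.countable_UN' image_subsetI countableI_type)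
      show "shift -` (regular \<inter> ?B) \<in> sets \<Lambda>"
        using measurable_sets[OF measurable_shift_\<Lambda> sets.Int[OF R past_in_sets[OF B']]]
        by (simp only: space_\<Lambda> Int_UNIV_right)
    qed
    also have "\<dots> = emeasure \<Lambda> (regular \<inter> ?B)"
      by (rule emeasure_shift[OF sets.Int[OF R past_in_sets[OF B']]])
    also have "\<dots> = (\<integral>\<^sup>+\<sigma>. indicator B (code_pt \<sigma>) * indicator regular \<sigma> \<partial>\<Lambda>)"
    proof -
      have "emeasure \<Lambda> (regular \<inter> ?B) = (\<integral>\<^sup>+\<sigma>. indicator (regular \<inter> ?B) \<sigma> \<partial>\<Lambda>)"
        by (rule nn_integral_indicator[symmetric, OF sets.Int[OF R past_in_sets[OF B']]])
      then show ?thesis by (auto simp: indicator_def intro!: nn_integral_cong)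
    qed
    finally have "(\<integral>\<^sup>+x. markov_op M (indicator B) x \<partial>limit_measure) = (\<integral>\<^sup>+x. indicator B x \<partial>limit_measure)"
      unfolding nn[OF ind] nn[OF measurable_markov_op[OF ind]] by simp
    also have "(\<integral>\<^sup>+x. indicator B x \<partial>limit_measure) = emeasure limit_measure B"
      by (rule nn_integral_indicator) (simp only: sets B)
    finally show "emeasure (markov_dual M limit_measure) B = emeasure limit_measure B"
      by (simp only: emeasure_markov_dual[OF M sets B])
  qed (simp add: sets)
  then show "limit_measure \<in> invariant_measures M"
    using prob sets by (simp add: invariant_measures_def)
  have "AE \<sigma> in \<Lambda>. \<sigma> \<in> regular \<longrightarrow> code_pt \<sigma> \<in> class_union M c"
    using AE_tgt_class by eventually_elim (auto simp: regular_def class_union_def)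
  then have "AE \<sigma> in uniform_measure \<Lambda> regular. code_pt \<sigma> \<in> class_union M c"
    by (intro AE_uniform_measureI R)
  moreover have "class_union M c \<in> sets borel"
    unfolding class_union_def using countable_vertices by (intro sets.countable_UN') (auto intro: countable_subset)
  ultimately show "AE x in limit_measure. x \<in> class_union M c"
    unfolding limit_measure_def by (subst AE_distr_iff[OF pt_U]) simp_all
qed

end

section \<open>Existence on generating classes and the entropy formula\<close>

context contractive_markov
begin

lemma class_invariant_measure_exists:
  assumes nd: "non_degenerate M pt v" and dom: "dominating_markov_chain M"
    and gen: "generating_point M x" and c: "c \<in> essential_classes M" and x: "x \<in> class_union M c"
  obtains \<mu> where "\<mu> \<in> invariant_measures M" "AE x in \<mu>. x \<in> class_union M c"
proof (rule stationary_code_measure[OF dom gen c x])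
  fix Q assume Q: "prob_space Q" "sets Q = sets seqs" "distr Q seqs shift_seq = Q"
    and gap: "\<And>L. (\<integral>\<^sup>+\<tau>. ennreal (gap L \<tau>) \<partial>Q) \<le> ennreal (2 * height_bound x * a ^ L)"
    and trans: "\<And>e \<epsilon>. 0 < \<epsilon> \<Longrightarrow> \<exists>L0. \<forall>L\<ge>L0. \<forall>X.
      \<bar>measure Q {\<tau>. map \<tau> [0..<L] \<in> X \<and> \<tau> L = Some e} - (\<integral>\<tau>. transition e X L \<tau> \<partial>Q)\<bar> \<le> \<epsilon>"
    and null: "\<And>w. (\<And>y. y \<in> class_union M c \<Longrightarrow> cyl_prob M w y = 0) \<Longrightarrow> measure Q (cylinder w) = 0"
  obtain \<Lambda> where \<Lambda>: "prob_space \<Lambda>" "sets \<Lambda> = sets biseqs" "\<And>m. distr \<Lambda> seqs (window m) = Q"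
    using two_sided_extension_exists[OF Q] by blast
  have C: "0 \<le> 2 * height_bound x" using height_bound(1)[of x] by simp
  have "code_measure_axioms M pt v a c (2 * height_bound x) Q \<Lambda>"
    by (rule code_measure_axioms.intro[OF c C Q(1,2) \<Lambda> gap trans null])
  then have code: "code_measure M pt v a b c (2 * height_bound x) Q \<Lambda>"
    by (rule code_measure.intro[OF contractive_markov_axioms])
  show thesis
    by (rule that[OF code_measure.limit_measure_invariant[OF code nd]])
qed

end

theorem corollary2:
  fixes M :: "('a::complete_space, 'v, 'e::countable) markov_sys"
    and pt :: "'v \<Rightarrow> 'a" and v :: 'v
  assumes "markov_system M"
    and "\<forall>j. pt j \<in> vert M j"
    and "uniformly_continuous_system M"
    and "non_degenerate M pt v"
    and "contractive M"
    and "absolute_continuity_condition M"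
    and "bounded_displacement M pt"
    and "dominating_markov_chain M"
    and "bounded_entropy M"
  shows "\<forall>c\<in>generating_classes M. \<exists>\<mu>. ergodic_measure M \<mu> \<and>
    (\<forall>x\<in>class_union M c. AE \<sigma> in path_measure M x.
      (\<lambda>n. 1 / real n * ln (measure (path_measure M x) (cyl_plus (map \<sigma> [0..<n]))))
        \<longlonglongrightarrow> (\<Sum>\<^sub>\<infinity>e. LINT y:vert M (src M e)|\<mu>. prb M e y * ln (prb M e y)))"
proof
  fix c assume "c \<in> generating_classes M"
  then obtain j x where c: "c \<in> essential_classes M" and j: "j \<in> c" "x \<in> vert M j" "generating_point M x"
    by (auto simp: generating_classes_def generating_vertex_def)
  then have x: "x \<in> class_union M c" by (auto simp: class_union_def)
  obtain a where a: "0 < a" "a < 1" and con: "\<And>j x y. x \<in> vert M j \<Longrightarrow> y \<in> vert M j \<Longrightarrow>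
      (\<Sum>\<^sub>\<infinity>e\<in>{e. src M e = j}. ennreal (prb M e x * dist (wmap M e x) (wmap M e y))) \<le> ennreal (a * dist x y)"
    using assms(5) unfolding contractive_def by blast
  \<comment> \<open>The displacement supremum supplies the constant \<open>b\<close> of the drift as
    \<open>enn2real s\<close>; its finiteness makes that conversion faithful.\<close>
  define s where "s = (SUP j. SUP x\<in>vert M j. \<Sum>\<^sub>\<infinity>e\<in>{e. src M e = j}.
      ennreal (prb M e x * dist (wmap M e (pt (src M e))) (pt (tgt M e))))"
  have s: "s < \<infinity>" using assms(7) by (simp add: bounded_displacement_def s_def)
  have disp: "(\<Sum>\<^sub>\<infinity>e\<in>{e. src M e = j}. ennreal (prb M e x * dist (wmap M e (pt (src M e))) (pt (tgt M e))))
      \<le> ennreal (enn2real s)" if "x \<in> vert M j" for x j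
  proof -
    have "(\<Sum>\<^sub>\<infinity>e\<in>{e. src M e = j}. ennreal (prb M e x * dist (wmap M e (pt (src M e))) (pt (tgt M e)))) \<le> s"
      unfolding s_def using that by (intro SUP_upper2[of j] SUP_upper) auto
    then show ?thesis using s by (simp add: less_top)
  qed
  have pt: "pt j \<in> vert M j" for j using assms(2) by simp
  have markov: "markov M" by (rule markov.intro[OF assms(1)])
  have "contractive_markov M pt a (enn2real s)"
    by (intro contractive_markov.intro[OF markov] contractive_markov_axioms.intro pt a enn2real_nonneg con disp assms(3))
  from contractive_markov.class_invariant_measure_exists[OF this assms(4,8) j(3) c x]
  obtain \<mu> where \<mu>: "\<mu> \<in> invariant_measures M" "AE x in \<mu>. x \<in> class_union M c" .
  show "\<exists>\<mu>. ergodic_measure M \<mu> \<and>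
    (\<forall>x\<in>class_union M c. AE \<sigma> in path_measure M x.
      (\<lambda>n. 1 / real n * ln (measure (path_measure M x) (cyl_plus (map \<sigma> [0..<n]))))
        \<longlonglongrightarrow> (\<Sum>\<^sub>\<infinity>e. LINT y:vert M (src M e)|\<mu>. prb M e y * ln (prb M e y)))"
  proof (intro exI conjI ballI)
    show "ergodic_measure M \<mu>"
      by (rule markov.ergodic_measure_class[OF markov assms(6,5) c \<mu>])
  qed (rule markov.entropy_limit[OF markov assms(6,9) c \<mu>])
qed

end
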